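(* Fix $1\le p_0<q<q_0\le\infty$ and $\mathbb B\in O(p_0,q_0)$. Let $f\in L^{p_0}_{loc}(\mathbb R^n)$ and let $a$ be a functional such that $(\fint_{2^kQ}|B_Qf|^{p_0}dx)^{1/p_0}\le a(2^kQ)$ for every integer $k\ge0$ and every cube $Q$. Let $w\in RH_{(q_0/q)'}$ (with $RH_1:=A_\infty$, so that when $q_0=\infty$ this means $w\in A_\infty$). There is a constant $C_0>0$ depending only on $n,p_0,C_{p_0},(\alpha_k),(\beta_k)$ such that if $\tilde\gamma_k\ge C_0m_k$ for all $k\ge1$, $\tilde a(Q)=\sum_{k\ge1}\tilde\gamma_ka(2^kQ)$, and $\tilde a\in D_q(w)$, then for every cube $Q$, $$\|B_Qf\|_{L^{q,\infty}(w),Q}\le C\,\tilde a(2Q),$$ with $C$ independent of $Q$ and $f$.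
   Context: Cubes $Q=\prod_i[a_i,a_i+\ell(Q))$; $\lambda Q$ is the concentric cube of sidelength $\lambda\ell(Q)$; $\mathcal Q$ is the set of all cubes; $\fint_Eg=|E|^{-1}\int_Eg$. A weight is a nonnegative locally integrable $w$, $w(E)=\int_Ew$; $\|g\|_{L^{q,\infty}(w),Q}=\sup_{t>0}t\,(w(\{x\in Q:|g(x)|>t\})/w(Q))^{1/q}$. $w\in RH_p$ ($1<p<\infty$) if $(\fint_Qw^p)^{1/p}\le C\fint_Qw$ for all cubes; $A_\infty=\bigcup_{p\ge1}A_p$ is the Muckenhoupt class. A functional is a map $\mathcal Q\to[0,\infty)$; $a\in D_q(w)$ means there is $C\ge1$ with $\sum_ia(Q_i)^qw(Q_i)\le C^qa(Q)^qw(Q)$ for every cube $Q$ and pairwise disjoint cubes $Q_i\subset Q$. $\mathbb B=(B_Q)$ are linear operators on $L^{p_0}_{loc}(\mathbb R^n)$, $A_Q=I-B_Q$; $\mathbb B\in O(p_0,q_0)$ means: (a) $B_QB_R=B_RB_Q$ for all $Q,R$; (b) $\|B_Qf\|_{L^{p_0}(\mathbb R^n)}\le C_{p_0}\|f\|_{L^{p_0}(\mathbb R^n)}$ for all $Q$; (c) there are $\alpha_k\ge0$ ($k\ge2$) with $\sum_k2^{kn/p_0}\alpha_k<\infty$ such that $(\fint_{2Q}|A_Q(f\chi_{4Q})|^{q_0})^{1/q_0}\le\alpha_2(\fint_{4Q}|f|^{p_0})^{1/p_0}$ and, for $j\ge1$, $(\fint_{2^jQ}|A_Q(f\chi_{\mathbb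 R^n\setminus2^{j+1}Q})|^{q_0})^{1/q_0}\le\sum_{k\ge2}\alpha_{k+j}(\fint_{2^{k+j}Q}|f|^{p_0})^{1/p_0}$; (d) there are $\beta_k\ge0$ with $\sum\beta_k<\infty$ such that for cubes $R\subset Q$, $(\fint_{2R}|B_RA_Qf|^{q_0})^{1/q_0}\le\sum_{k\ge1}\beta_{k+1}(\fint_{2^{k+1}Q}|f|^{p_0})^{1/p_0}$ (essential suprema when $q_0=\infty$). The numbers $m_k$: $m_1=1$, $m_2=\max\{1,\alpha_2,\alpha_3\}$, $m_3=\max\{\alpha_2,\alpha_3,\alpha_4\}$, $m_4=\max\{\alpha_3,\alpha_4,\alpha_5,\beta_2\}$, $m_k=\max\{\alpha_{k-2},2^{kn/p_0}\alpha_{k-1},2^{kn/p_0}\alpha_k,\alpha_{k+1},\beta_{k-3},\beta_{k-2}\}$ for $k\ge5$. *)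

theory Defs
  imports "HOL-Analysis.Analysis"
begin

text \<open>A cube is represented by its lower corner a and its sidelength l > 0;
  the cube itself is the half-open product of intervals [a_i, a_i + l).\<close>

type_synonym ('n) cube = "(real^('n::finite)) \<times> real"

definition cubes :: "('n::finite) cube set" where
  "cubes = {Q. snd Q > 0}"

definition cube_set :: "('n::finite) cube \<Rightarrow> (real^('n::finite)) set" where
  "cube_set Q = {x. \<forall>i. fst Q $ i \<le> x $ i \<and> x $ i < fst Q $ i + snd Q}"

text \<open>The concentric dilate t Q (sidelength t * l(Q), same centre).\<close>
definition dil :: "real \<Rightarrow> ('n::finite) cube \<Rightarrow> ('n::finite) cube" where
  "dil t Q = (fst Q + (\<chi> i. (1 - t) * snd Q / 2), t * snd Q)"

text \<open>Positive real power of an extended nonnegative real (r > 0).\<close>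
definition enn_powr :: "ennreal \<Rightarrow> real \<Rightarrow> ennreal" where
  "enn_powr x r = (if x = \<infinity> then \<infinity> else ennreal (enn2real x powr r))"

definition avgE :: "(real^('n::finite)) set \<Rightarrow> ((real^('n::finite)) \<Rightarrow> ennreal) \<Rightarrow> ennreal" where
  "avgE E h = (\<integral>\<^sup>+ x\<in>E. h x \<partial>lebesgue) / emeasure lebesgue E"

definition avgLp :: "real \<Rightarrow> (real^('n::finite)) set \<Rightarrow> ((real^('n::finite)) \<Rightarrow> 'b::real_normed_vector) \<Rightarrow> ennreal" where
  "avgLp p E g = enn_powr (avgE E (\<lambda>x. ennreal (norm (g x) powr p))) (1 / p)"

definition esssup_on :: "(real^('n::finite)) set \<Rightarrow> ((real^('n::finite)) \<Rightarrow> 'b::real_normed_vector) \<Rightarrow> ennreal" where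
  "esssup_on E g = Inf {C. AE x in lebesgue. x \<in> E \<longrightarrow> ennreal (norm (g x)) \<le> C}"

definition avgq :: "ennreal \<Rightarrow> (real^('n::finite)) set \<Rightarrow> ((real^('n::finite)) \<Rightarrow> 'b::real_normed_vector) \<Rightarrow> ennreal" where
  "avgq q E g = (if q = \<infinity> then esssup_on E g else avgLp (enn2real q) E g)"

definition Lpnorm :: "real \<Rightarrow> ((real^('n::finite)) \<Rightarrow> 'b::real_normed_vector) \<Rightarrow> ennreal" where
  "Lpnorm p g = enn_powr (\<integral>\<^sup>+ x. ennreal (norm (g x) powr p) \<partial>lebesgue) (1 / p)"

definition Lploc :: "real \<Rightarrow> ((real^('n::finite)) \<Rightarrow> 'b::real_normed_vector) \<Rightarrow> bool" where
  "Lploc p f \<longleftrightarrow> f \<in> borel_measurable lebesgue \<and>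
     (\<forall>Q\<in>cubes. (\<integral>\<^sup>+ x\<in>cube_set Q. ennreal (norm (f x) powr p) \<partial>lebesgue) < \<infinity>)"

definition weight :: "((real^('n::finite)) \<Rightarrow> real) \<Rightarrow> bool" where
  "weight w \<longleftrightarrow> (\<forall>x. 0 \<le> w x) \<and> Lploc 1 w"

definition wmeas :: "((real^('n::finite)) \<Rightarrow> real) \<Rightarrow> (real^('n::finite)) set \<Rightarrow> ennreal" where
  "wmeas w E = (\<integral>\<^sup>+ x\<in>E. ennreal (w x) \<partial>lebesgue)"

definition RH :: "real \<Rightarrow> ((real^('n::finite)) \<Rightarrow> real) \<Rightarrow> bool" where
  "RH p w \<longleftrightarrow> weight w \<and>
     (\<exists>C. \<forall>Q\<in>cubes. avgLp p (cube_set Q) w \<le> ennreal C * avgLp 1 (cube_set Q) w)"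

text \<open>Muckenhoupt A_1: avg_Q w \<le> C w(x) for a.e. x in Q (equivalently M w \<le> C w a.e.).\<close>
definition A1 :: "((real^('n::finite)) \<Rightarrow> real) \<Rightarrow> bool" where
  "A1 w \<longleftrightarrow> weight w \<and>
     (\<exists>C. \<forall>Q\<in>cubes. AE x in lebesgue. x \<in> cube_set Q \<longrightarrow>
          avgE (cube_set Q) (\<lambda>y. ennreal (w y)) \<le> ennreal (C * w x))"

text \<open>Muckenhoupt A_p (1 < p < \<infinity>):
  sup_Q (avg_Q w)(avg_Q w^(1-p'))^(p-1) < \<infinity>, where w^(1-p') = w^(-1/(p-1)) (= \<infinity> where w = 0).\<close>
definition Ap :: "real \<Rightarrow> ((real^('n::finite)) \<Rightarrow> real) \<Rightarrow> bool" where
  "Ap p w \<longleftrightarrow> weight w \<and>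
     (\<exists>C. \<forall>Q\<in>cubes.
        avgE (cube_set Q) (\<lambda>y. ennreal (w y)) *
        enn_powr (avgE (cube_set Q)
                   (\<lambda>y. if w y = 0 then \<infinity> else ennreal (w y powr (- 1 / (p - 1))))) (p - 1)
        \<le> ennreal C)"

definition Ainf :: "((real^('n::finite)) \<Rightarrow> real) \<Rightarrow> bool" where
  "Ainf w \<longleftrightarrow> A1 w \<or> (\<exists>p>1. Ap p w)"

definition weakLq :: "((real^('n::finite)) \<Rightarrow> real) \<Rightarrow> real \<Rightarrow> ('n::finite) cube \<Rightarrow> ((real^('n::finite)) \<Rightarrow> 'b::real_normed_vector) \<Rightarrow> ennreal" where
  "weakLq w q Q g = (SUP t\<in>{0<..}. ennreal t *
      enn_powr (wmeas w {x \<in> cube_set Q. norm (g x) > t} / wmeas w (cube_set Q)) (1 / q))"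

definition functional :: "(('n::finite) cube \<Rightarrow> real) \<Rightarrow> bool" where
  "functional a \<longleftrightarrow> (\<forall>Q\<in>cubes. 0 \<le> a Q)"

definition Dq :: "real \<Rightarrow> ((real^('n::finite)) \<Rightarrow> real) \<Rightarrow> (('n::finite) cube \<Rightarrow> real) \<Rightarrow> bool" where
  "Dq q w a \<longleftrightarrow> (\<exists>C\<ge>1. \<forall>Q\<in>cubes. \<forall>S. S \<subseteq> cubes \<and> (\<forall>R\<in>S. cube_set R \<subseteq> cube_set Q)
        \<and> disjoint_family_on cube_set S \<longrightarrow>
        infsum (\<lambda>R. ennreal (a R powr q) * wmeas w (cube_set R)) S
          \<le> ennreal (C powr q * a Q powr q) * wmeas w (cube_set Q))"

type_synonym 'n op = "((real^('n::finite)) \<Rightarrow> complex) \<Rightarrow> ((real^('n::finite)) \<Rightarrow> complex)"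

text \<open>Linear operator on L^{p0}_loc (acting on a.e.-classes).\<close>
definition linear_loc :: "real \<Rightarrow> ('n::finite) op \<Rightarrow> bool" where
  "linear_loc p T \<longleftrightarrow>
     (\<forall>f. Lploc p f \<longrightarrow> Lploc p (T f)) \<and>
     (\<forall>f g. Lploc p f \<longrightarrow> Lploc p g \<longrightarrow> (AE x in lebesgue. f x = g x) \<longrightarrow>
        (AE x in lebesgue. T f x = T g x)) \<and>
     (\<forall>f g. Lploc p f \<longrightarrow> Lploc p g \<longrightarrow>
        (AE x in lebesgue. T (\<lambda>y. f y + g y) x = T f x + T g x)) \<and>
     (\<forall>f c. Lploc p f \<longrightarrow> (AE x in lebesgue. T (\<lambda>y. c * f y) x = c * T f x))"

definition Aop :: "(('n::finite) cube \<Rightarrow> ('n::finite) op) \<Rightarrow> ('n::finite) cube \<Rightarrow> ('n::finite) op" where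
  "Aop B Q f = (\<lambda>x. f x - B Q f x)"

definition O_class :: "real \<Rightarrow> ennreal \<Rightarrow> real \<Rightarrow> (nat \<Rightarrow> real) \<Rightarrow> (nat \<Rightarrow> real)
    \<Rightarrow> (('n::finite) cube \<Rightarrow> ('n::finite) op) \<Rightarrow> bool" where
  "O_class p0 q0 Cp0 \<alpha> \<beta> B \<longleftrightarrow>
     (\<forall>Q\<in>cubes. linear_loc p0 (B Q)) \<and>
     \<comment> \<open>(a) commutation\<close>
     (\<forall>Q\<in>cubes. \<forall>R\<in>cubes. \<forall>f. Lploc p0 f \<longrightarrow>
        (AE x in lebesgue. B Q (B R f) x = B R (B Q f) x)) \<and>
     \<comment> \<open>(b) uniform L^{p0} boundedness\<close>
     (\<forall>Q\<in>cubes. \<forall>f. Lploc p0 f \<longrightarrow> Lpnorm p0 (B Q f) \<le> ennreal Cp0 * Lpnorm p0 f) \<and>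
     \<comment> \<open>(c) off-diagonal estimates for A_Q\<close>
     (\<forall>k\<ge>2. 0 \<le> \<alpha> k) \<and>
     summable (\<lambda>k. 2 powr (real k * real CARD('n) / p0) * \<alpha> k) \<and>
     (\<forall>Q\<in>cubes. \<forall>f. Lploc p0 f \<longrightarrow>
        avgq q0 (cube_set (dil 2 Q))
           (Aop B Q (\<lambda>x. if x \<in> cube_set (dil 4 Q) then f x else 0))
        \<le> ennreal (\<alpha> 2) * avgLp p0 (cube_set (dil 4 Q)) f) \<and>
     (\<forall>Q\<in>cubes. \<forall>f. \<forall>j::nat. j \<ge> 1 \<longrightarrow> Lploc p0 f \<longrightarrow>
        avgq q0 (cube_set (dil (2 ^ j) Q))
           (Aop B Q (\<lambda>x. if x \<in> cube_set (dil (2 ^ (j + 1)) Q) then 0 else f x))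
        \<le> (\<Sum>k. ennreal (\<alpha> (k + 2 + j)) * avgLp p0 (cube_set (dil (2 ^ (k + 2 + j)) Q)) f)) \<and>
     \<comment> \<open>(d)\<close>
     (\<forall>k\<ge>2. 0 \<le> \<beta> k) \<and> summable \<beta> \<and>
     (\<forall>Q\<in>cubes. \<forall>R\<in>cubes. cube_set R \<subseteq> cube_set Q \<longrightarrow> (\<forall>f. Lploc p0 f \<longrightarrow>
        avgq q0 (cube_set (dil 2 R)) (B R (Aop B Q f))
        \<le> (\<Sum>k. ennreal (\<beta> (k + 2)) * avgLp p0 (cube_set (dil (2 ^ (k + 2)) Q)) f)))"

definition mk :: "nat \<Rightarrow> real \<Rightarrow> (nat \<Rightarrow> real) \<Rightarrow> (nat \<Rightarrow> real) \<Rightarrow> nat \<Rightarrow> real" where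
  "mk n p0 \<alpha> \<beta> k =
    (if k = 1 then 1
     else if k = 2 then Max {1, \<alpha> 2, \<alpha> 3}
     else if k = 3 then Max {\<alpha> 2, \<alpha> 3, \<alpha> 4}
     else if k = 4 then Max {\<alpha> 3, \<alpha> 4, \<alpha> 5, \<beta> 2}
     else if k \<ge> 5 then Max {\<alpha> (k - 2), 2 powr (real k * real n / p0) * \<alpha> (k - 1),
                              2 powr (real k * real n / p0) * \<alpha> k, \<alpha> (k + 1),
                              \<beta> (k - 3), \<beta> (k - 2)}
     else 0)"

definition atilde :: "(nat \<Rightarrow> real) \<Rightarrow> (('n::finite) cube \<Rightarrow> real) \<Rightarrow> ('n::finite) cube \<Rightarrow> real" where
  "atilde \<gamma> a Q = (\<Sum>k. \<gamma> (k + 1) * a (dil (2 ^ (k + 1)) Q))"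

end

(* Fix a cube Q, put F = B_Q f and let Om_t be the union of the dyadic subcubes P of Q on whose double
   the L^{p0} average of F exceeds t. A maximal such cube R is either bad, atilde(R) > eps t, and D_q bounds
   the total weight of the bad ones; or on 2R one writes F = S + G with
     S = B_R B_R f,    G = A_R F + A_R B_R F - B_R A_Q B_R f    (by commutation).
   The average of S is at most a multiple of atilde(R) by (c) at scale R. The L^{q0} average of G is at most a
   multiple of t: for the first two terms by (c) and maximality of R, for the last one by (d) applied to B_R f,
   whose averages over 2^k Q are controlled by a on the dilates of the cube S' concentric with R and of the
   size of Q; S' lies in 2Q, so D_q and doubling give atilde(S') <= C atilde(2Q).
   This yields kappa^q w(Om_{kappa t}) <= w(Om_t)/2 + (bad part) for some kappa = kappa(t) in a bounded range,
   and iterating it along t, kappa t, ... gives the weak-type bound. Letting kappa depend on t avoids Gehring's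
   lemma: the L^{q0} bound on G makes the averages over dyadic kappa small, so some kappa is good.
   The theorem holds with C0 = 1, since the final constant may depend on everything but f and Q. *)

theory Submission
  imports Defs
begin

(* As a simp rule it would turn lebesgue into lborel and hide the measurability of cubes behind main_part. *)
declare emeasure_completion [simp del]

subsection \<open>Cubes\<close>

text \<open>The hypothesis on \<open>a\<close> controls averages of \<open>B Q f\<close> only, never
  those of \<open>f\<close>. Comparing F directly with B_R f on a maximal cube R leaves the error
  B_R A_Q f, for which (d) asks for averages of \<open>f\<close>. Comparing it with B_R B_R f puts
  B_R f in the place of \<open>f\<close> there. The price is the further error A_R B_R F, which
  needs averages of F and of B_R F over all dilates of R. Up to the size of Q, maximality of R
  bounds those of F; beyond it they are compared with averages over dilates of Q, and the change of
  volume costs 2^(kn/p0). This is where such factors in m_k come in. Apart from D_q, the weight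
  enters only through two conditions: small sets have small weight, and level sets decay on average.
  Finite and infinite q0 therefore share the good-lambda step and all that follows it. The term
  w(Om_t)/2 cannot be absorbed into a supremum over t, which is not known to be finite. The
  iteration starts instead at a height t0 just above a multiple of atilde(2Q), where w(Q) is a
  trivial bound.\<close>

lemma snd_dil [simp]: "snd (dil t Q) = t * snd Q"
  by (simp add: dil_def)

lemma fst_dil: "fst (dil t Q) $ i = fst Q $ i + (1 - t) * snd Q / 2"
  by (simp add: dil_def)

lemma dil_in_cubes [simp]: "Q \<in> cubes \<Longrightarrow> t > 0 \<Longrightarrow> dil t Q \<in> cubes"
  by (simp add: cubes_def)

lemma dil_1 [simp]: "dil 1 Q = Q"
  by (simp add: dil_def prod_eq_iff vec_eq_iff)

lemma dil_dil: "dil s (dil t Q) = dil (s * t) Q"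
  by (simp add: dil_def prod_eq_iff vec_eq_iff field_simps)

lemma cube_set_borel: "cube_set Q \<in> sets borel"
proof -
  have "cube_set Q = (\<Inter>i. {x. fst Q $ i \<le> x $ i} \<inter> {x. x $ i < fst Q $ i + snd Q})"
    by (auto simp: cube_set_def)
  moreover have "\<dots> \<in> sets borel"
    by (intro sets.countable_INT'' sets.Int) 
      (auto intro!: borel_closed borel_open closed_halfspace_component_ge_cart open_halfspace_component_lt_cart)
  ultimately show ?thesis by simp
qed

lemma cube_set_lebesgue [measurable, simp]: "cube_set Q \<in> sets lebesgue"
  by (metis cube_set_borel sets_completionI_sets sets_lborel)

lemma emeasure_cube_set:
  fixes Q :: "('n::finite) cube"
  assumes "Q \<in> cubes"
  shows "emeasure lebesgue (cube_set Q) = ennreal (snd Q ^ CARD('n))"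
proof -
  let ?b = "fst Q + (\<chi> i. snd Q)"
  have l: "snd Q > 0" using assms by (simp add: cubes_def)
  have 1: "box (fst Q) ?b \<subseteq> cube_set Q"
    by (auto simp: mem_box_cart cube_set_def less_imp_le)
  have 2: "cube_set Q \<subseteq> cbox (fst Q) ?b"
    by (auto simp: mem_box_cart cube_set_def less_imp_le)
  have inner: "(fst Q) \<bullet> b \<le> ?b \<bullet> b" if "b \<in> Basis" for b
    using l that by (auto simp: Basis_vec_def inner_axis)
  have prod: "(\<Prod>b\<in>Basis. (?b - fst Q) \<bullet> b) = snd Q ^ CARD('n)"
  proof -
    have "(\<Prod>b\<in>(Basis::(real^'n) set). (?b - fst Q) \<bullet> b) = (\<Prod>b\<in>(Basis::(real^'n) set). snd Q)"
      by (rule prod.cong) (auto simp: Basis_vec_def inner_axis)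
    then show ?thesis by simp
  qed
  have 3: "emeasure lebesgue (box (fst Q) ?b) = ennreal (snd Q ^ CARD('n))"
    using emeasure_lborel_box_eq[of "fst Q" ?b] inner prod by (auto simp: emeasure_completion)
  have 4: "emeasure lebesgue (cbox (fst Q) ?b) = ennreal (snd Q ^ CARD('n))"
    using emeasure_lborel_cbox_eq[of "fst Q" ?b] inner prod by (auto simp: emeasure_completion)
  show ?thesis
    using emeasure_mono[OF 1, of lebesgue] emeasure_mono[OF 2, of lebesgue] 3 4 by auto
qed

lemma mem_cube_set_dil:
  "x \<in> cube_set (dil t Q) \<longleftrightarrow>
    (\<forall>i. fst Q $ i + (1 - t) * snd Q / 2 \<le> x $ i \<and> x $ i < fst Q $ i + (1 + t) * snd Q / 2)"
proof -
  have "fst Q $ i + (1 - t) * snd Q / 2 + t * snd Q = fst Q $ i + (1 + t) * snd Q / 2" for i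
    by (simp add: field_simps)
  then show ?thesis by (simp only: cube_set_def fst_dil snd_dil mem_Collect_eq)
qed

lemma dil_subset:
  assumes "\<And>i. fst Q $ i + (1 - t) * snd Q / 2 \<le> fst R $ i + (1 - s) * snd R / 2"
    and "\<And>i. fst R $ i + (1 + s) * snd R / 2 \<le> fst Q $ i + (1 + t) * snd Q / 2"
  shows "cube_set (dil s R) \<subseteq> cube_set (dil t Q)"
  unfolding subset_iff mem_cube_set_dil using assms by (meson order_trans less_le_trans)

text \<open>Inclusion of the underlying sets, in coordinates.\<close>

definition subcube :: "('n::finite) cube \<Rightarrow> 'n cube \<Rightarrow> bool" where
  "subcube R Q \<longleftrightarrow> (\<forall>i. fst Q $ i \<le> fst R $ i \<and> fst R $ i + snd R \<le> fst Q $ i + snd Q)"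

lemma subcube_imp_subset: "subcube R Q \<Longrightarrow> cube_set R \<subseteq> cube_set Q"
  unfolding subcube_def cube_set_def by (auto intro: order_trans less_le_trans)

lemma subcube_snd_le:
  assumes "subcube R Q"
  shows "snd R \<le> snd Q"
proof -
  obtain i :: 'a where True by simp
  have "fst Q $ i \<le> fst R $ i" "fst R $ i + snd R \<le> fst Q $ i + snd Q"
    using assms by (auto simp: subcube_def)
  then show ?thesis by linarith
qed

text \<open>Dilation pushes each face outward by \<open>(t - 1) / 2\<close> times the sidelength, so
  the larger cube moves at least as far. For \<open>t < 1\<close> the faces would move inward and
  the inclusion could fail.\<close>

lemma subcube_dil:
  assumes "subcube R Q" "t \<ge> 1"
  shows "subcube (dil t R) (dil t Q)"
proof -
  have "(t - 1) * snd R \<le> (t - 1) * snd Q"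
    using assms(2) subcube_snd_le[OF assms(1)] by (intro mult_left_mono) auto
  then have "t * snd R \<le> t * snd Q - snd Q + snd R" by (simp add: algebra_simps)
  then have le: "(snd Q - t * snd Q) / 2 \<le> (snd R - t * snd R) / 2" by simp
  show ?thesis
    unfolding subcube_def
  proof (intro allI conjI)
    fix i
    have i: "fst Q $ i \<le> fst R $ i" "fst R $ i + snd R \<le> fst Q $ i + snd Q"
      using assms(1) by (auto simp: subcube_def)
    show "fst (dil t Q) $ i \<le> fst (dil t R) $ i"
      unfolding fst_dil left_diff_distrib mult_1 using le i(1) by (rule add_mono[rotated])
    have e: "x + (snd P - t * snd P) / 2 + t * snd P = x + snd P - (snd P - t * snd P) / 2" for x and P :: "'a cube"
      by (simp add: field_simps)
    show "fst (dil t R) $ i + snd (dil t R) \<le> fst (dil t Q) $ i + snd (dil t Q)"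
      unfolding fst_dil snd_dil left_diff_distrib mult_1 e using le i(2) by linarith
  qed
qed

lemma subcube_dil_dil: "s \<le> t \<Longrightarrow> Q \<in> cubes \<Longrightarrow> subcube (dil s Q) (dil t Q)"
  unfolding subcube_def fst_dil snd_dil cubes_def
  by (auto simp: field_simps)

lemma subcube_dil_self: "1 \<le> t \<Longrightarrow> Q \<in> cubes \<Longrightarrow> subcube Q (dil t Q)"
  using subcube_dil_dil[of 1 t Q] by simp

text \<open>Continuity from below along an enumeration of \<open>I\<close>. Both the Vitali argument
  and D_q deliver bounds for finite families; this carries them over to countable unions.\<close>

lemma emeasure_UN_le_of_finite:
  assumes "countable I" and X: "\<And>i. i \<in> I \<Longrightarrow> X i \<in> sets M"
    and fin: "\<And>F. finite F \<Longrightarrow> F \<subseteq> I \<Longrightarrow> emeasure M (\<Union>i\<in>F. X i) \<le> b"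
  shows "emeasure M (\<Union>i\<in>I. X i) \<le> b"
proof (cases "I = {}")
  case False
  let ?f = "from_nat_into I"
  define A where "A n = (\<Union>i\<in>?f ` {..n}. X i)" for n
  have r: "range ?f = I" using False assms(1) by (simp add: range_from_nat_into)
  have sub: "?f ` {..n} \<subseteq> I" for n using r by blast
  have "(\<Union>i\<in>I. X i) = (\<Union>n. A n)"
  proof -
    have "(\<Union>n. A n) = (\<Union>i\<in>range ?f. X i)" unfolding A_def by auto
    then show ?thesis using r by simp
  qed
  moreover have "emeasure M (\<Union>n. A n) = (SUP n. emeasure M (A n))"
  proof (rule SUP_emeasure_incseq[symmetric])
    show "range A \<subseteq> sets M" unfolding A_def using sub X by (force intro!: sets.finite_UN)
    show "incseq A" unfolding A_def by (intro monoI UN_mono image_mono) auto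
  qed
  moreover have "emeasure M (A n) \<le> b" for n
    unfolding A_def by (rule fin) (use sub in auto)
  ultimately show ?thesis by (simp add: SUP_le_iff)
qed (use fin[of "{}"] in auto)

lemma set_nn_integral_density:
  assumes "g \<in> borel_measurable M" "A \<in> sets M"
  shows "(\<integral>\<^sup>+x\<in>A. g x \<partial>M) = emeasure (density M g) A"
  using assms by (simp add: emeasure_density)

subsection \<open>Dyadic subcubes\<close>

text \<open>The dyadic cell of generation \<open>j\<close> of the grid generated by \<open>Q\<close> that contains \<open>x\<close>.\<close>

definition dy :: "('n::finite) cube \<Rightarrow> nat \<Rightarrow> real^'n \<Rightarrow> 'n cube" where
  "dy Q j x = (\<chi> i. fst Q $ i + of_int \<lfloor>(x $ i - fst Q $ i) * 2 ^ j / snd Q\<rfloor> * (snd Q / 2 ^ j), snd Q / 2 ^ j)"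

lemma snd_dy [simp]: "snd (dy Q j x) = snd Q / 2 ^ j"
  by (simp add: dy_def)

lemma fst_dy: "fst (dy Q j x) $ i = fst Q $ i + of_int \<lfloor>(x $ i - fst Q $ i) * 2 ^ j / snd Q\<rfloor> * (snd Q / 2 ^ j)"
  by (simp add: dy_def)

lemma dy_in_cubes [simp]: "Q \<in> cubes \<Longrightarrow> dy Q j x \<in> cubes"
  by (simp add: cubes_def)

text \<open>Membership becomes equality of integer parts, an equivalence relation between the two
  points; hence the cells of one generation partition the space.\<close>

lemma mem_dy_iff:
  assumes "Q \<in> cubes"
  shows "y \<in> cube_set (dy Q j x) \<longleftrightarrow>
    (\<forall>i. \<lfloor>(y $ i - fst Q $ i) * 2 ^ j / snd Q\<rfloor> = \<lfloor>(x $ i - fst Q $ i) * 2 ^ j / snd Q\<rfloor>)"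
proof -
  have l: "snd Q / 2 ^ j > 0" using assms by (simp add: cubes_def)
  have "(fst Q $ i + of_int m * (snd Q / 2 ^ j) \<le> y $ i \<and> y $ i < fst Q $ i + of_int m * (snd Q / 2 ^ j) + snd Q / 2 ^ j)
     \<longleftrightarrow> \<lfloor>(y $ i - fst Q $ i) * 2 ^ j / snd Q\<rfloor> = m" for i m
  proof -
    have "\<lfloor>(y $ i - fst Q $ i) * 2 ^ j / snd Q\<rfloor> = m \<longleftrightarrow>
       of_int m \<le> (y $ i - fst Q $ i) / (snd Q / 2 ^ j) \<and> (y $ i - fst Q $ i) / (snd Q / 2 ^ j) < of_int m + 1"
      by (simp add: floor_eq_iff)
    also have "\<dots> \<longleftrightarrow> of_int m * (snd Q / 2 ^ j) \<le> y $ i - fst Q $ i \<and> y $ i - fst Q $ i < (of_int m + 1) * (snd Q / 2 ^ j)"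
      using l by (simp only: pos_le_divide_eq pos_divide_less_eq)
    also have "\<dots> \<longleftrightarrow> (fst Q $ i + of_int m * (snd Q / 2 ^ j) \<le> y $ i \<and> y $ i < fst Q $ i + of_int m * (snd Q / 2 ^ j) + snd Q / 2 ^ j)"
      unfolding distrib_right by linarith
    finally show ?thesis by simp
  qed
  then show ?thesis unfolding cube_set_def fst_dy snd_dy mem_Collect_eq by simp
qed

lemma mem_dy_self [simp]: "Q \<in> cubes \<Longrightarrow> x \<in> cube_set (dy Q j x)"
  by (simp add: mem_dy_iff)

lemma dy_eq:
  assumes "Q \<in> cubes" "y \<in> cube_set (dy Q j x)"
  shows "dy Q j y = dy Q j x"
  using assms(2) unfolding mem_dy_iff[OF assms(1)] by (simp add: dy_def)

lemma dy_0:
  assumes "Q \<in> cubes" "x \<in> cube_set Q"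
  shows "dy Q 0 x = Q"
proof -
  have l: "snd Q > 0" using assms by (simp add: cubes_def)
  have "\<lfloor>(x $ i - fst Q $ i) / snd Q\<rfloor> = 0" for i
    using assms(2) l by (auto simp: floor_eq_iff cube_set_def pos_divide_less_eq algebra_simps)
  then show ?thesis by (simp add: dy_def prod_eq_iff vec_eq_iff)
qed

lemma subcube_dy:
  assumes "Q \<in> cubes" "i \<le> j"
  shows "subcube (dy Q j x) (dy Q i x)"
proof -
  define s where "s = snd Q / 2 ^ j"
  have s: "s > 0" using assms by (simp add: cubes_def s_def)
  have si: "snd Q / 2 ^ i = 2 ^ (j - i) * s"
    using assms(2) by (simp add: s_def power_diff)
  show ?thesis
    unfolding subcube_def fst_dy snd_dy
  proof (intro allI)
    fix k
    define u where "u = (x $ k - fst Q $ k) / s"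
    have uj: "(x $ k - fst Q $ k) * 2 ^ j / snd Q = u" by (simp add: u_def s_def)
    have ui: "(x $ k - fst Q $ k) * 2 ^ i / snd Q = u / 2 ^ (j - i)"
    proof -
      have "(x $ k - fst Q $ k) * 2 ^ i / snd Q = (x $ k - fst Q $ k) / (snd Q / 2 ^ i)" by simp
      then show ?thesis unfolding si u_def by simp
    qed
    define m where "m = \<lfloor>u / 2 ^ (j - i)\<rfloor>"
    have "of_int m \<le> u / 2 ^ (j - i)" "u / 2 ^ (j - i) < of_int m + 1"
      unfolding m_def by linarith+
    then have "of_int m * 2 ^ (j - i) \<le> u" "u < (of_int m + 1) * 2 ^ (j - i)"
      by (simp_all add: pos_le_divide_eq pos_divide_less_eq)
    then have "of_int (m * 2 ^ (j - i)) \<le> u" "u < of_int ((m + 1) * 2 ^ (j - i))" by simp_all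
    then have "m * 2 ^ (j - i) \<le> \<lfloor>u\<rfloor>" "\<lfloor>u\<rfloor> < (m + 1) * 2 ^ (j - i)"
      by (simp_all only: le_floor_iff floor_less_iff)
    \<comment> \<open>Integrality turns the strict upper bound into one for the successor: the small
      cell ends no later than the large one.\<close>
    then have "m * 2 ^ (j - i) \<le> \<lfloor>u\<rfloor>" "\<lfloor>u\<rfloor> + 1 \<le> (m + 1) * 2 ^ (j - i)" by simp_all
    then have "real_of_int (m * 2 ^ (j - i)) \<le> of_int \<lfloor>u\<rfloor>"
       "real_of_int (\<lfloor>u\<rfloor> + 1) \<le> of_int ((m + 1) * 2 ^ (j - i))" by (simp_all only: of_int_le_iff)
    then have "real_of_int (m * 2 ^ (j - i)) * s \<le> of_int \<lfloor>u\<rfloor> * s"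
       "real_of_int (\<lfloor>u\<rfloor> + 1) * s \<le> of_int ((m + 1) * 2 ^ (j - i)) * s"
      using s by (intro mult_right_mono; simp)+
    then show "fst Q $ k + of_int \<lfloor>(x $ k - fst Q $ k) * 2 ^ i / snd Q\<rfloor> * (snd Q / 2 ^ i)
        \<le> fst Q $ k + of_int \<lfloor>(x $ k - fst Q $ k) * 2 ^ j / snd Q\<rfloor> * (snd Q / 2 ^ j) \<and>
       fst Q $ k + of_int \<lfloor>(x $ k - fst Q $ k) * 2 ^ j / snd Q\<rfloor> * (snd Q / 2 ^ j) + snd Q / 2 ^ j
        \<le> fst Q $ k + of_int \<lfloor>(x $ k - fst Q $ k) * 2 ^ i / snd Q\<rfloor> * (snd Q / 2 ^ i) + snd Q / 2 ^ i"
      unfolding uj ui m_def[symmetric] unfolding si s_def[symmetric]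
      by (simp add: algebra_simps)
  qed
qed

lemma subcube_dy_Q: "Q \<in> cubes \<Longrightarrow> x \<in> cube_set Q \<Longrightarrow> subcube (dy Q j x) Q"
  using subcube_dy[of Q 0 j x] dy_0[of Q x] by simp

lemma dy_eq_mono:
  assumes "Q \<in> cubes" "y \<in> cube_set (dy Q j x)" "i \<le> j"
  shows "dy Q i y = dy Q i x"
  using subcube_imp_subset[OF subcube_dy[OF assms(1,3)]] assms(2) by (intro dy_eq assms(1)) blast

text \<open>A cell is determined by its generation and an integer vector, so \<open>h\<close>
  enumerates all of them.\<close>

lemma countable_dy:
  fixes Q :: "('n::finite) cube"
  shows "countable {dy Q j x | j x. True}"
proof -
  define h :: "nat \<times> (int^'n) \<Rightarrow> 'n cube" where
    "h = (\<lambda>(j, m). (\<chi> i. fst Q $ i + of_int (m $ i) * (snd Q / 2 ^ j), snd Q / 2 ^ j))"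
  have "dy Q j x = h (j, \<chi> i. \<lfloor>(x $ i - fst Q $ i) * 2 ^ j / snd Q\<rfloor>)" for j x
    by (simp add: dy_def h_def)
  then have "{dy Q j x | j x. True} \<subseteq> range h" by auto
  then show ?thesis by (rule countable_subset) simp
qed

definition dyads :: "(('n::finite) cube \<Rightarrow> bool) \<Rightarrow> 'n cube \<Rightarrow> 'n cube set" where
  "dyads \<phi> Q = {P. \<phi> P \<and> (\<exists>x\<in>cube_set Q. \<exists>j. P = dy Q j x)}"

text \<open>Maximality is read along the chain of cells that contain one point: no cell of smaller
  generation satisfies \<open>\<phi>\<close>. Generation 0 is Q, so the chain has a top and Q itself
  may be selected.\<close>

definition maxdy :: "(('n::finite) cube \<Rightarrow> bool) \<Rightarrow> 'n cube \<Rightarrow> 'n cube set" where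
  "maxdy \<phi> Q = {P. \<phi> P \<and> (\<exists>x\<in>cube_set Q. \<exists>j. P = dy Q j x \<and> (\<forall>i<j. \<not> \<phi> (dy Q i x)))}"

lemma maxdy_subset: "maxdy \<phi> Q \<subseteq> dyads \<phi> Q"
  by (auto simp: maxdy_def dyads_def)

lemma countable_dyads [simp]: "countable (dyads \<phi> Q)"
  by (rule countable_subset[OF _ countable_dy[of Q]]) (auto simp: dyads_def)

lemma countable_maxdy [simp]: "countable (maxdy \<phi> Q)"
  by (rule countable_subset[OF maxdy_subset]) simp

lemma dyads_cubes: "Q \<in> cubes \<Longrightarrow> P \<in> dyads \<phi> Q \<Longrightarrow> P \<in> cubes \<and> subcube P Q \<and> \<phi> P"
  unfolding dyads_def using subcube_dy_Q dy_in_cubes by blast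

text \<open>Two selected cubes with a common point y both lie in the chain \<open>dy Q i y\<close>,
  and each is its first member that satisfies \<open>\<phi>\<close>.\<close>

lemma disjoint_maxdy:
  assumes "Q \<in> cubes"
  shows "disjoint_family_on cube_set (maxdy \<phi> Q)"
proof -
  have eq: "P = P'" if P: "P \<in> maxdy \<phi> Q" "P' \<in> maxdy \<phi> Q" "y \<in> cube_set P" "y \<in> cube_set P'" for P P' y
  proof -
    obtain x j where x: "P = dy Q j x" "\<phi> P" "\<And>i. i < j \<Longrightarrow> \<not> \<phi> (dy Q i x)"
      using P(1) unfolding maxdy_def by blast
    obtain x' j' where x': "P' = dy Q j' x'" "\<phi> P'" "\<And>i. i < j' \<Longrightarrow> \<not> \<phi> (dy Q i x')"
      using P(2) unfolding maxdy_def by blast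
    have y: "dy Q i y = dy Q i x" if "i \<le> j" for i
      using \<open>y \<in> cube_set P\<close> x(1) that assms by (intro dy_eq_mono) auto
    have y': "dy Q i y = dy Q i x'" if "i \<le> j'" for i
      using \<open>y \<in> cube_set P'\<close> x'(1) that assms by (intro dy_eq_mono) auto
    have "j = j'"
      using y[of j] y'[of j'] y[of j'] y'[of j] x x' by (metis linorder_cases less_imp_le order_refl)
    then show ?thesis using y[of j] y'[of j] x(1) x'(1) by simp
  qed
  show ?thesis unfolding disjoint_family_on_def using eq by blast
qed

lemma Union_maxdy:
  assumes "Q \<in> cubes"
  shows "(\<Union>P\<in>maxdy \<phi> Q. cube_set P) = (\<Union>P\<in>dyads \<phi> Q. cube_set P)"
proof
  show "(\<Union>P\<in>maxdy \<phi> Q. cube_set P) \<subseteq> (\<Union>P\<in>dyads \<phi> Q. cube_set P)"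
    using maxdy_subset by blast
  show "(\<Union>P\<in>dyads \<phi> Q. cube_set P) \<subseteq> (\<Union>P\<in>maxdy \<phi> Q. cube_set P)"
  proof
    fix y assume "y \<in> (\<Union>P\<in>dyads \<phi> Q. cube_set P)"
    then obtain x j where x: "x \<in> cube_set Q" "\<phi> (dy Q j x)" "y \<in> cube_set (dy Q j x)"
      by (auto simp: dyads_def)
    then have y: "y \<in> cube_set Q"
      using subcube_imp_subset[OF subcube_dy_Q[OF assms]] by blast
    have ex: "\<phi> (dy Q j y)" using x dy_eq[OF assms] by metis
    define k where "k = (LEAST j. \<phi> (dy Q j y))"
    have "\<phi> (dy Q k y)" unfolding k_def using ex by (rule LeastI)
    moreover have "\<not> \<phi> (dy Q i y)" if "i < k" for i
      using that not_less_Least unfolding k_def by blast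
    ultimately have "dy Q k y \<in> maxdy \<phi> Q" using y by (auto simp: maxdy_def)
    then show "y \<in> (\<Union>P\<in>maxdy \<phi> Q. cube_set P)" using assms by (intro UN_I) auto
  qed
qed

lemma sets_Union_cubes [simp, measurable]:
  "countable S \<Longrightarrow> (\<Union>P\<in>S. cube_set P) \<in> sets lebesgue"
  by (rule sets.countable_UN') auto

text \<open>Estimates on the single maximal cubes add up because these cubes are disjoint and
  countable. The set \<open>U\<close> localizes the left side only; with \<open>U = UNIV\<close>
  both sides live on the same set.\<close>

lemma emeasure_Union_maxdy_le:
  assumes Q: "Q \<in> cubes" and [measurable]: "f \<in> borel_measurable lebesgue" "g \<in> borel_measurable lebesgue"
    and U: "\<And>P. P \<in> maxdy \<phi> Q \<Longrightarrow> U \<inter> cube_set P \<in> sets lebesgue"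
    and le: "\<And>P. P \<in> maxdy \<phi> Q \<Longrightarrow> (\<integral>\<^sup>+x\<in>U \<inter> cube_set P. f x \<partial>lebesgue) \<le> c * (\<integral>\<^sup>+x\<in>cube_set P. g x \<partial>lebesgue)"
  shows "(\<integral>\<^sup>+x\<in>U \<inter> (\<Union>P\<in>dyads \<phi> Q. cube_set P). f x \<partial>lebesgue) 
    \<le> c * (\<integral>\<^sup>+x\<in>(\<Union>P\<in>dyads \<phi> Q. cube_set P). g x \<partial>lebesgue)"
proof -
  let ?M = "maxdy \<phi> Q"
  have eq: "U \<inter> (\<Union>P\<in>dyads \<phi> Q. cube_set P) = (\<Union>P\<in>?M. U \<inter> cube_set P)"
    unfolding Union_maxdy[OF Q, symmetric] by auto
  have sets: "(\<Union>P\<in>?M. U \<inter> cube_set P) \<in> sets lebesgue"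
    by (rule sets.countable_UN') (use U in auto)
  have "(\<integral>\<^sup>+x\<in>U \<inter> (\<Union>P\<in>dyads \<phi> Q. cube_set P). f x \<partial>lebesgue) = emeasure (density lebesgue f) (\<Union>P\<in>?M. U \<inter> cube_set P)"
    unfolding eq by (rule set_nn_integral_density) (use sets in auto)
  also have "\<dots> = (\<integral>\<^sup>+P. emeasure (density lebesgue f) (U \<inter> cube_set P) \<partial>count_space ?M)"
    by (rule emeasure_UN_countable)
       (use U disjoint_maxdy[OF Q, of \<phi>] in \<open>simp_all add: disjoint_family_on_def, blast\<close>)
  also have "\<dots> \<le> (\<integral>\<^sup>+P. c * emeasure (density lebesgue g) (cube_set P) \<partial>count_space ?M)"
    by (intro nn_integral_mono) (use le U in \<open>auto simp: set_nn_integral_density\<close>)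
  also have "\<dots> = c * (\<integral>\<^sup>+P. emeasure (density lebesgue g) (cube_set P) \<partial>count_space ?M)"
    by (rule nn_integral_cmult) auto
  also have "(\<integral>\<^sup>+P. emeasure (density lebesgue g) (cube_set P) \<partial>count_space ?M) = emeasure (density lebesgue g) (\<Union>P\<in>?M. cube_set P)"
    by (rule emeasure_UN_countable[symmetric]) (use disjoint_maxdy[OF Q] in auto)
  also have "\<dots> = (\<integral>\<^sup>+x\<in>(\<Union>P\<in>dyads \<phi> Q. cube_set P). g x \<partial>lebesgue)"
    unfolding Union_maxdy[OF Q] by (simp add: set_nn_integral_density)
  finally show ?thesis .
qed

subsection \<open>Lebesgue differentiation and the weak type inequality\<close>

lemma emeasure_cube_finite [simp]: "Q \<in> cubes \<Longrightarrow> emeasure lebesgue (cube_set Q) < \<infinity>"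
  by (simp add: emeasure_cube_set)

lemma dist_dy:
  fixes Q :: "('n::finite) cube"
  assumes Q: "Q \<in> cubes" and y: "y \<in> cube_set (dy Q j x)"
  shows "dist x y \<le> real CARD('n) * (snd Q / 2 ^ j)"
proof -
  have x: "x \<in> cube_set (dy Q j x)" using Q by simp
  have "\<bar>(x - y) $ i\<bar> \<le> snd Q / 2 ^ j" for i
  proof -
    have "fst (dy Q j x) $ i \<le> x $ i" "x $ i < fst (dy Q j x) $ i + snd Q / 2 ^ j"
      "fst (dy Q j x) $ i \<le> y $ i" "y $ i < fst (dy Q j x) $ i + snd Q / 2 ^ j"
      using x y unfolding cube_set_def by simp_all
    then show ?thesis by simp
  qed
  then have "(\<Sum>i\<in>UNIV. \<bar>(x - y) $ i\<bar>) \<le> real CARD('n) * (snd Q / 2 ^ j)"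
    by (intro sum_bounded_above) simp
  then show ?thesis using norm_le_l1_cart[of "x - y"] by (simp add: dist_norm)
qed

lemma dy_subset_open:
  fixes U :: "(real^('n::finite)) set"
  assumes Q: "Q \<in> cubes" and U: "open U" "x \<in> U"
  obtains j where "cube_set (dy Q j x) \<subseteq> U"
proof -
  obtain e where e: "e > 0" "ball x e \<subseteq> U" using U open_contains_ball by blast
  obtain j where j: "real CARD('n) * snd Q / e < 2 ^ j"
    using real_arch_pow[of 2] by auto
  have "real CARD('n) * (snd Q / 2 ^ j) < e"
    using j e(1) by (simp add: field_simps)
  then have "cube_set (dy Q j x) \<subseteq> ball x e"
    using dist_dy[OF Q, of _ j x] by fastforce
  then show ?thesis using e that by blast
qed

text \<open>One half of Lebesgue's differentiation theorem, by covering: the exceptional points N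
  with \<open>g x \<ge> s > c\<close> are covered by dyadic cubes inside an open set U of almost the
  same measure, and on these cubes the average of \<open>g\<close> is at most \<open>c\<close>. Thus
  s |N| <= c |U|, which forces N to be null.\<close>

lemma AE_dyadic_average:
  fixes g :: "real^('n::finite) \<Rightarrow> ennreal"
  assumes Q: "Q \<in> cubes" and g [measurable]: "g \<in> borel_measurable lebesgue" and lam: "c \<ge> 0"
  shows "AE x in lebesgue. x \<in> cube_set Q \<longrightarrow> g x > ennreal c \<longrightarrow>
    (\<exists>P\<in>dyads (\<lambda>P. (\<integral>\<^sup>+y\<in>cube_set P. g y \<partial>lebesgue) > ennreal c * emeasure lebesgue (cube_set P)) Q. x \<in> cube_set P)"
proof -
  let ?D = "dyads (\<lambda>P. (\<integral>\<^sup>+y\<in>cube_set P. g y \<partial>lebesgue) > ennreal c * emeasure lebesgue (cube_set P)) Q"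
  define N where "N s = {x \<in> space lebesgue. g x \<ge> ennreal s} \<inter> cube_set Q - (\<Union>P\<in>?D. cube_set P)" for s
  have N_sets [measurable]: "N s \<in> sets lebesgue" for s
  proof -
    have "{x \<in> space lebesgue. g x \<ge> ennreal s} \<in> sets lebesgue" by measurable
    then show ?thesis unfolding N_def by (intro sets.Diff sets.Int sets_Union_cubes) auto
  qed
  have null: "emeasure lebesgue (N s) = 0" if s: "s > c" for s
  proof -
    have fin: "emeasure lebesgue (N s) < \<infinity>"
    proof (rule le_less_trans[OF emeasure_mono emeasure_cube_finite[OF Q]])
      show "N s \<subseteq> cube_set Q" by (auto simp: N_def)
    qed simp
    define m where "m = measure lebesgue (N s)"
    have m: "emeasure lebesgue (N s) = ennreal m"
      using fin by (simp add: m_def emeasure_eq_ennreal_measure top.not_eq_extremum)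
    have m0: "m \<ge> 0" by (simp add: m_def)
    have step: "s * m \<le> c * (m + e)" if e: "e > 0" for e
    proof -
      obtain U where U: "open U" "N s \<subseteq> U" "U - N s \<in> lmeasurable" "emeasure lebesgue (U - N s) < ennreal e"
        using sets_lebesgue_outer_open[OF N_sets e] by blast
      have [measurable]: "U \<in> sets lebesgue" using U(1) by auto
      have eU: "emeasure lebesgue U \<le> ennreal (m + e)"
      proof -
        have "emeasure lebesgue (N s \<union> (U - N s)) = emeasure lebesgue (N s) + emeasure lebesgue (U - N s)"
          by (intro plus_emeasure[symmetric]) auto
        moreover have "N s \<union> (U - N s) = U" using U(2) by auto
        ultimately show ?thesis using U(4) m e m0 by (simp add: ennreal_plus)
      qed
      \<comment> \<open>A point of \<open>N s\<close> lies in no cube of \<open>?D\<close>. A cube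
        that meets \<open>N s\<close> is therefore not in \<open>?D\<close>, so its average is at
        most \<open>c\<close>.\<close>
      let ?\<phi> = "\<lambda>P. cube_set P \<subseteq> U \<and> cube_set P \<inter> N s \<noteq> {}"
      let ?E = "\<Union>P\<in>dyads ?\<phi> Q. cube_set P"
      have NE: "N s \<subseteq> ?E"
      proof
        fix x assume x: "x \<in> N s"
        then have "x \<in> cube_set Q" "x \<in> U" using U(2) by (auto simp: N_def)
        moreover obtain j where "cube_set (dy Q j x) \<subseteq> U"
          using dy_subset_open[OF Q U(1) \<open>x \<in> U\<close>] by blast
        ultimately have "dy Q j x \<in> dyads ?\<phi> Q" unfolding dyads_def using x mem_dy_self[OF Q] by blast
        then show "x \<in> ?E" using mem_dy_self[OF Q] by blast
      qed
      have EU: "?E \<subseteq> U" by (auto simp: dyads_def)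
      have "ennreal s * emeasure lebesgue (N s) = (\<integral>\<^sup>+x\<in>N s. ennreal s \<partial>lebesgue)"
        by (rule nn_integral_cmult_indicator[symmetric]) simp
      also have "\<dots> \<le> (\<integral>\<^sup>+x\<in>?E. g x \<partial>lebesgue)"
        using NE by (intro nn_integral_mono) (auto simp: indicator_def N_def)
      also have "\<dots> \<le> ennreal c * (\<integral>\<^sup>+x\<in>?E. 1 \<partial>lebesgue)"
      proof -
        have "(\<integral>\<^sup>+x\<in>UNIV \<inter> ?E. g x \<partial>lebesgue) \<le> ennreal c * (\<integral>\<^sup>+x\<in>?E. 1 \<partial>lebesgue)"
        proof (rule emeasure_Union_maxdy_le[OF Q])
          fix P assume "P \<in> maxdy ?\<phi> Q"
          then have P: "P \<in> dyads ?\<phi> Q" using maxdy_subset by blast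
          then obtain z where z: "z \<in> cube_set P" "z \<in> N s" by (auto simp: dyads_def)
          have "P \<notin> ?D" using z by (auto simp: N_def)
          then have "\<not> ((\<integral>\<^sup>+y\<in>cube_set P. g y \<partial>lebesgue) > ennreal c * emeasure lebesgue (cube_set P))"
            using P unfolding dyads_def by blast
          then show "(\<integral>\<^sup>+x\<in>UNIV \<inter> cube_set P. g x \<partial>lebesgue) \<le> ennreal c * (\<integral>\<^sup>+x\<in>cube_set P. 1 \<partial>lebesgue)"
            by (simp add: not_less)
        qed auto
        then show ?thesis by simp
      qed
      also have "\<dots> \<le> ennreal c * emeasure lebesgue U"
        using EU by (auto intro!: mult_left_mono emeasure_mono)
      also have "\<dots> \<le> ennreal c * ennreal (m + e)"
        by (intro mult_left_mono eU) auto
      finally have "ennreal (s * m) \<le> ennreal (c * (m + e))"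
        using lam s m0 e by (simp add: m ennreal_mult)
      then show ?thesis using lam m0 e by (simp add: ennreal_le_iff)
    qed
    have "m \<le> 0"
    proof (rule ccontr)
      assume "\<not> m \<le> 0"
      then have mp: "m > 0" by simp
      \<comment> \<open>Chosen so that \<open>c * e < (s - c) * m\<close>; the summand 1 covers
        \<open>c = 0\<close>.\<close>
      define e where "e = (s - c) * m / (2 * (c + 1))"
      have e: "e > 0" using mp s lam by (simp add: e_def)
      have "c * e \<le> (c + 1) * e" using e by simp
      also have "\<dots> = (s - c) * m / 2" using lam by (simp add: e_def field_simps)
      also have "\<dots> < (s - c) * m" using s mp by simp
      finally show False using step[OF e] by (simp add: algebra_simps)
    qed
    then show ?thesis using m m0 by simp
  qed
  have "AE x in lebesgue. \<forall>k::nat. x \<notin> N (c + 1 / Suc k)"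
    unfolding AE_all_countable
    by (intro allI AE_not_in) (auto simp: null_sets_def null)
  then show ?thesis
  proof eventually_elim
    case (elim x)
    show ?case
    proof (intro impI)
      assume x: "x \<in> cube_set Q" "ennreal c < g x"
      obtain k :: nat where k: "ennreal (c + 1 / Suc k) \<le> g x"
      proof (cases "g x")
        case (real r)
        then have "r - c > 0" using x(2) lam by (simp add: ennreal_less_iff)
        then obtain k :: nat where "1 / Suc k < r - c" using nat_approx_posE by blast
        then show ?thesis using real that[of k] by (auto intro!: ennreal_leI)
      qed (use that in auto)
      have "x \<notin> N (c + 1 / Suc k)" using elim by blast
      then show "\<exists>P\<in>?D. x \<in> cube_set P" using x k by (auto simp: N_def)
    qed
  qed
qed

text \<open>Weak type (1,1) of the maximal operator over doubled cubes. Vitali selects a disjoint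
  family of balls whose fivefold enlargements cover the union; the doubled cubes inside these balls
  are disjoint subsets of \<open>V\<close>, so their integrals add up. The common bound
  \<open>L\<close> on the sidelengths is what the selection requires.\<close>

lemma weak_type_cubes:
  fixes \<P> :: "('n::finite) cube set"
  assumes P: "\<P> \<subseteq> cubes" "countable \<P>" and g [measurable]: "g \<in> borel_measurable lebesgue"
    and V: "V \<in> sets lebesgue"
    and le: "\<And>P. P \<in> \<P> \<Longrightarrow> cube_set (dil 2 P) \<subseteq> V"
      "\<And>P. P \<in> \<P> \<Longrightarrow> c * emeasure lebesgue (cube_set (dil 2 P)) \<le> (\<integral>\<^sup>+x\<in>cube_set (dil 2 P). g x \<partial>lebesgue)"
      "\<And>P. P \<in> \<P> \<Longrightarrow> snd P \<le> L"
  shows "c * emeasure lebesgue (\<Union>P\<in>\<P>. cube_set P) 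
    \<le> ennreal ((11 * real CARD('n)) ^ CARD('n)) * (\<integral>\<^sup>+x\<in>V. g x \<partial>lebesgue)"
proof -
  let ?n = "real CARD('n)"
  define ctr where "ctr P = fst P + (\<chi> i. snd P / 2)" for P :: "'n cube"
  have l: "snd P > 0" if "P \<in> \<P>" for P using P(1) that by (auto simp: cubes_def)
  have n1: "?n \<ge> 1" by (simp add: Suc_leI)
  have sub1: "cube_set (dil 2 P) \<subseteq> cball (ctr P) (?n * snd P)" if "P \<in> \<P>" for P
  proof
    fix x assume x: "x \<in> cube_set (dil 2 P)"
    have "\<bar>(ctr P - x) $ i\<bar> \<le> snd P" for i
      using x[unfolded mem_cube_set_dil] by (simp add: ctr_def) (smt (verit) field_sum_of_halves)
    then have "(\<Sum>i\<in>UNIV. \<bar>(ctr P - x) $ i\<bar>) \<le> ?n * snd P"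
      by (intro sum_bounded_above) simp
    then show "x \<in> cball (ctr P) (?n * snd P)"
      using norm_le_l1_cart[of "ctr P - x"] by (simp add: dist_norm)
  qed
  \<comment> \<open>The enlarged ball has radius \<open>5 * ?n * snd P\<close>, while half the side
    of the dilate is \<open>5.5 * ?n * snd P\<close>. The surplus also takes care of the half-open
    upper faces.\<close>
  have sub2: "cball (ctr P) (5 * (?n * snd P)) \<subseteq> cube_set (dil (11 * ?n) P)" if "P \<in> \<P>" for P
  proof
    fix x assume "x \<in> cball (ctr P) (5 * (?n * snd P))"
    then have d: "\<bar>(ctr P - x) $ i\<bar> \<le> 5 * (?n * snd P)" for i
      using component_le_norm_cart[of "ctr P - x" i] by (simp add: dist_norm)
    have p: "?n * snd P > 0" using n1 l[OF that] by simp
    have e: "(1 - 11 * ?n) * snd P / 2 = snd P / 2 - 11 * (?n * snd P) / 2"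
      "(1 + 11 * ?n) * snd P / 2 = snd P / 2 + 11 * (?n * snd P) / 2" by (simp_all add: field_simps)
    show "x \<in> cube_set (dil (11 * ?n) P)"
      unfolding mem_cube_set_dil e
    proof
      fix i
      have "\<bar>fst P $ i + snd P / 2 - x $ i\<bar> \<le> 5 * (?n * snd P)"
        using d[of i] by (simp add: ctr_def)
      then show "fst P $ i + (snd P / 2 - 11 * (?n * snd P) / 2) \<le> x $ i \<and>
         x $ i < fst P $ i + (snd P / 2 + 11 * (?n * snd P) / 2)"
        using p by (auto simp: abs_le_iff)
    qed
  qed
  have sub0: "cube_set P \<subseteq> cube_set (dil 2 P)" if "P \<in> \<P>" for P
    using subcube_imp_subset[OF subcube_dil_self[of 2 P]] that P(1) by auto
  have cov: "(\<Union>P\<in>\<P>. cube_set P) \<subseteq> (\<Union>P\<in>\<P>. cball (ctr P) (?n * snd P))"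
    using sub0 sub1 by blast
  have bd: "0 < ?n * snd P \<and> ?n * snd P \<le> ?n * L" if "P \<in> \<P>" for P
    using that l le(3) n1 by simp
  obtain C where C: "countable C" "C \<subseteq> \<P>"
     "pairwise (\<lambda>i j. disjnt (cball (ctr i) (?n * snd i)) (cball (ctr j) (?n * snd j))) C"
     "(\<Union>P\<in>\<P>. cube_set P) \<subseteq> (\<Union>P\<in>C. cball (ctr P) (5 * (?n * snd P)))"
    using Vitali_covering_lemma_cballs[OF cov bd] by blast
  define I where "I = (\<integral>\<^sup>+x\<in>V. g x \<partial>lebesgue)"
  let ?K = "ennreal ((11 * ?n) ^ CARD('n))"
  have cover: "c * emeasure lebesgue (\<Union>P\<in>F. cube_set (dil (11 * ?n) P)) \<le> ?K * I" if F: "finite F" "F \<subseteq> C" for F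
  proof -
    have FP: "P \<in> \<P>" "P \<in> cubes" if "P \<in> F" for P using that F C(2) P(1) by auto
    have "c * emeasure lebesgue (\<Union>P\<in>F. cube_set (dil (11 * ?n) P)) 
        \<le> c * (\<Sum>P\<in>F. emeasure lebesgue (cube_set (dil (11 * ?n) P)))"
      by (intro mult_left_mono emeasure_subadditive_finite F) auto
    also have "\<dots> = (\<Sum>P\<in>F. c * emeasure lebesgue (cube_set (dil (11 * ?n) P)))"
      by (simp add: sum_distrib_left)
    also have "\<dots> \<le> (\<Sum>P\<in>F. ?K * (\<integral>\<^sup>+x\<in>cube_set (dil 2 P). g x \<partial>lebesgue))"
    proof (rule sum_mono)
      fix P assume PF: "P \<in> F"
      have "emeasure lebesgue (cube_set (dil (11 * ?n) P)) = ?K * ennreal (snd P ^ CARD('n))"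
        using FP[OF PF] l n1 by (simp add: emeasure_cube_set power_mult_distrib ennreal_mult less_imp_le)
      also have "\<dots> \<le> ?K * emeasure lebesgue (cube_set (dil 2 P))"
        using FP[OF PF] l[of P] by (auto simp: emeasure_cube_set intro!: mult_left_mono ennreal_leI power_mono)
      finally have "c * emeasure lebesgue (cube_set (dil (11 * ?n) P)) \<le> c * (?K * emeasure lebesgue (cube_set (dil 2 P)))"
        by (rule mult_left_mono) simp
      also have "\<dots> = ?K * (c * emeasure lebesgue (cube_set (dil 2 P)))" by (simp add: ac_simps)
      also have "\<dots> \<le> ?K * (\<integral>\<^sup>+x\<in>cube_set (dil 2 P). g x \<partial>lebesgue)"
        using le(2)[OF FP(1)[OF PF]] by (rule mult_left_mono) simp
      finally show "c * emeasure lebesgue (cube_set (dil (11 * ?n) P)) \<le> ?K * (\<integral>\<^sup>+x\<in>cube_set (dil 2 P). g x \<partial>lebesgue)" .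
    qed
    also have "\<dots> = ?K * (\<Sum>P\<in>F. emeasure (density lebesgue g) (cube_set (dil 2 P)))"
      by (simp add: sum_distrib_left set_nn_integral_density)
    also have "(\<Sum>P\<in>F. emeasure (density lebesgue g) (cube_set (dil 2 P))) = emeasure (density lebesgue g) (\<Union>P\<in>F. cube_set (dil 2 P))"
    proof (rule sum_emeasure)
      show "disjoint_family_on (\<lambda>P. cube_set (dil 2 P)) F"
        unfolding disjoint_family_on_def
      proof (intro ballI impI)
        fix P P' assume *: "P \<in> F" "P' \<in> F" "P \<noteq> P'"
        then have "disjnt (cball (ctr P) (?n * snd P)) (cball (ctr P') (?n * snd P'))"
          using C(3) F(2) unfolding pairwise_def by blast
        then show "cube_set (dil 2 P) \<inter> cube_set (dil 2 P') = {}"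
          using sub1[of P] sub1[of P'] FP * unfolding disjnt_def by blast
      qed
    qed (use F in auto)
    also have "\<dots> \<le> emeasure (density lebesgue g) V"
      using le(1) FP V by (intro emeasure_mono) auto
    also have "\<dots> = I" unfolding I_def using V by (simp add: set_nn_integral_density)
    finally show ?thesis by (simp add: mult_left_mono)
  qed
  have U: "emeasure lebesgue (\<Union>P\<in>\<P>. cube_set P) \<le> emeasure lebesgue (\<Union>P\<in>C. cube_set (dil (11 * ?n) P))"
  proof (rule emeasure_mono)
    have "cball (ctr P) (5 * (?n * snd P)) \<subseteq> cube_set (dil (11 * ?n) P)" if "P \<in> C" for P
      using sub2 C(2) that by blast
    then show "(\<Union>P\<in>\<P>. cube_set P) \<subseteq> (\<Union>P\<in>C. cube_set (dil (11 * ?n) P))"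
      using C(4) by (meson UN_mono order_refl order_trans)
    show "(\<Union>P\<in>C. cube_set (dil (11 * ?n) P)) \<in> sets lebesgue"
      using C(1) by (intro sets.countable_UN') auto
  qed
  \<comment> \<open>The factor \<open>c\<close> is moved into a measure, so that the passage from
    finite to countable unions applies to the product.\<close>
  have "emeasure (density lebesgue (\<lambda>_. c)) (\<Union>P\<in>C. cube_set (dil (11 * ?n) P)) \<le> ?K * I"
  proof (rule emeasure_UN_le_of_finite[OF C(1)])
    fix F assume F: "finite F" "F \<subseteq> C"
    have "emeasure (density lebesgue (\<lambda>_. c)) (\<Union>P\<in>F. cube_set (dil (11 * ?n) P))
      = c * emeasure lebesgue (\<Union>P\<in>F. cube_set (dil (11 * ?n) P))"
      by (rule emeasure_density_const) (use F in \<open>auto intro: sets.finite_UN\<close>)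
    then show "emeasure (density lebesgue (\<lambda>_. c)) (\<Union>P\<in>F. cube_set (dil (11 * ?n) P)) \<le> ?K * I"
      using cover[OF F] by simp
  qed simp
  moreover have "emeasure (density lebesgue (\<lambda>_. c)) (\<Union>P\<in>C. cube_set (dil (11 * ?n) P)) 
     = c * emeasure lebesgue (\<Union>P\<in>C. cube_set (dil (11 * ?n) P))"
    by (rule emeasure_density_const) (use C(1) in \<open>auto intro!: sets.countable_UN'\<close>)
  ultimately have "c * emeasure lebesgue (\<Union>P\<in>C. cube_set (dil (11 * ?n) P)) \<le> ?K * I" by simp
  with mult_left_mono[OF U zero_le] show ?thesis unfolding I_def by (rule order_trans)
qed

subsection \<open>Averages\<close>

lemma powr_le_iff_root:
  fixes y T r :: real
  assumes "r > 0" "y \<ge> 0" "T \<ge> 0"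
  shows "y powr r \<le> T \<longleftrightarrow> y \<le> T powr (1 / r)"
proof
  assume "y powr r \<le> T"
  then have "(y powr r) powr (1 / r) \<le> T powr (1 / r)"
    using assms by (intro powr_mono2) auto
  then show "y \<le> T powr (1 / r)" using assms by (simp add: powr_powr)
next
  assume "y \<le> T powr (1 / r)"
  then have "y powr r \<le> (T powr (1 / r)) powr r"
    using assms by (intro powr_mono2) auto
  then show "y powr r \<le> T" using assms by (simp add: powr_powr)
qed

lemma enn_powr_le_iff:
  assumes "r > 0" "T \<ge> 0"
  shows "enn_powr x r \<le> ennreal T \<longleftrightarrow> x \<le> ennreal (T powr (1 / r))"
proof (cases x)
  case (real y)
  then show ?thesis using assms powr_le_iff_root[of r y T] by (simp add: enn_powr_def ennreal_le_iff)
next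
  case top
  then show ?thesis by (simp add: enn_powr_def top_unique)
qed

lemma ennreal_divide_le_iff:
  fixes a b c :: ennreal
  assumes "b > 0" "b < \<infinity>"
  shows "a / b \<le> c \<longleftrightarrow> a \<le> c * b"
proof
  assume "a / b \<le> c"
  then have "(a / b) * b \<le> c * b" by (rule mult_right_mono) simp
  moreover have "(a / b) * b = a"
    using assms by (metis ennreal_mult_divide_eq ennreal_times_divide infinity_ennreal_def less_irrefl mult.commute)
  ultimately show "a \<le> c * b" by simp
next
  assume "a \<le> c * b"
  then show "a / b \<le> c" using assms by (intro divide_le_posI_ennreal) (auto simp: mult.commute)
qed

lemma emeasure_cube_pos [simp]: "Q \<in> cubes \<Longrightarrow> emeasure lebesgue (cube_set Q) > 0"
  by (simp add: emeasure_cube_set) (simp add: cubes_def)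

text \<open>Averages are compared with finite real bounds almost everywhere below. In this form root
  and division disappear and only integrals are estimated.\<close>

lemma avgLp_le_iff:
  assumes "Q \<in> cubes" "p > 0" "T \<ge> 0"
  shows "avgLp p (cube_set Q) g \<le> ennreal T \<longleftrightarrow>
    (\<integral>\<^sup>+x\<in>cube_set Q. ennreal (norm (g x) powr p) \<partial>lebesgue) \<le> ennreal (T powr p) * emeasure lebesgue (cube_set Q)"
  unfolding avgLp_def avgE_def using assms
  by (simp add: enn_powr_le_iff ennreal_divide_le_iff[OF emeasure_cube_pos emeasure_cube_finite])

lemma avgLp_mono_set:
  fixes Q :: "('n::finite) cube"
  assumes "Q \<in> cubes" "R \<in> cubes" "p > 0" "T \<ge> 0" "c > 0"
    and sub: "cube_set Q \<subseteq> cube_set R" and "snd R \<le> c * snd Q"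
    and le: "avgLp p (cube_set R) g \<le> ennreal T"
  shows "avgLp p (cube_set Q) g \<le> ennreal (c powr (real CARD('n) / p) * T)"
proof -
  have pos: "snd Q > 0" "snd R > 0" using assms by (auto simp: cubes_def)
  have "(\<integral>\<^sup>+x\<in>cube_set Q. ennreal (norm (g x) powr p) \<partial>lebesgue) \<le> (\<integral>\<^sup>+x\<in>cube_set R. ennreal (norm (g x) powr p) \<partial>lebesgue)"
    using sub by (intro nn_integral_mono) (auto simp: indicator_def)
  also have "\<dots> \<le> ennreal (T powr p) * ennreal (snd R ^ CARD('n))"
    using le assms by (simp add: avgLp_le_iff emeasure_cube_set)
  also have "\<dots> \<le> ennreal (T powr p) * ennreal ((c * snd Q) ^ CARD('n))"
    using assms pos by (intro mult_left_mono ennreal_leI power_mono) auto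
  also have "\<dots> = ennreal ((c powr (real CARD('n) / p) * T) powr p) * emeasure lebesgue (cube_set Q)"
  proof -
    have "(c powr (real CARD('n) / p) * T) powr p = c ^ CARD('n) * T powr p"
      using assms by (simp add: powr_mult powr_powr powr_realpow)
    then show ?thesis using assms pos
      by (simp add: emeasure_cube_set ennreal_mult[symmetric] power_mult_distrib ac_simps)
  qed
  finally show ?thesis using assms by (simp add: avgLp_le_iff)
qed

text \<open>For \<open>p \<ge> 1\<close> and \<open>c \<ge> 1\<close> the exponent n/p may be
  rounded up to n, which keeps these constants free of \<open>p\<close>.\<close>

lemma avgLp_mono_set_2:
  fixes Q :: "('n::finite) cube"
  assumes "Q \<in> cubes" "R \<in> cubes" "p \<ge> 1" "T \<ge> 0" "c \<ge> 1"
    and "cube_set Q \<subseteq> cube_set R" and "snd R \<le> c * snd Q"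
    and le: "avgLp p (cube_set R) g \<le> ennreal T"
  shows "avgLp p (cube_set Q) g \<le> ennreal (c ^ CARD('n) * T)"
proof -
  have "avgLp p (cube_set Q) g \<le> ennreal (c powr (real CARD('n) / p) * T)"
    using assms by (intro avgLp_mono_set[of Q R p T c]) auto
  also have "c powr (real CARD('n) / p) \<le> c powr (real CARD('n))"
    using assms(3,5) by (intro powr_mono) (auto simp: divide_le_eq)
  then have "ennreal (c powr (real CARD('n) / p) * T) \<le> ennreal (c ^ CARD('n) * T)"
    using assms by (intro ennreal_leI mult_right_mono) (auto simp: powr_realpow)
  finally show ?thesis .
qed

lemma avgLp_cong_AE:
  assumes "AE x in lebesgue. x \<in> E \<longrightarrow> norm (f x) = norm (g x)"
  shows "avgLp p E f = avgLp p E g"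
proof -
  have "(\<integral>\<^sup>+x\<in>E. ennreal (norm (f x) powr p) \<partial>lebesgue) = (\<integral>\<^sup>+x\<in>E. ennreal (norm (g x) powr p) \<partial>lebesgue)"
    by (rule nn_integral_cong_AE) (use assms in eventually_elim, auto simp: indicator_def)
  then show ?thesis by (simp add: avgLp_def avgE_def)
qed

lemma esssup_on_cong_AE:
  assumes "AE x in lebesgue. x \<in> E \<longrightarrow> norm (f x) = norm (g x)"
  shows "esssup_on E f = esssup_on E g"
proof -
  have "(AE x in lebesgue. x \<in> E \<longrightarrow> ennreal (norm (f x)) \<le> C) \<longleftrightarrow> (AE x in lebesgue. x \<in> E \<longrightarrow> ennreal (norm (g x)) \<le> C)" for C
    by (rule eventually_subst) (use assms in eventually_elim, auto)
  then show ?thesis by (simp add: esssup_on_def)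
qed

lemma avgq_cong_AE:
  assumes "AE x in lebesgue. x \<in> E \<longrightarrow> norm (f x) = norm (g x)"
  shows "avgq q E f = avgq q E g"
  using avgLp_cong_AE[OF assms] esssup_on_cong_AE[OF assms] by (simp add: avgq_def)

text \<open>The infimum of the almost-everywhere bounds is reached along a sequence of bounds, and
  countably many null sets have a null union.\<close>

lemma AE_le_esssup: "AE x in lebesgue. x \<in> E \<longrightarrow> ennreal (norm (g x)) \<le> esssup_on E g"
proof -
  let ?S = "{C. AE x in lebesgue. x \<in> E \<longrightarrow> ennreal (norm (g x)) \<le> C}"
  have "?S \<noteq> {}" by (auto intro!: exI[of _ top])
  then obtain C where C: "\<And>k::nat. C k \<in> ?S" "Inf ?S = (INF k. C k)"
    using ennreal_Inf_countable_INF[of ?S] by blast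
  have "AE x in lebesgue. \<forall>k. x \<in> E \<longrightarrow> ennreal (norm (g x)) \<le> C k"
    unfolding AE_all_countable using C(1) by blast
  then show ?thesis
    unfolding esssup_on_def C(2) by eventually_elim (auto intro: INF_greatest)
qed

lemma avgq_inf_le_iff: "avgq \<infinity> E g \<le> ennreal T \<longleftrightarrow> (AE x in lebesgue. x \<in> E \<longrightarrow> ennreal (norm (g x)) \<le> ennreal T)"
proof
  assume "avgq \<infinity> E g \<le> ennreal T"
  then show "AE x in lebesgue. x \<in> E \<longrightarrow> ennreal (norm (g x)) \<le> ennreal T"
    using AE_le_esssup[of E g] unfolding avgq_def by (auto elim!: eventually_mono intro: order_trans)
qed (auto simp: avgq_def esssup_on_def intro: Inf_lower)

lemma powr_add_le:
  fixes x y p :: real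
  assumes "p > 0" "x \<ge> 0" "y \<ge> 0"
  shows "(x + y) powr p \<le> 2 powr p * (x powr p + y powr p)"
proof -
  have "(x + y) powr p \<le> (2 * max x y) powr p"
    using assms by (intro powr_mono2) auto
  also have "\<dots> = 2 powr p * max x y powr p" using assms by (simp add: powr_mult)
  also have "\<dots> \<le> 2 powr p * (x powr p + y powr p)"
    by (intro mult_left_mono) (auto simp: max_def)
  finally show ?thesis .
qed

text \<open>Above the height \<open>T\<close> the factor \<open>x powr (p - r)\<close> is at most
  \<open>T powr (p - r)\<close>. This two-term bound stands in for Hoelder's and Jensen's
  inequalities below: a suitable \<open>T\<close> recovers them up to a constant.\<close>

lemma powr_le_split:
  fixes x T p r :: real
  assumes "0 < p" "p \<le> r" "x \<ge> 0" "T > 0"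
  shows "x powr p \<le> T powr p + T powr (p - r) * x powr r"
proof (cases "x \<le> T")
  case True
  then have "x powr p \<le> T powr p" using assms by (intro powr_mono2) auto
  then show ?thesis by (simp add: add_increasing2)
next
  case False
  then have "x powr p = x powr (p - r) * x powr r"
    using assms by (simp flip: powr_add)
  also have "\<dots> \<le> T powr (p - r) * x powr r"
    using False assms by (intro mult_right_mono powr_mono2') auto
  finally show ?thesis by (simp add: add_increasing)
qed

text \<open>A quasi-triangle inequality, 2^p (S^p + T^p) <= 2^p 2 (S+T)^p <= (4 (S+T))^p. The factor
  4 instead of Minkowski's 1 affects constants only.\<close>

lemma avgLp_add:
  fixes f g :: "(real^('n::finite)) \<Rightarrow> 'b::{real_normed_vector, second_countable_topology}"
  assumes Q: "Q \<in> cubes" and p: "p \<ge> 1" and S: "S \<ge> 0" and T: "T \<ge> 0"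
    and [measurable]: "f \<in> borel_measurable lebesgue" "g \<in> borel_measurable lebesgue"
    and le: "avgLp p (cube_set Q) f \<le> ennreal S" "avgLp p (cube_set Q) g \<le> ennreal T"
  shows "avgLp p (cube_set Q) (\<lambda>x. f x + g x) \<le> ennreal (4 * (S + T))"
proof -
  let ?m = "emeasure lebesgue (cube_set Q)"
  have "(\<integral>\<^sup>+x\<in>cube_set Q. ennreal (norm (f x + g x) powr p) \<partial>lebesgue)
     \<le> (\<integral>\<^sup>+x. ennreal (2 powr p) * (ennreal (norm (f x) powr p) * indicator (cube_set Q) x +
          ennreal (norm (g x) powr p) * indicator (cube_set Q) x) \<partial>lebesgue)"
  proof (rule nn_integral_mono)
    fix x
    have "norm (f x + g x) powr p \<le> (norm (f x) + norm (g x)) powr p"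
      using p by (intro powr_mono2) (auto intro: norm_triangle_ineq)
    also have "\<dots> \<le> 2 powr p * (norm (f x) powr p + norm (g x) powr p)"
      using p by (intro powr_add_le) auto
    finally have "ennreal (norm (f x + g x) powr p) \<le> ennreal (2 powr p) * (ennreal (norm (f x) powr p) + ennreal (norm (g x) powr p))"
      by (simp add: ennreal_mult[symmetric] ennreal_plus[symmetric] del: ennreal_plus)
    then show "ennreal (norm (f x + g x) powr p) * indicator (cube_set Q) x \<le> ennreal (2 powr p) * (ennreal (norm (f x) powr p) * indicator (cube_set Q) x +
          ennreal (norm (g x) powr p) * indicator (cube_set Q) x)"
      by (simp add: indicator_def)
  qed
  also have "\<dots> = ennreal (2 powr p) * ((\<integral>\<^sup>+x\<in>cube_set Q. ennreal (norm (f x) powr p) \<partial>lebesgue) +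
      (\<integral>\<^sup>+x\<in>cube_set Q. ennreal (norm (g x) powr p) \<partial>lebesgue))"
    by (subst nn_integral_cmult, measurable) (subst nn_integral_add, auto)
  also have "\<dots> \<le> ennreal (2 powr p) * (ennreal (S powr p) * ?m + ennreal (T powr p) * ?m)"
    using le Q p S T by (intro mult_left_mono add_mono) (auto simp: avgLp_le_iff)
  also have "\<dots> = ennreal (2 powr p * (S powr p + T powr p)) * ?m"
    by (simp add: ennreal_mult ennreal_plus distrib_right mult.assoc)
  also have "\<dots> \<le> ennreal ((4 * (S + T)) powr p) * ?m"
  proof (intro mult_right_mono ennreal_leI)
    have "S powr p \<le> (S + T) powr p" "T powr p \<le> (S + T) powr p"
      using S T p by (auto intro!: powr_mono2)
    then have "2 powr p * (S powr p + T powr p) \<le> 2 powr p * (2 * (S + T) powr p)"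
      by (intro mult_left_mono) auto
    also have "\<dots> \<le> 2 powr p * (2 powr p * (S + T) powr p)"
      using p powr_mono[of 1 p 2] by (intro mult_left_mono mult_right_mono) auto
    also have "\<dots> = (4 * (S + T)) powr p"
      using S T by (simp add: powr_mult[symmetric] flip: mult.assoc)
    finally show "2 powr p * (S powr p + T powr p) \<le> (4 * (S + T)) powr p" .
  qed simp
  finally show ?thesis using p S T by (subst avgLp_le_iff[OF Q]) simp_all
qed

lemma avgq_add:
  fixes f g :: "(real^('n::finite)) \<Rightarrow> 'b::{real_normed_vector, second_countable_topology}"
  assumes Q: "Q \<in> cubes" and q: "q \<ge> 1" and S: "S \<ge> 0" and T: "T \<ge> 0"
    and m: "f \<in> borel_measurable lebesgue" "g \<in> borel_measurable lebesgue"
    and le: "avgq q (cube_set Q) f \<le> ennreal S" "avgq q (cube_set Q) g \<le> ennreal T"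
  shows "avgq q (cube_set Q) (\<lambda>x. f x + g x) \<le> ennreal (4 * (S + T))"
proof (cases "q = \<infinity>")
  case True
  have "AE x in lebesgue. x \<in> cube_set Q \<longrightarrow> ennreal (norm (f x + g x)) \<le> ennreal (4 * (S + T))"
    using le[unfolded True avgq_inf_le_iff]
  proof eventually_elim
    case (elim x)
    show ?case
    proof
      assume "x \<in> cube_set Q"
      then have "norm (f x) \<le> S" "norm (g x) \<le> T" using elim S T by (auto simp: ennreal_le_iff)
      then show "ennreal (norm (f x + g x)) \<le> ennreal (4 * (S + T))"
        using norm_triangle_ineq[of "f x" "g x"] S T by (intro ennreal_leI) (smt (verit))
    qed
  qed
  then show ?thesis unfolding True avgq_inf_le_iff .
next
  case False
  then have "enn2real q \<ge> 1" using q by (cases q) (auto simp: ennreal_le_iff simp flip: ennreal_1)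
  then show ?thesis using avgLp_add[OF Q _ S T m, of "enn2real q"] le False by (simp add: avgq_def)
qed

text \<open>Jensen's inequality up to the factor 2. Splitting at the height \<open>T\<close> gives
  \<open>2 * T powr p\<close>, which is at most \<open>(2 * T) powr p\<close>. Since the split needs
  \<open>T > 0\<close>, the value 0 is reached by adding an arbitrary positive number.\<close>

lemma avgLp_le_avgq:
  fixes h :: "(real^('n::finite)) \<Rightarrow> 'b::{real_normed_vector, second_countable_topology}"
  assumes Q: "Q \<in> cubes" and p: "p \<ge> 1" "ennreal p < q" and T: "T \<ge> 0"
    and [measurable]: "h \<in> borel_measurable lebesgue"
    and le: "avgq q (cube_set Q) h \<le> ennreal T"
  shows "avgLp p (cube_set Q) h \<le> ennreal (2 * T)"
proof -
  have *: "avgLp p (cube_set Q) h \<le> ennreal (2 * T)" if le: "avgq q (cube_set Q) h \<le> ennreal T" and T: "T > 0" for T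
  proof (cases "q = \<infinity>")
    case True
    let ?m = "emeasure lebesgue (cube_set Q)"
    have "(\<integral>\<^sup>+x\<in>cube_set Q. ennreal (norm (h x) powr p) \<partial>lebesgue) \<le> (\<integral>\<^sup>+x\<in>cube_set Q. ennreal (T powr p) \<partial>lebesgue)"
      by (rule nn_integral_mono_AE)
       (use le[unfolded True avgq_inf_le_iff] in eventually_elim, use T p in \<open>auto simp: indicator_def ennreal_le_iff intro!: ennreal_leI powr_mono2\<close>)
    also have "\<dots> = ennreal (T powr p) * ?m"
      by (rule nn_integral_cmult_indicator) simp
    also have "\<dots> \<le> ennreal ((2 * T) powr p) * ?m"
      using T p by (intro mult_right_mono ennreal_leI powr_mono2) auto
    finally show ?thesis using p T by (subst avgLp_le_iff[OF Q]) simp_all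
  next
    case False
    define r where "r = enn2real q"
    have r: "r > p" "q = ennreal r" using False p(2) p(1) by (cases q; auto simp: r_def ennreal_less_iff)+
    let ?m = "emeasure lebesgue (cube_set Q)"
    have le': "(\<integral>\<^sup>+x\<in>cube_set Q. ennreal (norm (h x) powr r) \<partial>lebesgue) \<le> ennreal (T powr r) * ?m"
      using le False Q T r p by (simp add: avgq_def avgLp_le_iff flip: r_def)
    have "(\<integral>\<^sup>+x\<in>cube_set Q. ennreal (norm (h x) powr p) \<partial>lebesgue)
      \<le> (\<integral>\<^sup>+x. ennreal (T powr p) * indicator (cube_set Q) x + ennreal (T powr (p - r)) * (ennreal (norm (h x) powr r) * indicator (cube_set Q) x) \<partial>lebesgue)"
    proof (rule nn_integral_mono)
      fix x
      have "norm (h x) powr p \<le> T powr p + T powr (p - r) * norm (h x) powr r"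
        using T p r by (intro powr_le_split) auto
      then have "ennreal (norm (h x) powr p) \<le> ennreal (T powr p) + ennreal (T powr (p - r)) * ennreal (norm (h x) powr r)"
        by (simp add: ennreal_mult[symmetric] ennreal_plus[symmetric] del: ennreal_plus)
      then show "ennreal (norm (h x) powr p) * indicator (cube_set Q) x \<le> ennreal (T powr p) * indicator (cube_set Q) x + ennreal (T powr (p - r)) * (ennreal (norm (h x) powr r) * indicator (cube_set Q) x)"
        by (simp add: indicator_def)
    qed
    also have "\<dots> = ennreal (T powr p) * ?m + ennreal (T powr (p - r)) * (\<integral>\<^sup>+x\<in>cube_set Q. ennreal (norm (h x) powr r) \<partial>lebesgue)"
      by (simp add: nn_integral_add nn_integral_cmult nn_integral_cmult_indicator)
    also have "\<dots> \<le> ennreal (T powr p) * ?m + ennreal (T powr (p - r)) * (ennreal (T powr r) * ?m)"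
      by (intro add_left_mono mult_left_mono le') auto
    also have "\<dots> = ennreal (2 * T powr p) * ?m"
    proof -
      have "T powr (p - r) * T powr r = T powr p" by (simp flip: powr_add)
      then have "ennreal (T powr (p - r)) * (ennreal (T powr r) * ?m) = ennreal (T powr p) * ?m"
        by (simp only: mult.assoc[symmetric] ennreal_mult[symmetric] powr_ge_zero)
      moreover have "ennreal (2 * T powr p) = ennreal (T powr p) + ennreal (T powr p)"
        by (subst ennreal_plus[symmetric]) simp_all
      ultimately show ?thesis by (simp only: distrib_right)
    qed
    also have "\<dots> \<le> ennreal ((2 * T) powr p) * ?m"
    proof (intro mult_right_mono ennreal_leI)
      have "(2 * T) powr p = 2 powr p * T powr p" using T by (simp add: powr_mult)
      then show "2 * T powr p \<le> (2 * T) powr p"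
        using p powr_mono[of 1 p 2] by (auto intro!: mult_right_mono)
    qed simp
    finally show ?thesis using p T by (subst avgLp_le_iff[OF Q]) simp_all
  qed
  show ?thesis
  proof (rule ennreal_le_epsilon)
    fix e :: real assume e: "e > 0"
    have "avgq q (cube_set Q) h \<le> ennreal (T + e / 2)"
      by (rule order_trans[OF le]) (use e in \<open>auto intro!: ennreal_leI\<close>)
    then have "avgLp p (cube_set Q) h \<le> ennreal (2 * (T + e / 2))"
      by (rule *) (use T e in linarith)
    also have "2 * (T + e / 2) = 2 * T + e" by simp
    also have "ennreal (2 * T + e) = ennreal (2 * T) + ennreal e"
      by (rule ennreal_plus) (use T e in auto)
    finally show "avgLp p (cube_set Q) h \<le> ennreal (2 * T) + ennreal e" .
  qed
qed

section \<open>Functions locally in L^p\<close>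

lemma Lploc_measurable: "Lploc p f \<Longrightarrow> f \<in> borel_measurable lebesgue"
  by (simp add: Lploc_def)

lemma Lploc_avgE:
  assumes "Lploc p f" "Q \<in> cubes" "p > 0"
  obtains T where "T \<ge> 0" "avgLp p (cube_set Q) f \<le> ennreal T"
proof -
  have "avgE (cube_set Q) (\<lambda>x. ennreal (norm (f x) powr p)) < \<infinity>"
    using assms unfolding Lploc_def avgE_def
    by (auto simp: ennreal_divide_eq_top_iff less_top[symmetric] intro!: emeasure_cube_pos[THEN less_imp_neq, symmetric])
  then have "avgLp p (cube_set Q) f = ennreal (enn2real (avgE (cube_set Q) (\<lambda>x. ennreal (norm (f x) powr p))) powr (1 / p))"
    by (simp add: avgLp_def enn_powr_def)
  then show ?thesis by (intro that[OF _ eq_refl]) auto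
qed

lemma Lploc_add:
  fixes f g :: "(real^('n::finite)) \<Rightarrow> 'b::{real_normed_vector, second_countable_topology}"
  assumes "Lploc p f" "Lploc p g" "p \<ge> 1"
  shows "Lploc p (\<lambda>x. f x + g x)"
  unfolding Lploc_def
proof (intro conjI ballI)
  show "(\<lambda>x. f x + g x) \<in> borel_measurable lebesgue"
    using assms(1,2)[THEN Lploc_measurable] by measurable
  fix Q :: "'n cube" assume Q: "Q \<in> cubes"
  have p: "p > 0" using assms by simp
  obtain S where S: "S \<ge> 0" "avgLp p (cube_set Q) f \<le> ennreal S" using Lploc_avgE[OF assms(1) Q p] by blast
  obtain T where T: "T \<ge> 0" "avgLp p (cube_set Q) g \<le> ennreal T" using Lploc_avgE[OF assms(2) Q p] by blast
  have "avgLp p (cube_set Q) (\<lambda>x. f x + g x) \<le> ennreal (4 * (S + T))"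
    using assms S T Q by (intro avgLp_add) (auto simp: Lploc_measurable)
  then have "(\<integral>\<^sup>+x\<in>cube_set Q. ennreal (norm (f x + g x) powr p) \<partial>lebesgue) \<le> ennreal ((4 * (S + T)) powr p) * emeasure lebesgue (cube_set Q)"
    using p S T by (subst (asm) avgLp_le_iff[OF Q]) simp_all
  also have "\<dots> < \<infinity>" using emeasure_cube_finite[OF Q] by (simp add: ennreal_mult_less_top)
  finally show "(\<integral>\<^sup>+x\<in>cube_set Q. ennreal (norm (f x + g x) powr p) \<partial>lebesgue) < \<infinity>" .
qed

lemma Lploc_le:
  fixes f :: "(real^('n::finite)) \<Rightarrow> 'b::real_normed_vector"
  assumes "Lploc p f" "p > 0" "g \<in> borel_measurable lebesgue" "\<And>x. norm (g x) \<le> norm (f x)"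
  shows "Lploc p g"
  unfolding Lploc_def
proof (intro conjI ballI)
  fix Q :: "'n cube" assume Q: "Q \<in> cubes"
  have "(\<integral>\<^sup>+x\<in>cube_set Q. ennreal (norm (g x) powr p) \<partial>lebesgue) \<le> (\<integral>\<^sup>+x\<in>cube_set Q. ennreal (norm (f x) powr p) \<partial>lebesgue)"
    using assms by (intro nn_integral_mono mult_right_mono ennreal_leI powr_mono2) auto
  also have "\<dots> < \<infinity>" using assms Q by (auto simp: Lploc_def)
  finally show "(\<integral>\<^sup>+x\<in>cube_set Q. ennreal (norm (g x) powr p) \<partial>lebesgue) < \<infinity>" .
qed (use assms in auto)

lemma Lploc_restrict:
  assumes "Lploc p f" "p > 0" "E \<in> sets lebesgue"
  shows "Lploc p (\<lambda>x. if x \<in> E then f x else 0)" "Lploc p (\<lambda>x. if x \<in> E then 0 else f x)"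
proof -
  have [measurable]: "f \<in> borel_measurable lebesgue" "E \<in> sets lebesgue" using assms by (auto simp: Lploc_def)
  show "Lploc p (\<lambda>x. if x \<in> E then f x else 0)" by (rule Lploc_le[OF assms(1,2)]) auto
  show "Lploc p (\<lambda>x. if x \<in> E then 0 else f x)" by (rule Lploc_le[OF assms(1,2)]) auto
qed

lemma Lploc_uminus:
  fixes f :: "(real^('n::finite)) \<Rightarrow> 'b::{real_normed_vector, second_countable_topology}"
  assumes "Lploc p f" "p > 0"
  shows "Lploc p (\<lambda>x. - f x)"
  by (rule Lploc_le[OF assms]) (use Lploc_measurable[OF assms(1)] in auto)

subsection \<open>Weights\<close>

lemma ennreal_half_mult: "0 \<le> L \<Longrightarrow> ennreal (1/2) * ennreal L = ennreal (L / 2)"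
  by (subst ennreal_mult[symmetric]) simp_all

lemma weight_nonneg: "weight w \<Longrightarrow> 0 \<le> w x"
  by (simp add: weight_def)

lemma weight_measurable [measurable_dest]: "weight w \<Longrightarrow> w \<in> borel_measurable lebesgue"
  by (simp add: weight_def Lploc_def)

lemma wmeas_density:
  "weight w \<Longrightarrow> E \<in> sets lebesgue \<Longrightarrow> wmeas w E = emeasure (density lebesgue (\<lambda>x. ennreal (w x))) E"
  using weight_measurable[of w] by (simp add: wmeas_def set_nn_integral_density)

lemma wmeas_mono: "E \<subseteq> F \<Longrightarrow> wmeas w E \<le> wmeas w F"
  unfolding wmeas_def by (intro nn_integral_mono) (auto simp: indicator_def)

lemma wmeas_cube_finite:
  assumes "weight w" "Q \<in> cubes"
  shows "wmeas w (cube_set Q) < \<infinity>"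
proof -
  have "norm (w x) powr 1 = w x" for x using weight_nonneg[OF assms(1), of x] by simp
  then show ?thesis using assms by (simp only: weight_def Lploc_def wmeas_def)
qed

lemma wmeas_Un:
  assumes w: "weight w" and E: "E \<in> sets lebesgue" "F \<in> sets lebesgue" "E \<inter> F = {}"
  shows "wmeas w (E \<union> F) = wmeas w E + wmeas w F"
  using E plus_emeasure[of E "density lebesgue (\<lambda>x. ennreal (w x))" F] by (simp add: wmeas_density[OF w])

lemma wmeas_cube_mean:
  assumes w: "weight w" and Q: "Q \<in> cubes"
  obtains m where "m \<ge> 0" "wmeas w (cube_set Q) = ennreal m * emeasure lebesgue (cube_set Q)"
    "avgE (cube_set Q) (\<lambda>y. ennreal (w y)) = ennreal m" "avgLp 1 (cube_set Q) w = ennreal m"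
proof -
  define L where "L = snd Q ^ CARD('a)"
  have l: "L > 0" "emeasure lebesgue (cube_set Q) = ennreal L"
    using Q by (auto simp: emeasure_cube_set L_def) (simp add: cubes_def)
  obtain W where W: "W \<ge> 0" "wmeas w (cube_set Q) = ennreal W"
    using wmeas_cube_finite[OF w Q] by (cases "wmeas w (cube_set Q)") auto
  have 1: "avgE (cube_set Q) (\<lambda>y. ennreal (w y)) = ennreal (W / L)"
    using W l unfolding avgE_def wmeas_def[symmetric] by (simp add: divide_ennreal)
  then have "avgLp 1 (cube_set Q) w = ennreal (W / L)"
    using w W l by (simp add: avgLp_def weight_def enn_powr_def)
  moreover have "ennreal W = ennreal (W / L) * ennreal L"
    using W l by (subst ennreal_mult[symmetric]) auto
  ultimately show ?thesis using 1 W l by (intro that[of "W / L"]) auto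
qed

text \<open>In substance Hoelder's inequality on E: w(E) <= |E|^(1-1/s) (int_Q w^s)^(1/s), followed
  by the reverse Hoelder condition. It is obtained by splitting \<open>w\<close> at the height
  \<open>M\<close>.\<close>

lemma RH_small_sets:
  fixes w :: "(real^('n::finite)) \<Rightarrow> real"
  assumes RH: "RH s w" and s: "s > 1"
  obtains C where "C > 0" "\<And>Q E \<delta>. Q \<in> cubes \<Longrightarrow> E \<in> sets lebesgue \<Longrightarrow> E \<subseteq> cube_set Q \<Longrightarrow> \<delta> \<ge> 0 \<Longrightarrow>
    emeasure lebesgue E \<le> ennreal \<delta> * emeasure lebesgue (cube_set Q) \<Longrightarrow>
    wmeas w E \<le> ennreal (C * \<delta> powr (1 - 1 / s)) * wmeas w (cube_set Q)"
proof -
  have w: "weight w" using RH by (simp add: RH_def)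
  have [measurable]: "w \<in> borel_measurable lebesgue" using w by (rule weight_measurable)
  obtain C1 where C1: "\<And>Q. Q \<in> cubes \<Longrightarrow> avgLp s (cube_set Q) w \<le> ennreal C1 * avgLp 1 (cube_set Q) w"
    using RH by (auto simp: RH_def)
  define C where "C = max C1 0"
  have C: "C \<ge> 0" "\<And>Q. Q \<in> cubes \<Longrightarrow> avgLp s (cube_set Q) w \<le> ennreal C * avgLp 1 (cube_set Q) w"
    using C1 by (auto simp: C_def max_def ennreal_neg)
  show ?thesis
  proof (rule that[of "1 + C powr s"])
    show "1 + C powr s > 0" by (simp add: add_pos_nonneg)
    fix Q :: "'n cube" and E and \<delta> :: real
    assume Q: "Q \<in> cubes" and E [measurable]: "E \<in> sets lebesgue" and EQ: "E \<subseteq> cube_set Q"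
      and d0: "\<delta> \<ge> 0" and le: "emeasure lebesgue E \<le> ennreal \<delta> * emeasure lebesgue (cube_set Q)"
    let ?m = "emeasure lebesgue (cube_set Q)"
    obtain m where m: "m \<ge> 0" "wmeas w (cube_set Q) = ennreal m * ?m" "avgLp 1 (cube_set Q) w = ennreal m"
      using wmeas_cube_mean[OF w Q] by metis
    show "wmeas w E \<le> ennreal ((1 + C powr s) * \<delta> powr (1 - 1 / s)) * wmeas w (cube_set Q)"
    proof (cases "m = 0 \<or> \<delta> = 0")
      case True
      have "wmeas w E = 0" if "\<delta> = 0"
        using le that unfolding wmeas_def by (intro nn_integral_null_set) (auto simp: null_sets_def)
      then show ?thesis using True wmeas_mono[OF EQ, of w] m by auto
    next
      case False
      then have m0: "m > 0" and d: "\<delta> > 0" using m d0 by auto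
      have ws: "(\<integral>\<^sup>+x\<in>cube_set Q. ennreal (w x powr s) \<partial>lebesgue) \<le> ennreal ((C * m) powr s) * ?m"
      proof -
        have "avgLp s (cube_set Q) w \<le> ennreal (C * m)" using C(2)[OF Q] C(1) m by (simp add: ennreal_mult)
        then show ?thesis using s C(1) m weight_nonneg[OF w] by (subst (asm) avgLp_le_iff[OF Q]) simp_all
      qed
      \<comment> \<open>This height balances the two terms: \<open>M * \<delta>\<close> and
        \<open>M powr (1 - s) * m powr s\<close> both equal
        \<open>m * \<delta> powr (1 - 1 / s)\<close>.\<close>
      define M where "M = m * \<delta> powr (- 1 / s)"
      have M: "M > 0" using m0 d by (simp add: M_def)
      have "wmeas w E \<le> (\<integral>\<^sup>+x. ennreal M * indicator E x + ennreal (M powr (1 - s)) * (ennreal (w x powr s) * indicator (cube_set Q) x) \<partial>lebesgue)"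
        unfolding wmeas_def
      proof (rule nn_integral_mono)
        fix x
        have "w x \<le> M + M powr (1 - s) * w x powr s"
          using powr_le_split[of 1 s "w x" M] s M weight_nonneg[OF w, of x] by simp
        then have "ennreal (w x) \<le> ennreal M + ennreal (M powr (1 - s)) * ennreal (w x powr s)"
          using M by (simp add: ennreal_mult[symmetric] ennreal_plus[symmetric] ennreal_leI del: ennreal_plus)
        then show "ennreal (w x) * indicator E x \<le> ennreal M * indicator E x + ennreal (M powr (1 - s)) * (ennreal (w x powr s) * indicator (cube_set Q) x)"
          using EQ by (auto simp: indicator_def)
      qed
      also have "\<dots> = ennreal M * emeasure lebesgue E + ennreal (M powr (1 - s)) * (\<integral>\<^sup>+x\<in>cube_set Q. ennreal (w x powr s) \<partial>lebesgue)"
        by (simp add: nn_integral_add nn_integral_cmult nn_integral_cmult_indicator)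
      also have "\<dots> \<le> ennreal M * (ennreal \<delta> * ?m) + ennreal (M powr (1 - s)) * (ennreal ((C * m) powr s) * ?m)"
        by (intro add_mono mult_left_mono le ws) auto
      also have "\<dots> = ennreal (M * \<delta> + M powr (1 - s) * (C * m) powr s) * ?m"
        using M d by (simp only: mult.assoc[symmetric] ennreal_mult[symmetric] powr_ge_zero less_imp_le distrib_right[symmetric]
             ennreal_plus[symmetric] mult_nonneg_nonneg)
      also have "M * \<delta> + M powr (1 - s) * (C * m) powr s = (1 + C powr s) * \<delta> powr (1 - 1 / s) * m"
      proof -
        have 1: "M * \<delta> = m * \<delta> powr (1 - 1 / s)"
          using d by (simp add: M_def powr_diff powr_minus field_simps)
        have "M powr (1 - s) * m powr s = m * \<delta> powr (- 1 / s * (1 - s))"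
        proof -
          have "M powr (1 - s) = m powr (1 - s) * \<delta> powr (- 1 / s * (1 - s))"
            using m0 d by (simp add: M_def powr_mult powr_powr)
          moreover have "m powr (1 - s) * m powr s = m" using m0 by (simp flip: powr_add)
          ultimately show ?thesis by (simp add: ac_simps)
        qed
        also have "- 1 / s * (1 - s) = 1 - 1 / s" using s by (simp add: field_simps)
        finally have 2: "M powr (1 - s) * m powr s = m * \<delta> powr (1 - 1 / s)" .
        have "M powr (1 - s) * (C * m) powr s = C powr s * (M powr (1 - s) * m powr s)"
          using C m by (simp add: powr_mult)
        then show ?thesis unfolding 1 2 by (simp add: algebra_simps)
      qed
      also have "ennreal ((1 + C powr s) * \<delta> powr (1 - 1 / s) * m) * ?m = ennreal ((1 + C powr s) * \<delta> powr (1 - 1 / s)) * (ennreal m * ?m)"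
        using m by (subst ennreal_mult) (auto simp: mult.assoc add_nonneg_nonneg)
      finally show ?thesis using m by simp
    qed
  qed
qed

text \<open>The form of A_infinity as absolute continuity, uniform over all cubes. Reverse Hoelder
  and Muckenhoupt weights both satisfy it; doubling and the control of the S-part of the
  decomposition rest on it.\<close>

definition small_sets_cond :: "((real^('n::finite)) \<Rightarrow> real) \<Rightarrow> bool" where
  "small_sets_cond w \<longleftrightarrow> weight w \<and> (\<forall>e>0. \<exists>d>0. \<forall>Q\<in>cubes. \<forall>E\<in>sets lebesgue. E \<subseteq> cube_set Q \<longrightarrow>
     emeasure lebesgue E \<le> ennreal d * emeasure lebesgue (cube_set Q) \<longrightarrow>
     wmeas w E \<le> ennreal e * wmeas w (cube_set Q))"

lemma RH_imp_small_sets_cond: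
  fixes w :: "(real^('n::finite)) \<Rightarrow> real"
  assumes RH: "RH s w" and s: "s > 1"
  shows "small_sets_cond w"
  unfolding small_sets_cond_def
proof (intro conjI allI impI)
  show "weight w" using RH by (simp add: RH_def)
  fix e :: real assume e: "e > 0"
  obtain C where C: "C > 0" "\<And>Q E \<delta>. Q \<in> cubes \<Longrightarrow> E \<in> sets lebesgue \<Longrightarrow> E \<subseteq> cube_set Q \<Longrightarrow> \<delta> \<ge> 0 \<Longrightarrow>
    emeasure lebesgue E \<le> ennreal \<delta> * emeasure lebesgue (cube_set Q) \<Longrightarrow>
    wmeas w E \<le> ennreal (C * \<delta> powr (1 - 1 / s)) * wmeas w (cube_set Q)"
    using RH_small_sets[OF RH s] by blast
  define \<theta> where "\<theta> = 1 - 1 / s"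
  have th: "\<theta> > 0" using s by (simp add: \<theta>_def)
  define d where "d = (e / C) powr (1 / \<theta>)"
  have d: "d > 0" "C * d powr \<theta> = e" using e C th by (auto simp: d_def powr_powr)
  then show "\<exists>d>0. \<forall>Q\<in>cubes. \<forall>E\<in>sets lebesgue. E \<subseteq> cube_set Q \<longrightarrow>
     emeasure lebesgue E \<le> ennreal d * emeasure lebesgue (cube_set Q) \<longrightarrow>
     wmeas w E \<le> ennreal e * wmeas w (cube_set Q)"
    using C(2)[of _ _ d] unfolding \<theta>_def[symmetric] by (intro exI[of _ d]) auto
qed

text \<open>What the Muckenhoupt conditions yield directly: large subsets keep a fixed share of the
  weight. Turning this into \<open>small_sets_cond\<close> takes a complement and a dyadic
  iteration.\<close>

definition half_sets_cond :: "((real^('n::finite)) \<Rightarrow> real) \<Rightarrow> real \<Rightarrow> bool" where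
  "half_sets_cond w c \<longleftrightarrow> (\<forall>Q\<in>cubes. \<forall>E\<in>sets lebesgue. E \<subseteq> cube_set Q \<longrightarrow>
     ennreal (1/2) * emeasure lebesgue (cube_set Q) \<le> emeasure lebesgue E \<longrightarrow>
     ennreal c * wmeas w (cube_set Q) \<le> wmeas w E)"

text \<open>Almost everywhere on Q the weight is at least its mean divided by \<open>C\<close>;
  integrating this over \<open>E\<close> gives the share \<open>1 / (2 * C)\<close>.\<close>

lemma A1_half_sets:
  fixes w :: "(real^('n::finite)) \<Rightarrow> real"
  assumes A1: "A1 w"
  obtains c where "c > 0" "half_sets_cond w c"
proof -
  have w: "weight w" using A1 by (simp add: A1_def)
  have [measurable]: "w \<in> borel_measurable lebesgue" using w by (rule weight_measurable)
  obtain C1 where C1: "\<And>Q. Q \<in> cubes \<Longrightarrow> AE x in lebesgue. x \<in> cube_set Q \<longrightarrow>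
          avgE (cube_set Q) (\<lambda>y. ennreal (w y)) \<le> ennreal (C1 * w x)"
    using A1 by (auto simp: A1_def)
  define C where "C = max C1 1"
  have C: "C \<ge> 1" "C1 * w x \<le> C * w x" for x
    using weight_nonneg[OF w, of x] by (auto simp: C_def intro: mult_right_mono)
  show ?thesis
  proof (rule that[of "1 / (2 * C)"])
    show "1 / (2 * C) > 0" using C by simp
    show "half_sets_cond w (1 / (2 * C))"
      unfolding half_sets_cond_def
    proof (intro ballI impI)
      fix Q :: "'n cube" and E
      assume Q: "Q \<in> cubes" and E [measurable]: "E \<in> sets lebesgue" and EQ: "E \<subseteq> cube_set Q"
        and le: "ennreal (1/2) * emeasure lebesgue (cube_set Q) \<le> emeasure lebesgue E"
      let ?m = "emeasure lebesgue (cube_set Q)"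
      obtain m where m: "m \<ge> 0" "wmeas w (cube_set Q) = ennreal m * ?m" "avgE (cube_set Q) (\<lambda>y. ennreal (w y)) = ennreal m"
        using wmeas_cube_mean[OF w Q] by metis
      have "ennreal (1 / (2 * C)) * wmeas w (cube_set Q) = ennreal (1 / C) * (ennreal m * (ennreal (1/2) * ?m))"
      proof -
        have "ennreal (1 / (2 * C)) = ennreal (1 / C) * ennreal (1 / 2)"
          using C by (subst ennreal_mult[symmetric]) (auto simp: field_simps)
        then show ?thesis using m by (simp add: ac_simps)
      qed
      also have "\<dots> \<le> ennreal (1 / C) * (ennreal m * emeasure lebesgue E)"
        by (intro mult_left_mono le) auto
      also have "ennreal m * emeasure lebesgue E = (\<integral>\<^sup>+x. ennreal m * indicator E x \<partial>lebesgue)"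
        by (simp add: nn_integral_cmult_indicator)
      also have "\<dots> \<le> (\<integral>\<^sup>+x. ennreal C * (ennreal (w x) * indicator E x) \<partial>lebesgue)"
      proof (rule nn_integral_mono_AE)
        show "AE x in lebesgue. ennreal m * indicator E x \<le> ennreal C * (ennreal (w x) * indicator E x)"
          using C1[OF Q]
        proof eventually_elim
          case (elim x)
          have "ennreal (C1 * w x) \<le> ennreal C * ennreal (w x)"
            using C weight_nonneg[OF w, of x] by (simp add: ennreal_mult[symmetric] ennreal_leI)
          then show ?case using elim EQ m(3) by (auto simp: indicator_def intro: order_trans)
        qed
      qed
      also have "\<dots> = ennreal C * wmeas w E"
        by (simp add: nn_integral_cmult wmeas_def)
      finally have "ennreal (1 / (2 * C)) * wmeas w (cube_set Q) \<le> ennreal (1 / C) * (ennreal C * wmeas w E)"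
        by (simp add: mult_left_mono)
      also have "\<dots> = wmeas w E"
        using C by (simp add: mult.assoc[symmetric] ennreal_mult[symmetric])
      finally show "ennreal (1 / (2 * C)) * wmeas w (cube_set Q) \<le> wmeas w E" .
    qed
  qed
qed

text \<open>Hoelder's inequality between w(E) and the integral of the dual weight \<open>v\<close>,
  in additive form: wherever \<open>w\<close> is positive, one of \<open>l * w\<close> and its power
  with exponent \<open>- 1 / (p - 1)\<close> is at least 1. The free parameter \<open>l\<close> is
  chosen at the end.\<close>

lemma Ap_half_sets:
  fixes w :: "(real^('n::finite)) \<Rightarrow> real"
  assumes Ap: "Ap p w" and p: "p > 1"
  obtains c where "c > 0" "half_sets_cond w c"
proof -
  have w: "weight w" using Ap by (simp add: Ap_def)
  have [measurable]: "w \<in> borel_measurable lebesgue" using w by (rule weight_measurable)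
  define v where "v y = (if w y = 0 then \<infinity> else ennreal (w y powr (- 1 / (p - 1))))" for y
  have [measurable]: "v \<in> borel_measurable lebesgue" unfolding v_def by measurable
  obtain C1 where C1: "\<And>Q. Q \<in> cubes \<Longrightarrow> avgE (cube_set Q) (\<lambda>y. ennreal (w y)) *
        enn_powr (avgE (cube_set Q) v) (p - 1) \<le> ennreal C1"
    using Ap unfolding Ap_def v_def by blast
  define C where "C = max C1 1"
  have C: "C \<ge> 1" "\<And>Q. Q \<in> cubes \<Longrightarrow> avgE (cube_set Q) (\<lambda>y. ennreal (w y)) *
        enn_powr (avgE (cube_set Q) v) (p - 1) \<le> ennreal C"
    using order_trans[OF C1 ennreal_leI[of C1 C]] by (auto simp: C_def)
  define c where "c = 1 / (4 powr p * C)"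
  have c: "c > 0" using C by (simp add: c_def)
  have split: "emeasure lebesgue E \<le> ennreal l * wmeas w E + ennreal (l powr (- 1 / (p - 1))) * (\<integral>\<^sup>+x\<in>cube_set Q. v x \<partial>lebesgue)"
    if [measurable]: "E \<in> sets lebesgue" and EQ: "E \<subseteq> cube_set Q" and l: "l > 0" for E Q l
  proof -
    have "emeasure lebesgue E = (\<integral>\<^sup>+x. indicator E x \<partial>lebesgue)" by simp
    also have "\<dots> \<le> (\<integral>\<^sup>+x. ennreal l * (ennreal (w x) * indicator E x) + ennreal (l powr (- 1 / (p - 1))) * (v x * indicator (cube_set Q) x) \<partial>lebesgue)"
    proof (rule nn_integral_mono)
      fix x
      have "1 \<le> ennreal l * ennreal (w x) + ennreal (l powr (- 1 / (p - 1))) * v x"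
      proof (cases "w x = 0")
        case True
        then show ?thesis using l by (simp add: v_def ennreal_mult_top)
      next
        case False
        then have wx: "w x > 0" using weight_nonneg[OF w, of x] by simp
        show ?thesis
        proof (cases "l * w x \<ge> 1")
          case True
          then have "1 \<le> ennreal l * ennreal (w x)"
            using l wx by (simp add: ennreal_mult[symmetric] flip: ennreal_1)
          then show ?thesis by (rule order_trans) simp
        next
          case f: False
          have "1 powr (- 1 / (p - 1)) \<le> (l * w x) powr (- 1 / (p - 1))"
            using f l wx p by (intro powr_mono2') auto
          then have "1 \<le> ennreal (l powr (- 1 / (p - 1))) * ennreal (w x powr (- 1 / (p - 1)))"
            using l wx by (simp add: ennreal_mult[symmetric] powr_mult flip: ennreal_1)
          then show ?thesis using False by (simp add: v_def add_increasing)
        qed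
      qed
      then show "indicator E x \<le> ennreal l * (ennreal (w x) * indicator E x) + ennreal (l powr (- 1 / (p - 1))) * (v x * indicator (cube_set Q) x)"
        using EQ by (auto simp: indicator_def)
    qed
    also have "\<dots> = ennreal l * wmeas w E + ennreal (l powr (- 1 / (p - 1))) * (\<integral>\<^sup>+x\<in>cube_set Q. v x \<partial>lebesgue)"
      by (simp add: nn_integral_add nn_integral_cmult wmeas_def)
    finally show ?thesis .
  qed
  have "half_sets_cond w c"
    unfolding half_sets_cond_def
  proof (intro ballI impI)
    fix Q :: "'n cube" and E
    assume Q: "Q \<in> cubes" and E: "E \<in> sets lebesgue" and EQ: "E \<subseteq> cube_set Q"
      and le: "ennreal (1/2) * emeasure lebesgue (cube_set Q) \<le> emeasure lebesgue E"
    let ?m = "emeasure lebesgue (cube_set Q)"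
    define L where "L = snd Q ^ CARD('n)"
    have L: "L > 0" "?m = ennreal L" using Q by (auto simp: emeasure_cube_set L_def) (simp add: cubes_def)
    obtain m where m: "m \<ge> 0" "wmeas w (cube_set Q) = ennreal m * ?m" "avgE (cube_set Q) (\<lambda>y. ennreal (w y)) = ennreal m"
      using wmeas_cube_mean[OF w Q] by metis
    show "ennreal c * wmeas w (cube_set Q) \<le> wmeas w E"
    proof (cases "m = 0")
      case True
      then show ?thesis using m by simp
    next
      case False
      then have m0: "m > 0" using m by simp
      \<comment> \<open>The mean of \<open>w\<close> is positive here, so an infinite mean of
        \<open>v\<close> would make the A_p product infinite.\<close>
      have "avgE (cube_set Q) v \<noteq> \<infinity>"
      proof
        assume "avgE (cube_set Q) v = \<infinity>"
        then show False using C(2)[OF Q] m0 by (simp add: m(3) enn_powr_def ennreal_mult_top top_unique)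
      qed
      then obtain k where k: "k \<ge> 0" "avgE (cube_set Q) v = ennreal k" by (cases "avgE (cube_set Q) v") auto
      have vk: "(\<integral>\<^sup>+x\<in>cube_set Q. v x \<partial>lebesgue) \<le> ennreal k * ?m"
        using k(2) unfolding avgE_def
        by (subst ennreal_divide_le_iff[symmetric]) (use Q emeasure_cube_finite[OF Q] in auto)
      have kC: "m * k powr (p - 1) \<le> C"
        using C(2)[OF Q] C(1) m0 k by (simp add: m(3) enn_powr_def ennreal_mult[symmetric] ennreal_le_iff)
      obtain W where W: "W \<ge> 0" "wmeas w E = ennreal W"
        using le_less_trans[OF wmeas_mono[OF EQ, of w] wmeas_cube_finite[OF w Q]] by (cases "wmeas w E") auto
      have real_split: "L / 2 \<le> l * W + l powr (- 1 / (p - 1)) * k * L" if l: "l > 0" for l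
      proof -
        have "ennreal (1/2) * ?m \<le> ennreal l * wmeas w E + ennreal (l powr (- 1 / (p - 1))) * (ennreal k * ?m)"
          using le split[OF E EQ l] vk by (meson add_left_mono mult_left_mono order_trans zero_le)
        also have "\<dots> = ennreal (l * W + l powr (- 1 / (p - 1)) * (k * L))"
          using l W k L by (simp add: ennreal_mult ennreal_plus)
        also have "ennreal (1/2) * ?m = ennreal (L / 2)"
          unfolding L(2) using L(1) by (intro ennreal_half_mult) simp
        finally have "L / 2 \<le> l * W + l powr (- 1 / (p - 1)) * (k * L)"
          using l W k L by (subst (asm) ennreal_le_iff) auto
        then show ?thesis by (simp only: mult.assoc)
      qed
      have k0: "k > 0"
      proof (rule ccontr)
        assume "\<not> k > 0"
        then have "k = 0" using k by simp
        then have *: "L / 2 \<le> l * W" if "l > 0" for l using real_split[OF that] by simp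
        have "L / 2 \<le> L / (4 * (W + 1)) * W" using L W by (intro *) auto
        also have "\<dots> \<le> L / 4" using L W by (simp add: field_simps)
        finally show False using L by simp
      qed
      \<comment> \<open>With this value the term with the dual weight is \<open>L / 4\<close>, half
        of the left side \<open>L / 2\<close>, and can be absorbed.\<close>
      define l where "l = (4 * k) powr (p - 1)"
      have l: "l > 0" using k0 by (simp add: l_def)
      have "l powr (- 1 / (p - 1)) = (4 * k) powr ((p - 1) * (- 1 / (p - 1)))"
        by (simp add: l_def powr_powr)
      also have "(p - 1) * (- 1 / (p - 1)) = - 1" using p by simp
      finally have h: "l powr (- 1 / (p - 1)) * k = 1 / 4" using k0 by (simp add: powr_minus field_simps)
      have "L / 2 \<le> l * W + 1 / 4 * L" using real_split[OF l] unfolding h .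
      then have "L / 4 \<le> l * W" by simp
      then have "m * L / 4 \<le> m * l * W" using m0 by (simp add: mult.assoc)
      also have "m * l = 4 powr (p - 1) * (m * k powr (p - 1))"
        using k0 by (simp add: l_def powr_mult)
      also have "\<dots> * W \<le> 4 powr (p - 1) * C * W"
        using W kC by (intro mult_right_mono mult_left_mono) auto
      finally have "m * L \<le> 4 powr p * C * W" by (simp add: powr_diff field_simps)
      then have "c * (m * L) \<le> W" using C by (simp add: c_def field_simps)
      then show ?thesis using m L W c by (simp add: ennreal_mult[symmetric] ennreal_leI)
    qed
  qed
  then show ?thesis using that c by blast
qed

text \<open>Pass to the complement of \<open>E\<close> in the cube: it has at least half the
  measure, hence a fixed share of the weight.\<close>

lemma half_sets_small:
  fixes w :: "(real^('n::finite)) \<Rightarrow> real"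
  assumes w: "weight w" and c: "c > 0" "half_sets_cond w c"
  obtains \<eta> where "0 < \<eta>" "\<eta> < 1" "\<And>Q E. Q \<in> cubes \<Longrightarrow> E \<in> sets lebesgue \<Longrightarrow> E \<subseteq> cube_set Q \<Longrightarrow>
    emeasure lebesgue E \<le> ennreal (1/2) * emeasure lebesgue (cube_set Q) \<Longrightarrow>
     wmeas w E \<le> ennreal \<eta> * wmeas w (cube_set Q)"
proof -
  \<comment> \<open>The minimum keeps \<open>1 - d\<close> positive whatever the size of
    \<open>c\<close>.\<close>
  define d where "d = min c (1/2)"
  have d: "d > 0" "d \<le> c" "d < 1" using c by (auto simp: d_def)
  show ?thesis
  proof (rule that[of "1 - d"])
    fix Q :: "'n cube" and E
    assume Q: "Q \<in> cubes" and E: "E \<in> sets lebesgue" and EQ: "E \<subseteq> cube_set Q"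
      and le: "emeasure lebesgue E \<le> ennreal (1/2) * emeasure lebesgue (cube_set Q)"
    let ?F = "cube_set Q - E"
    have un: "E \<union> ?F = cube_set Q" using EQ by auto
    define L where "L = snd Q ^ CARD('n)"
    have L: "L > 0" "emeasure lebesgue (cube_set Q) = ennreal L" using Q by (auto simp: emeasure_cube_set L_def) (simp add: cubes_def)
    obtain e where e: "e \<ge> 0" "emeasure lebesgue E = ennreal e"
      using emeasure_mono[OF EQ, of lebesgue] L by (cases "emeasure lebesgue E") (auto simp: top_unique)
    have "emeasure lebesgue ?F = emeasure lebesgue (cube_set Q) - emeasure lebesgue E"
      using E EQ e by (intro emeasure_Diff) auto
    also have "\<dots> = ennreal (L - e)" using e L by (simp add: ennreal_minus)
    finally have F: "emeasure lebesgue ?F = ennreal (L - e)" .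
    have "ennreal e \<le> ennreal (L / 2)"
      using le unfolding e(2) L(2) by (subst (asm) ennreal_half_mult) (use L in auto)
    then have "e \<le> L / 2" using L by (subst (asm) ennreal_le_iff) auto
    then have "ennreal (1/2) * emeasure lebesgue (cube_set Q) \<le> emeasure lebesgue ?F"
      unfolding F L(2) using L(1) by (subst ennreal_half_mult) (auto intro: ennreal_leI)
    then have lo: "ennreal c * wmeas w (cube_set Q) \<le> wmeas w ?F"
      using c(2) Q E unfolding half_sets_cond_def by (auto simp: sets.Diff)
    have sum: "wmeas w (cube_set Q) = wmeas w E + wmeas w ?F"
      using wmeas_Un[OF w E, of ?F] E unfolding un by auto
    obtain W where W: "W \<ge> 0" "wmeas w (cube_set Q) = ennreal W"
      using wmeas_cube_finite[OF w Q] by (cases "wmeas w (cube_set Q)") auto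
    obtain a where a: "a \<ge> 0" "wmeas w E = ennreal a"
      using sum W by (cases "wmeas w E") auto
    obtain b where b: "b \<ge> 0" "wmeas w ?F = ennreal b"
      using sum W by (cases "wmeas w ?F") auto
    have "W = a + b" using sum W a b by (simp add: ennreal_plus[symmetric] del: ennreal_plus)
    moreover have "c * W \<le> b" using lo W b c(1) by (simp add: ennreal_mult[symmetric] ennreal_le_iff)
    moreover have "d * W \<le> c * W" using d W by (intro mult_right_mono) auto
    ultimately have "a \<le> (1 - d) * W" by (simp add: algebra_simps)
    then show "wmeas w E \<le> ennreal (1 - d) * wmeas w (cube_set Q)"
      using W a d by (simp add: ennreal_mult[symmetric] ennreal_leI)
  qed (use d in auto)
qed

text \<open>One step replaces E by the union E1 of the dyadic cubes in which E has density above b =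
  2^-(n+1). Then E lies in E1 up to a null set and |E1| <= |E| / b. In a maximal cube E has density
  at most 1/2, because the parent has density at most b and 2^n times the volume. Each step thus
  gains the factor \<open>\<eta>\<close> in weight for a factor b in measure.\<close>

lemma small_sets_iterate:
  fixes w :: "(real^('n::finite)) \<Rightarrow> real"
  assumes w: "weight w" and \<eta>: "0 < \<eta>" and Q: "Q \<in> cubes"
    and half: "\<And>Q E. Q \<in> cubes \<Longrightarrow> E \<in> sets lebesgue \<Longrightarrow> E \<subseteq> cube_set Q \<Longrightarrow>
      emeasure lebesgue E \<le> ennreal (1/2) * emeasure lebesgue (cube_set Q) \<Longrightarrow>
      wmeas w E \<le> ennreal \<eta> * wmeas w (cube_set Q)"
    and E: "E \<in> sets lebesgue" "E \<subseteq> cube_set Q"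
    and le: "emeasure lebesgue E \<le> ennreal ((1 / 2 ^ (CARD('n) + 1)) ^ k) * emeasure lebesgue (cube_set Q)"
  shows "wmeas w E \<le> ennreal (\<eta> ^ k) * wmeas w (cube_set Q)"
  using E le
proof (induction k arbitrary: E)
  case 0
  then show ?case using wmeas_mono[of E "cube_set Q" w] by simp
next
  case (Suc k)
  note E = \<open>E \<in> sets lebesgue\<close> \<open>E \<subseteq> cube_set Q\<close>
  have [measurable]: "w \<in> borel_measurable lebesgue" "E \<in> sets lebesgue" using weight_measurable[OF w] E by auto
  define b :: real where "b = 1 / 2 ^ (CARD('n) + 1)"
  have b: "0 < b" "b < 1"
    using one_less_power[of "2::real" "CARD('n) + 1"] by (auto simp: b_def)
  let ?\<phi> = "\<lambda>P. (\<integral>\<^sup>+y\<in>cube_set P. indicator E y \<partial>lebesgue) > ennreal b * emeasure lebesgue (cube_set P)"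
  have int: "(\<integral>\<^sup>+y\<in>A. indicator E y \<partial>lebesgue) = emeasure lebesgue (E \<inter> A)" if "A \<in> sets lebesgue" for A
  proof -
    have "(\<integral>\<^sup>+y\<in>A. indicator E y \<partial>lebesgue) = (\<integral>\<^sup>+y. indicator (E \<inter> A) y \<partial>lebesgue)"
      by (rule nn_integral_cong) (auto simp: indicator_def)
    then show ?thesis using that E by simp
  qed
  define E1 where "E1 = (\<Union>P\<in>dyads ?\<phi> Q. cube_set P)"
  have E1 [measurable]: "E1 \<in> sets lebesgue" unfolding E1_def by simp
  have E1Q: "E1 \<subseteq> cube_set Q"
    unfolding E1_def using dyads_cubes[OF Q] subcube_imp_subset by blast
  have "AE x in lebesgue. x \<in> cube_set Q \<longrightarrow> indicator E x > ennreal b \<longrightarrow> x \<in> E1"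
    using AE_dyadic_average[OF Q, of "indicator E" b] b unfolding E1_def by simp
  then have AE: "AE x in lebesgue. x \<in> E \<longrightarrow> x \<in> E1"
    by eventually_elim (use E b in \<open>auto simp: indicator_def\<close>)
  have small: "ennreal ((1 / 2 ^ (CARD('n) + 1)) ^ Suc k) \<le> ennreal b"
    using b power_le_one[of b k] unfolding b_def[symmetric] by (intro ennreal_leI) (simp add: mult_left_le)
  \<comment> \<open>Since Q is not selected, every maximal cube has a parent in the grid of Q, and
    the parent is not selected.\<close>
  have notQ: "\<not> ?\<phi> Q"
  proof -
    have "emeasure lebesgue (E \<inter> cube_set Q) \<le> emeasure lebesgue E" by (intro emeasure_mono) auto
    also have "\<dots> \<le> ennreal b * emeasure lebesgue (cube_set Q)"
      using Suc.prems(3) mult_right_mono[OF small, of "emeasure lebesgue (cube_set Q)"] by (meson order_trans zero_le)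
    finally show ?thesis by (simp add: int not_less)
  qed
  have "wmeas w E = (\<integral>\<^sup>+x\<in>E \<inter> E1. ennreal (w x) \<partial>lebesgue)"
    unfolding wmeas_def by (rule nn_integral_cong_AE) (use AE in eventually_elim, auto simp: indicator_def)
  also have "\<dots> \<le> ennreal \<eta> * (\<integral>\<^sup>+x\<in>E1. ennreal (w x) \<partial>lebesgue)"
    unfolding E1_def
  proof (rule emeasure_Union_maxdy_le[OF Q])
    fix P assume P: "P \<in> maxdy ?\<phi> Q"
    then obtain x j where x: "x \<in> cube_set Q" "P = dy Q j x" "?\<phi> P" "\<And>i. i < j \<Longrightarrow> \<not> ?\<phi> (dy Q i x)"
      unfolding maxdy_def by blast
    have Pc: "P \<in> cubes" using x Q by simp
    have "j \<noteq> 0"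
    proof
      assume "j = 0"
      then show False using x dy_0[OF Q x(1)] notQ by metis
    qed
    define R where "R = dy Q (j - 1) x"
    have R: "R \<in> cubes" "\<not> ?\<phi> R" "subcube P R"
      using x(4)[of "j - 1"] \<open>j \<noteq> 0\<close> Q subcube_dy[OF Q, of "j - 1" j x] by (auto simp: R_def x(2))
    have RP: "snd R = 2 * snd P"
      using \<open>j \<noteq> 0\<close> by (cases j) (auto simp: R_def x(2))
    have "emeasure lebesgue (E \<inter> cube_set P) \<le> emeasure lebesgue (E \<inter> cube_set R)"
      using subcube_imp_subset[OF R(3)] by (intro emeasure_mono) auto
    also have "\<dots> \<le> ennreal b * emeasure lebesgue (cube_set R)"
      using R(2) by (simp add: int not_less)
    also have "\<dots> = ennreal (1/2) * emeasure lebesgue (cube_set P)"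
    proof -
      have sp: "snd P > 0" using Pc by (simp add: cubes_def)
      have "b * snd R ^ CARD('n) = 1/2 * snd P ^ CARD('n)" by (simp add: RP b_def power_mult_distrib)
      then show ?thesis using sp b R Pc RP
        by (simp only: emeasure_cube_set ennreal_mult[symmetric] zero_le_power less_imp_le mult_nonneg_nonneg zero_le_numeral
              zero_le_divide_1_iff)
    qed
    finally have "wmeas w (E \<inter> cube_set P) \<le> ennreal \<eta> * wmeas w (cube_set P)"
      by (intro half Pc) auto
    then show "(\<integral>\<^sup>+x\<in>E \<inter> cube_set P. ennreal (w x) \<partial>lebesgue) \<le> ennreal \<eta> * (\<integral>\<^sup>+x\<in>cube_set P. ennreal (w x) \<partial>lebesgue)"
      by (simp add: wmeas_def)
  qed auto
  finally have 1: "wmeas w E \<le> ennreal \<eta> * wmeas w E1" by (simp add: wmeas_def)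
  have "emeasure lebesgue E1 = (\<integral>\<^sup>+x\<in>UNIV \<inter> E1. 1 \<partial>lebesgue)" by simp
  also have "\<dots> \<le> ennreal (1 / b) * (\<integral>\<^sup>+x\<in>E1. indicator E x \<partial>lebesgue)"
    unfolding E1_def
  proof (rule emeasure_Union_maxdy_le[OF Q])
    fix P assume "P \<in> maxdy ?\<phi> Q"
    then have "?\<phi> P" by (auto simp: maxdy_def)
    then have "ennreal (1 / b) * (ennreal b * emeasure lebesgue (cube_set P)) \<le> ennreal (1 / b) * (\<integral>\<^sup>+y\<in>cube_set P. indicator E y \<partial>lebesgue)"
      by (intro mult_left_mono) auto
    moreover have "ennreal (1 / b) * (ennreal b * emeasure lebesgue (cube_set P)) = emeasure lebesgue (cube_set P)"
      using b by (simp add: mult.assoc[symmetric] ennreal_mult[symmetric])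
    ultimately show "(\<integral>\<^sup>+x\<in>UNIV \<inter> cube_set P. 1 \<partial>lebesgue) \<le> ennreal (1 / b) * (\<integral>\<^sup>+x\<in>cube_set P. indicator E x \<partial>lebesgue)"
      by simp
  qed auto
  also have "\<dots> \<le> ennreal (1 / b) * emeasure lebesgue E"
    by (subst int) (auto intro!: mult_left_mono emeasure_mono)
  also have "\<dots> \<le> ennreal (1 / b) * (ennreal (b ^ Suc k) * emeasure lebesgue (cube_set Q))"
    using Suc.prems(3) by (intro mult_left_mono) (auto simp: b_def)
  also have "\<dots> = ennreal (b ^ k) * emeasure lebesgue (cube_set Q)"
    using b by (simp add: mult.assoc[symmetric] ennreal_mult[symmetric])
  finally have "wmeas w E1 \<le> ennreal (\<eta> ^ k) * wmeas w (cube_set Q)"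
    using E1 E1Q by (intro Suc.IH) (auto simp: b_def)
  then have "wmeas w E \<le> ennreal \<eta> * (ennreal (\<eta> ^ k) * wmeas w (cube_set Q))"
    by (intro order_trans[OF 1] mult_left_mono) auto
  also have "\<dots> = ennreal (\<eta> ^ Suc k) * wmeas w (cube_set Q)"
    using \<eta> by (simp add: mult.assoc[symmetric] ennreal_mult[symmetric])
  finally show ?case .
qed

lemma half_sets_imp_small_sets_cond:
  fixes w :: "(real^('n::finite)) \<Rightarrow> real"
  assumes w: "weight w" and c: "c > 0" "half_sets_cond w c"
  shows "small_sets_cond w"
  unfolding small_sets_cond_def
proof (intro conjI w allI impI)
  fix e :: real assume e: "e > 0"
  obtain \<eta> where \<eta>: "0 < \<eta>" "\<eta> < 1" and half: "\<And>Q E. Q \<in> cubes \<Longrightarrow> E \<in> sets lebesgue \<Longrightarrow> E \<subseteq> cube_set Q \<Longrightarrow>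
    emeasure lebesgue E \<le> ennreal (1/2) * emeasure lebesgue (cube_set Q) \<Longrightarrow>
     wmeas w E \<le> ennreal \<eta> * wmeas w (cube_set Q)"
    using half_sets_small[OF w c] by blast
  obtain k where k: "\<eta> ^ k < e" using \<eta> e real_arch_pow_inv by blast
  let ?d = "(1 / 2 ^ (CARD('n) + 1)) ^ k :: real"
  have "wmeas w E \<le> ennreal e * wmeas w (cube_set Q)"
    if "Q \<in> cubes" "E \<in> sets lebesgue" "E \<subseteq> cube_set Q" "emeasure lebesgue E \<le> ennreal ?d * emeasure lebesgue (cube_set Q)" for Q E
  proof -
    have "wmeas w E \<le> ennreal (\<eta> ^ k) * wmeas w (cube_set Q)"
      by (rule small_sets_iterate[OF w \<eta>(1) that(1) half that(2,3,4)])
    also have "\<dots> \<le> ennreal e * wmeas w (cube_set Q)" using k by (intro mult_right_mono ennreal_leI) auto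
    finally show ?thesis .
  qed
  moreover have "?d > 0" by simp
  ultimately show "\<exists>d>0. \<forall>Q\<in>cubes. \<forall>E\<in>sets lebesgue. E \<subseteq> cube_set Q \<longrightarrow>
     emeasure lebesgue E \<le> ennreal d * emeasure lebesgue (cube_set Q) \<longrightarrow>
     wmeas w E \<le> ennreal e * wmeas w (cube_set Q)" by blast
qed

lemma Ainf_imp_small_sets_cond:
  assumes "Ainf w"
  shows "small_sets_cond w"
  using assms unfolding Ainf_def
proof
  assume "A1 w"
  then show ?thesis
    using A1_half_sets[of w] half_sets_imp_small_sets_cond[of w] by (metis A1_def)
next
  assume "\<exists>p>1. Ap p w"
  then obtain p where "p > 1" "Ap p w" by blast
  then show ?thesis
    using Ap_half_sets[of p w] half_sets_imp_small_sets_cond[of w] by (metis Ap_def)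
qed

text \<open>For \<open>l\<close> slightly above 1 the shell between Q and lQ is so small a part of
  lQ that it carries at most half of its weight, so \<open>w\<close> at most doubles from Q to lQ.
  Finitely many such dilations reach the factor 4.\<close>

lemma doubling_weight:
  fixes w :: "(real^('n::finite)) \<Rightarrow> real"
  assumes P: "small_sets_cond w"
  obtains D where "D \<ge> 1" "\<And>Q. Q \<in> cubes \<Longrightarrow> wmeas w (cube_set (dil 4 Q)) \<le> ennreal D * wmeas w (cube_set Q)"
proof -
  have w: "weight w" using P by (simp add: small_sets_cond_def)
  obtain d where d: "d > 0" "\<And>Q E. Q \<in> cubes \<Longrightarrow> E \<in> sets lebesgue \<Longrightarrow> E \<subseteq> cube_set Q \<Longrightarrow>
     emeasure lebesgue E \<le> ennreal d * emeasure lebesgue (cube_set Q) \<Longrightarrow>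
     wmeas w E \<le> ennreal (1/2) * wmeas w (cube_set Q)"
    using P unfolding small_sets_cond_def by (metis half_gt_zero zero_less_one)
  define n where "n = CARD('n)"
  have n: "real n \<ge> 1" by (simp add: n_def Suc_leI)
  define e where "e = min d (1/2)"
  have e: "e > 0" "e \<le> d" "e \<le> 1/2" using d by (auto simp: e_def)
  \<comment> \<open>By Bernoulli's inequality the volume ratio l^-n is then at least
    \<open>1 - e\<close>, so the shell has relative volume at most \<open>e \<le> d\<close>.\<close>
  define l where "l = 1 / (1 - e / n)"
  have en: "0 < e / n" "e / n < 1" using e n by (auto simp: divide_less_eq)
  have l: "l > 1" using en by (simp add: l_def)
  have ln: "1 - 1 / l ^ n \<le> d"
  proof -
    have "1 + real n * (- (e / n)) \<le> (1 + (- (e / n))) ^ n"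
      using en by (intro Bernoulli_inequality) auto
    then have "1 - e \<le> 1 / l ^ n" using n by (simp add: l_def power_one_over)
    then show ?thesis using e by simp
  qed
  have step: "wmeas w (cube_set (dil l Q)) \<le> 2 * wmeas w (cube_set Q)" if Q: "Q \<in> cubes" for Q :: "'n cube"
  proof -
    have lQ: "dil l Q \<in> cubes" using Q l by simp
    have sub: "cube_set Q \<subseteq> cube_set (dil l Q)"
      using l Q by (intro subcube_imp_subset subcube_dil_self) auto
    let ?E = "cube_set (dil l Q) - cube_set Q"
    have sQ: "snd Q > 0" using Q by (simp add: cubes_def)
    have "emeasure lebesgue ?E = emeasure lebesgue (cube_set (dil l Q)) - emeasure lebesgue (cube_set Q)"
      using sub emeasure_cube_finite[OF Q] by (intro emeasure_Diff) auto
    also have "\<dots> = ennreal ((l * snd Q) ^ n - snd Q ^ n)"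
      using Q lQ sQ by (simp add: emeasure_cube_set n_def ennreal_minus)
    also have "(l * snd Q) ^ n - snd Q ^ n = (1 - 1 / l ^ n) * (l * snd Q) ^ n"
      using l by (simp add: power_mult_distrib field_simps)
    also have "ennreal \<dots> \<le> ennreal (d * (l * snd Q) ^ n)"
      using ln l sQ by (intro ennreal_leI mult_right_mono) auto
    also have "\<dots> = ennreal d * emeasure lebesgue (cube_set (dil l Q))"
      using lQ d l sQ by (simp add: emeasure_cube_set n_def ennreal_mult)
    finally have "wmeas w ?E \<le> ennreal (1/2) * wmeas w (cube_set (dil l Q))"
      using d(2)[OF lQ, of ?E] by auto
    moreover have "wmeas w (cube_set (dil l Q)) = wmeas w (cube_set Q) + wmeas w ?E"
    proof -
      have "cube_set Q \<union> ?E = cube_set (dil l Q)" using sub by auto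
      then show ?thesis using wmeas_Un[OF w, of "cube_set Q" ?E] by auto
    qed
    moreover obtain W where W: "W \<ge> 0" "wmeas w (cube_set (dil l Q)) = ennreal W"
      using wmeas_cube_finite[OF w lQ] by (cases "wmeas w (cube_set (dil l Q))") auto
    moreover obtain a where a: "a \<ge> 0" "wmeas w (cube_set Q) = ennreal a"
      using wmeas_cube_finite[OF w Q] by (cases "wmeas w (cube_set Q)") auto
    ultimately have "ennreal W \<le> ennreal a + ennreal (1/2) * ennreal W"
      by (metis add_left_mono)
    also have "\<dots> = ennreal (a + W / 2)"
      using a W by (subst ennreal_half_mult) (simp_all del: ennreal_plus add: ennreal_plus[symmetric])
    finally have "W \<le> a + W / 2" using a W by (subst (asm) ennreal_le_iff) auto
    then have "W \<le> 2 * a" by simp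
    then show ?thesis using a W by (simp add: ennreal_mult[symmetric] ennreal_leI flip: ennreal_numeral)
  qed
  have iter: "wmeas w (cube_set (dil (l ^ k) Q)) \<le> ennreal (2 ^ k) * wmeas w (cube_set Q)" if Q: "Q \<in> cubes" for Q :: "'n cube" and k
  proof (induction k)
    case (Suc k)
    have "wmeas w (cube_set (dil (l ^ Suc k) Q)) = wmeas w (cube_set (dil l (dil (l ^ k) Q)))"
      by (simp add: dil_dil)
    also have "\<dots> \<le> 2 * wmeas w (cube_set (dil (l ^ k) Q))" using Q l by (intro step) auto
    also have "\<dots> \<le> 2 * (ennreal (2 ^ k) * wmeas w (cube_set Q))" by (intro mult_left_mono Suc) auto
    also have "\<dots> = ennreal (2 ^ Suc k) * wmeas w (cube_set Q)"
      by (simp add: mult.assoc[symmetric] ennreal_mult)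
    finally show ?case .
  qed simp
  obtain k where k: "4 < l ^ k" using real_arch_pow[OF l] by blast
  show ?thesis
  proof (rule that[of "2 ^ k"])
    fix Q :: "'n cube" assume Q: "Q \<in> cubes"
    have "cube_set (dil 4 Q) \<subseteq> cube_set (dil (l ^ k) Q)"
      using k Q by (intro subcube_imp_subset subcube_dil_dil) auto
    then show "wmeas w (cube_set (dil 4 Q)) \<le> ennreal (2 ^ k) * wmeas w (cube_set Q)"
      using iter[OF Q, of k] wmeas_mono order_trans by blast
  qed simp
qed

subsection \<open>Maximal level sets\<close>

text \<open>The average is taken over the doubled cube because the operator estimates at the scale
  of a cube hold on its double.\<close>

definition high :: "real \<Rightarrow> (real^('n::finite) \<Rightarrow> 'b::real_normed_vector) \<Rightarrow> real \<Rightarrow> 'n cube \<Rightarrow> bool" where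
  "high p F t P \<longleftrightarrow> ennreal t < avgLp p (cube_set (dil 2 P)) F"

text \<open>The level set of a maximal function restricted to the family \<open>\<P>\<close>. In the
  application \<open>\<P>\<close> consists of the dyadic subcubes of Q that lie in one maximal
  cube.\<close>

definition lvlset :: "real \<Rightarrow> (real^('n::finite) \<Rightarrow> 'b::real_normed_vector) \<Rightarrow> real \<Rightarrow> 'n cube set \<Rightarrow> (real^'n) set" where
  "lvlset p F t \<P> = (\<Union>P\<in>{P\<in>\<P>. high p F t P}. cube_set P)"

lemma lvlset_sets [simp, measurable]: "countable \<P> \<Longrightarrow> lvlset p F t \<P> \<in> sets lebesgue"
  unfolding lvlset_def by (intro sets_Union_cubes) auto

lemma lvlset_subset: "(\<And>P. P \<in> \<P> \<Longrightarrow> subcube P R) \<Longrightarrow> lvlset p F t \<P> \<subseteq> cube_set R"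
  unfolding lvlset_def using subcube_imp_subset by blast

lemma dyads_subset_maxdy:
  assumes Q: "Q \<in> cubes" and P: "P \<in> dyads \<phi> Q"
  obtains R where "R \<in> maxdy \<phi> Q" "subcube P R"
proof -
  obtain x j where x: "x \<in> cube_set Q" "P = dy Q j x" "\<phi> P" using P by (auto simp: dyads_def)
  define k where "k = (LEAST i. \<phi> (dy Q i x))"
  have k: "\<phi> (dy Q k x)" "k \<le> j"
    unfolding k_def using x by (auto intro: LeastI Least_le)
  have "dy Q k x \<in> maxdy \<phi> Q"
    unfolding maxdy_def using x(1) k(1) not_less_Least[of _ "\<lambda>i. \<phi> (dy Q i x)"] unfolding k_def[symmetric] by blast
  moreover have "subcube P (dy Q k x)" unfolding x(2) by (rule subcube_dy[OF Q k(2)])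
  ultimately show ?thesis by (rule that)
qed

text \<open>The constant of \<open>weak_type_cubes\<close> times the volume ratio of 2R to
  R.\<close>

definition vitali_const :: "nat \<Rightarrow> real" where
  "vitali_const n = (11 * real n) ^ n * 2 ^ n"

lemma vitali_const_pos: "n > 0 \<Longrightarrow> vitali_const n > 0"
  by (simp add: vitali_const_def)

text \<open>Weak type (1,1) for \<open>norm (S x) powr p\<close> at the height
  \<open>u powr p\<close>; the doubles of all subcubes of R stay inside 2R.\<close>

lemma lvlset_weak:
  fixes S :: "real^('n::finite) \<Rightarrow> 'b::{real_normed_vector, second_countable_topology}"
  assumes R: "R \<in> cubes" and \<P>: "\<P> \<subseteq> cubes" "countable \<P>" "\<And>P. P \<in> \<P> \<Longrightarrow> subcube P R"
    and p: "p \<ge> 1" and u: "u > 0" and sg: "\<sigma> \<ge> 0" and [measurable]: "S \<in> borel_measurable lebesgue"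
    and le: "avgLp p (cube_set (dil 2 R)) S \<le> ennreal \<sigma>"
  shows "emeasure lebesgue (lvlset p S u \<P>) \<le> ennreal (vitali_const CARD('n) * (\<sigma> / u) powr p) * emeasure lebesgue (cube_set R)"
proof -
  let ?\<P> = "{P\<in>\<P>. high p S u P}"
  let ?g = "\<lambda>x. ennreal (norm (S x) powr p)"
  have "ennreal (u powr p) * emeasure lebesgue (\<Union>P\<in>?\<P>. cube_set P) 
    \<le> ennreal ((11 * real CARD('n)) ^ CARD('n)) * (\<integral>\<^sup>+x\<in>cube_set (dil 2 R). ?g x \<partial>lebesgue)"
  proof (rule weak_type_cubes[where L = "snd R"])
    fix P assume "P \<in> ?\<P>"
    then have P: "P \<in> cubes" "subcube P R" "high p S u P" using \<P> by auto
    show "cube_set (dil 2 P) \<subseteq> cube_set (dil 2 R)"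
      using P by (intro subcube_imp_subset subcube_dil) auto
    show "snd P \<le> snd R" using P by (intro subcube_snd_le)
    have "\<not> avgLp p (cube_set (dil 2 P)) S \<le> ennreal u" using P(3) by (simp add: high_def)
    then show "ennreal (u powr p) * emeasure lebesgue (cube_set (dil 2 P)) \<le> (\<integral>\<^sup>+x\<in>cube_set (dil 2 P). ?g x \<partial>lebesgue)"
      using p u P(1) by (subst (asm) avgLp_le_iff) auto
  qed (use \<P> in auto)
  also have "(\<integral>\<^sup>+x\<in>cube_set (dil 2 R). ?g x \<partial>lebesgue) \<le> ennreal (\<sigma> powr p) * emeasure lebesgue (cube_set (dil 2 R))"
    using le p sg R by (subst (asm) avgLp_le_iff) auto
  also have "emeasure lebesgue (cube_set (dil 2 R)) = ennreal (2 ^ CARD('n)) * emeasure lebesgue (cube_set R)"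
    using R by (simp add: emeasure_cube_set power_mult_distrib ennreal_mult cubes_def)
  finally have 1: "ennreal (u powr p) * emeasure lebesgue (lvlset p S u \<P>)
    \<le> ennreal ((11 * real CARD('n)) ^ CARD('n)) * (ennreal (\<sigma> powr p) * (ennreal (2 ^ CARD('n)) * emeasure lebesgue (cube_set R)))"
    by (simp add: lvlset_def mult_left_mono)
  have "emeasure lebesgue (lvlset p S u \<P>) = ennreal (u powr (- p)) * (ennreal (u powr p) * emeasure lebesgue (lvlset p S u \<P>))"
    using u by (simp add: mult.assoc[symmetric] ennreal_mult[symmetric] powr_add[symmetric])
  also have "\<dots> \<le> ennreal (u powr (- p)) * (ennreal ((11 * real CARD('n)) ^ CARD('n)) * (ennreal (\<sigma> powr p) * (ennreal (2 ^ CARD('n)) * emeasure lebesgue (cube_set R))))"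
    using 1 by (rule mult_left_mono) simp
  also have "\<dots> = ennreal (u powr (- p) * ((11 * real CARD('n)) ^ CARD('n) * (\<sigma> powr p * 2 ^ CARD('n)))) * emeasure lebesgue (cube_set R)"
    by (simp add: ennreal_mult mult.assoc)
  also have "u powr (- p) * ((11 * real CARD('n)) ^ CARD('n) * (\<sigma> powr p * 2 ^ CARD('n))) = vitali_const CARD('n) * (\<sigma> / u) powr p"
    using u sg by (simp add: vitali_const_def powr_divide powr_minus field_simps)
  finally show ?thesis .
qed

text \<open>A geometric sum is at most a fixed multiple of its last term, and the last term that
  occurs is below \<open>z powr e\<close>.\<close>

lemma geometric_truncated:
  fixes z e :: real
  assumes e: "e > 0" and z: "z \<ge> 0"
  shows "(\<Sum>l\<in>{1..J}. if 2 ^ l < z then (2 ^ l) powr e else 0) \<le> 2 powr e / (2 powr e - 1) * z powr e"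
proof (induction J)
  case 0
  have "2 powr e > 1" using e by simp
  then show ?case by simp
next
  case (Suc J)
  let ?b = "2 powr e :: real"
  have b: "?b > 1" using e by simp
  show ?case
  proof (cases "2 ^ Suc J < z")
    case True
    have "(\<Sum>l\<in>{1..Suc J}. if 2 ^ l < z then (2 ^ l) powr e else 0) = (\<Sum>l\<in>{1..Suc J}. ?b ^ l)"
    proof (rule sum.cong)
      fix l assume l: "l \<in> {1..Suc J}"
      have "(2::real) ^ l \<le> 2 ^ Suc J" using l by (intro power_increasing) auto
      then have "2 ^ l < z" using True by linarith
      moreover have "((2::real) ^ l) powr e = ?b ^ l"
        by (simp add: powr_powr powr_realpow[symmetric] mult.commute)
      ultimately show "(if 2 ^ l < z then (2 ^ l) powr e else 0) = ?b ^ l" by simp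
    qed simp
    also have "\<dots> \<le> (\<Sum>l<Suc (Suc J). ?b ^ l)"
      using b by (intro sum_mono2) auto
    also have "\<dots> = (?b ^ Suc (Suc J) - 1) / (?b - 1)"
      using b by (intro geometric_sum) auto
    also have "\<dots> \<le> ?b ^ Suc (Suc J) / (?b - 1)"
      using b by (intro divide_right_mono) auto
    also have "\<dots> = ?b / (?b - 1) * ?b ^ Suc J" by simp
    also have "?b ^ Suc J = (2 ^ Suc J) powr e"
      by (simp add: powr_powr powr_realpow[symmetric] mult.commute del: power_Suc)
    also have "?b / (?b - 1) * (2 ^ Suc J) powr e \<le> ?b / (?b - 1) * z powr e"
    proof (rule mult_left_mono)
      show "(2 ^ Suc J) powr e \<le> z powr e" using True e by (intro powr_mono2) auto
      show "0 \<le> ?b / (?b - 1)" by (rule divide_nonneg_nonneg) (use b in linarith)+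
    qed
    finally show ?thesis .
  qed (use Suc in simp)
qed

lemma ennreal_half_absorb:
  assumes "ennreal a \<le> ennreal b + x" "0 \<le> b" "b \<le> a / 2"
  shows "ennreal (a / 2) \<le> x"
proof (cases x)
  case (real r)
  then have "ennreal a \<le> ennreal (b + r)" using assms by simp
  then have "a \<le> b + r" using real assms by (subst (asm) ennreal_le_iff) auto
  then show ?thesis using assms real by (auto intro!: ennreal_leI)
qed simp

text \<open>The strong type (r,r) inequality of the maximal function in discrete layer-cake form,
  derived as in Marcinkiewicz interpolation: at each height the weak type bound is applied to the
  part of \<open>G\<close> above half that height. The constant is uniform in
  \<open>J\<close>.\<close>

lemma lvlset_sum:
  fixes G :: "real^('n::finite) \<Rightarrow> 'b::{real_normed_vector, second_countable_topology}"
  assumes p: "p \<ge> 1" "p < r"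
  obtains C where "C > 0" "\<And>R G T \<P> J. R \<in> cubes \<Longrightarrow> \<P> \<subseteq> cubes \<Longrightarrow> countable \<P> \<Longrightarrow> (\<And>P. P \<in> \<P> \<Longrightarrow> subcube P R) \<Longrightarrow>
    T > 0 \<Longrightarrow> (G :: real^'n \<Rightarrow> 'b) \<in> borel_measurable lebesgue \<Longrightarrow> avgLp r (cube_set (dil 2 R)) G \<le> ennreal T \<Longrightarrow>
    (\<Sum>l\<in>{1..J}. ennreal ((2 ^ l) powr r) * emeasure lebesgue (lvlset p G (2 ^ l * T) \<P>)) \<le> ennreal C * emeasure lebesgue (cube_set R)"
proof -
  define K where "K = (11 * real CARD('n)) ^ CARD('n)"
  have K: "K > 0" by (simp add: K_def)
  define e where "e = r - p"
  have e: "e > 0" using p by (simp add: e_def)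
  define b where "b = 2 powr e / (2 powr e - 1)"
  have b: "b > 0" using e by (simp add: b_def)
  define C where "C = 2 * K * (b * 2 powr e) * 2 ^ CARD('n)"
  have C: "C > 0" using K b by (simp add: C_def)
  show ?thesis
  proof (rule that[OF C])
    fix R :: "'n cube" and G :: "real^'n \<Rightarrow> 'b" and T :: real and \<P> and J :: nat
    assume R: "R \<in> cubes" and \<P>: "\<P> \<subseteq> cubes" "countable \<P>" "\<And>P. P \<in> \<P> \<Longrightarrow> subcube P R"
      and T: "T > 0" and G [measurable]: "G \<in> borel_measurable lebesgue" and le: "avgLp r (cube_set (dil 2 R)) G \<le> ennreal T"
    let ?V = "cube_set (dil 2 R)"
    \<comment> \<open>Values of \<open>G\<close> below half the height contribute at most
      \<open>(t / 2) powr p \<le> t powr p / 2\<close> to an average above \<open>t powr p\<close>,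
      so the truncated part \<open>g l\<close> still carries half of it.\<close>
    define g where "g l x = (if norm (G x) > 2 ^ l * T / 2 then norm (G x) powr p else 0)" for l :: nat and x
    have [measurable]: "g l \<in> borel_measurable lebesgue" for l unfolding g_def by measurable
    have g0: "g l x \<ge> 0" for l x by (simp add: g_def)
    have weak: "ennreal ((2 ^ l * T) powr p / 2) * emeasure lebesgue (lvlset p G (2 ^ l * T) \<P>) \<le> ennreal K * (\<integral>\<^sup>+x\<in>?V. ennreal (g l x) \<partial>lebesgue)" for l :: nat
    proof -
      define t where "t = 2 ^ l * T"
      have t: "t > 0" using T by (simp add: t_def)
      let ?\<P> = "{P\<in>\<P>. high p G t P}"
      have "ennreal (t powr p / 2) * emeasure lebesgue (\<Union>P\<in>?\<P>. cube_set P) 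
        \<le> ennreal ((11 * real CARD('n)) ^ CARD('n)) * (\<integral>\<^sup>+x\<in>?V. ennreal (g l x) \<partial>lebesgue)"
      proof (rule weak_type_cubes[where L = "snd R"])
        fix P assume "P \<in> ?\<P>"
        then have P: "P \<in> cubes" "subcube P R" "high p G t P" using \<P> by auto
        let ?W = "cube_set (dil 2 P)"
        show "?W \<subseteq> ?V"
          using P by (intro subcube_imp_subset subcube_dil) auto
        show "snd P \<le> snd R" using P by (intro subcube_snd_le)
        define m where "m = snd (dil 2 P) ^ CARD('n)"
        have m: "m > 0" "emeasure lebesgue ?W = ennreal m"
          using P(1) by (simp add: m_def cubes_def, simp add: m_def emeasure_cube_set)
        have "\<not> avgLp p ?W G \<le> ennreal t" using P(3) by (simp add: high_def)
        then have "ennreal (t powr p * m) \<le> (\<integral>\<^sup>+x\<in>?W. ennreal (norm (G x) powr p) \<partial>lebesgue)"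
          using p t P(1) m by (subst (asm) avgLp_le_iff) (auto simp: ennreal_mult)
        also have "\<dots> \<le> (\<integral>\<^sup>+x. ennreal ((t / 2) powr p) * indicator ?W x + ennreal (g l x) * indicator ?W x \<partial>lebesgue)"
        proof (rule nn_integral_mono)
          fix x
          have "norm (G x) powr p \<le> (t / 2) powr p + g l x"
          proof (cases "norm (G x) > t / 2")
            case False
            then have "norm (G x) powr p \<le> (t / 2) powr p" using p by (intro powr_mono2) auto
            then show ?thesis using g0[of l x] by linarith
          qed (simp add: g_def t_def)
          then show "ennreal (norm (G x) powr p) * indicator ?W x \<le> ennreal ((t / 2) powr p) * indicator ?W x + ennreal (g l x) * indicator ?W x"
            using g0[of l x] by (auto simp: indicator_def ennreal_plus[symmetric] intro!: ennreal_leI simp del: ennreal_plus)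
        qed
        also have "\<dots> = ennreal ((t / 2) powr p * m) + (\<integral>\<^sup>+x\<in>?W. ennreal (g l x) \<partial>lebesgue)"
          using m by (simp add: nn_integral_add nn_integral_cmult_indicator ennreal_mult)
        finally have "ennreal (t powr p * m / 2) \<le> (\<integral>\<^sup>+x\<in>?W. ennreal (g l x) \<partial>lebesgue)"
        proof (rule ennreal_half_absorb)
          have "2 powr p \<ge> (2::real)" using p powr_mono[of 1 p "2::real"] by simp
          then have "t powr p / 2 powr p \<le> t powr p / 2"
            by (intro divide_left_mono) auto
          then have "(t / 2) powr p \<le> t powr p / 2" using t by (simp add: powr_divide)
          then have "(t / 2) powr p * m \<le> t powr p / 2 * m" using m by (intro mult_right_mono) auto
          then show "(t / 2) powr p * m \<le> t powr p * m / 2" by simp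
        qed (use m in simp)
        moreover have "ennreal (t powr p * m / 2) = ennreal (t powr p / 2) * ennreal m"
          using m by (subst ennreal_mult[symmetric]) auto
        ultimately show "ennreal (t powr p / 2) * emeasure lebesgue ?W \<le> (\<integral>\<^sup>+x\<in>?W. ennreal (g l x) \<partial>lebesgue)"
          using m by simp
      qed (use \<P> in auto)
      then show ?thesis by (simp add: lvlset_def K_def t_def)
    qed
    define A where "A = 2 * K * T powr (- p)"
    have A: "A > 0" using K T by (simp add: A_def)
    have term_le: "ennreal ((2 ^ l) powr r) * emeasure lebesgue (lvlset p G (2 ^ l * T) \<P>) \<le> ennreal A * (\<integral>\<^sup>+x. ennreal ((2 ^ l) powr e * g l x) * indicator ?V x \<partial>lebesgue)" for l :: nat
    proof -
      let ?U = "emeasure lebesgue (lvlset p G (2 ^ l * T) \<P>)"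
      let ?c = "(2 ^ l) powr e * 2 * T powr (- p) :: real"
      have "?c * ((2 ^ l * T) powr p / 2) = ((2 ^ l) powr e * (2 ^ l) powr p) * (T powr (- p) * T powr p)"
        using T by (simp add: powr_mult)
      also have "\<dots> = (2 ^ l) powr r"
        using T by (simp add: powr_add[symmetric] e_def)
      finally have c: "?c * ((2 ^ l * T) powr p / 2) = (2 ^ l) powr r" .
      have "ennreal ((2 ^ l) powr r) * ?U = ennreal ?c * (ennreal ((2 ^ l * T) powr p / 2) * ?U)"
        unfolding c[symmetric] by (simp only: ennreal_mult mult.assoc powr_ge_zero mult_nonneg_nonneg zero_le_numeral divide_nonneg_nonneg)
      also have "\<dots> \<le> ennreal ?c * (ennreal K * (\<integral>\<^sup>+x\<in>?V. ennreal (g l x) \<partial>lebesgue))"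
        by (intro mult_left_mono weak) auto
      also have "\<dots> = ennreal (?c * K) * (\<integral>\<^sup>+x\<in>?V. ennreal (g l x) \<partial>lebesgue)"
        using K by (simp add: ennreal_mult mult.assoc)
      also have "?c * K = A * (2 ^ l) powr e" by (simp add: A_def)
      also have "ennreal (A * (2 ^ l) powr e) * (\<integral>\<^sup>+x\<in>?V. ennreal (g l x) \<partial>lebesgue) = ennreal A * (\<integral>\<^sup>+x. ennreal ((2 ^ l) powr e) * (ennreal (g l x) * indicator ?V x) \<partial>lebesgue)"
        using A by (simp add: ennreal_mult mult.assoc nn_integral_cmult)
      also have "\<dots> = ennreal A * (\<integral>\<^sup>+x. ennreal ((2 ^ l) powr e * g l x) * indicator ?V x \<partial>lebesgue)"
        using g0 by (simp add: ennreal_mult mult.assoc)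
      finally show ?thesis .
    qed
    have "(\<Sum>l\<in>{1..J}. ennreal ((2 ^ l) powr r) * emeasure lebesgue (lvlset p G (2 ^ l * T) \<P>))
       \<le> (\<Sum>l\<in>{1..J}. ennreal A * (\<integral>\<^sup>+x. ennreal ((2 ^ l) powr e * g l x) * indicator ?V x \<partial>lebesgue))"
      by (intro sum_mono term_le)
    also have "\<dots> = ennreal A * (\<integral>\<^sup>+x. (\<Sum>l\<in>{1..J}. ennreal ((2 ^ l) powr e * g l x) * indicator ?V x) \<partial>lebesgue)"
      by (subst nn_integral_sum) (auto simp: sum_distrib_left)
    also have "\<dots> \<le> ennreal A * (\<integral>\<^sup>+x. ennreal (b * 2 powr e * T powr (- e)) * (ennreal (norm (G x) powr r) * indicator ?V x) \<partial>lebesgue)"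
    proof (intro mult_left_mono nn_integral_mono)
      fix x
      \<comment> \<open>At a fixed point only the heights below twice \<open>norm (G x)\<close>
        contribute, so the sum over \<open>l\<close> is a truncated geometric series.\<close>
      have "(\<Sum>l\<in>{1..J}. (2 ^ l) powr e * g l x) = norm (G x) powr p * (\<Sum>l\<in>{1..J}. if 2 ^ l < 2 * norm (G x) / T then (2 ^ l) powr e else 0)"
        unfolding sum_distrib_left using T by (intro sum.cong) (auto simp: g_def field_simps)
      also have "\<dots> \<le> norm (G x) powr p * (b * (2 * norm (G x) / T) powr e)"
        unfolding b_def using e T by (intro mult_left_mono geometric_truncated) auto
      also have "\<dots> = b * 2 powr e * T powr (- e) * (norm (G x) powr p * norm (G x) powr e)"
        using T by (simp add: powr_mult powr_divide powr_minus field_simps)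
      also have "norm (G x) powr p * norm (G x) powr e = norm (G x) powr r"
        by (simp add: powr_add[symmetric] e_def)
      finally have *: "(\<Sum>l\<in>{1..J}. (2 ^ l) powr e * g l x) \<le> b * 2 powr e * T powr (- e) * norm (G x) powr r" .
      have "(\<Sum>l\<in>{1..J}. ennreal ((2 ^ l) powr e * g l x) * indicator ?V x) = ennreal (\<Sum>l\<in>{1..J}. (2 ^ l) powr e * g l x) * indicator ?V x"
        by (simp add: g0 flip: sum_distrib_right)
      also have "\<dots> \<le> ennreal (b * 2 powr e * T powr (- e) * norm (G x) powr r) * indicator ?V x"
        using * by (intro mult_right_mono ennreal_leI) auto
      also have "\<dots> = ennreal (b * 2 powr e * T powr (- e)) * (ennreal (norm (G x) powr r) * indicator ?V x)"
        using b by (simp add: ennreal_mult mult.assoc)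
      finally show "(\<Sum>l\<in>{1..J}. ennreal ((2 ^ l) powr e * g l x) * indicator ?V x) \<le> ennreal (b * 2 powr e * T powr (- e)) * (ennreal (norm (G x) powr r) * indicator ?V x)" .
    qed simp
    also have "\<dots> = ennreal A * (ennreal (b * 2 powr e * T powr (- e)) * (\<integral>\<^sup>+x\<in>?V. ennreal (norm (G x) powr r) \<partial>lebesgue))"
      by (subst nn_integral_cmult) auto
    also have "\<dots> \<le> ennreal A * (ennreal (b * 2 powr e * T powr (- e)) * (ennreal (T powr r) * emeasure lebesgue ?V))"
      using le p T R by (intro mult_left_mono) (auto simp: avgLp_le_iff)
    also have "\<dots> = ennreal C * emeasure lebesgue (cube_set R)"
    proof -
      have sR: "snd R > 0" using R by (simp add: cubes_def)
      have "T powr (- p) * (T powr (- e) * T powr r) = 1"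
        using T by (simp add: powr_add[symmetric] e_def)
      then have CC: "A * (b * 2 powr e * T powr (- e) * (T powr r * (2 ^ CARD('n) * snd R ^ CARD('n)))) = C * snd R ^ CARD('n)"
        unfolding A_def C_def by (simp add: algebra_simps)
      have V: "emeasure lebesgue ?V = ennreal (2 ^ CARD('n) * snd R ^ CARD('n))"
        using R by (simp add: emeasure_cube_set power_mult_distrib)
      have W: "emeasure lebesgue (cube_set R) = ennreal (snd R ^ CARD('n))" using R by (simp add: emeasure_cube_set)
      show ?thesis unfolding V W
        using A b C sR CC by (simp only: ennreal_mult[symmetric] mult_nonneg_nonneg powr_ge_zero less_imp_le zero_le_power zero_le_numeral)
    qed
    finally show "(\<Sum>l\<in>{1..J}. ennreal ((2 ^ l) powr r) * emeasure lebesgue (lvlset p G (2 ^ l * T) \<P>)) \<le> ennreal C * emeasure lebesgue (cube_set R)" .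
  qed
qed

subsection \<open>The good-\<open>\<lambda>\<close> inequality\<close>

text \<open>The level sets of the dyadic maximal function of \<open>G\<close> at heights \<open>2 ^ l * T\<close> have small
  weight for most \<open>l\<close>. This averaged form follows from the exponent of the reverse-Hoelder class itself;
  a bound for each single \<open>l\<close> would need its self-improvement (Gehring).\<close>

definition level_decay_at :: "real \<Rightarrow> real \<Rightarrow> ennreal \<Rightarrow> (real^('n::finite) \<Rightarrow> real) \<Rightarrow> real \<Rightarrow> nat \<Rightarrow> bool" where
  "level_decay_at p q q0 w \<eta> J \<longleftrightarrow> (\<forall>R\<in>cubes. \<forall>(G :: real^'n \<Rightarrow> complex)\<in>borel_measurable lebesgue. \<forall>T>0. \<forall>\<P>.
     \<P> \<subseteq> cubes \<longrightarrow> countable \<P> \<longrightarrow> (\<forall>P\<in>\<P>. subcube P R) \<longrightarrow> avgq q0 (cube_set (dil 2 R)) G \<le> ennreal T \<longrightarrow>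
     (\<Sum>l\<in>{1..J}. ennreal ((2 ^ l) powr q) * wmeas w (lvlset p G (2 ^ l * T) \<P>)) \<le> ennreal (\<eta> * real J) * wmeas w (cube_set R))"

definition level_decay :: "real \<Rightarrow> real \<Rightarrow> ennreal \<Rightarrow> (real^('n::finite) \<Rightarrow> real) \<Rightarrow> bool" where
  "level_decay p q q0 w \<longleftrightarrow> (\<forall>\<eta>>0. \<exists>J\<ge>1. level_decay_at p q q0 w \<eta> J)"

text \<open>An essential bound \<open>T\<close> on 2R bounds all averages over the doubled subcubes
  by \<open>2 * T\<close>. The first level set is then empty, and \<open>J = 1\<close> serves every
  \<open>\<eta>\<close>.\<close>

lemma level_decay_infinity:
  fixes w :: "real^('n::finite) \<Rightarrow> real"
  assumes p: "p \<ge> 1"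
  shows "level_decay p q \<infinity> w"
  unfolding level_decay_def level_decay_at_def
proof (intro allI impI exI[of _ "1::nat"] conjI ballI)
  fix \<eta> T :: real and R :: "'n cube" and G :: "real^'n \<Rightarrow> complex" and \<P>
  assume R: "R \<in> cubes" and G: "G \<in> borel_measurable lebesgue" and T: "T > 0" and \<P>: "\<P> \<subseteq> cubes" "\<forall>P\<in>\<P>. subcube P R"
    and le: "avgq \<infinity> (cube_set (dil 2 R)) G \<le> ennreal T"
  have "\<not> high p G (2 ^ 1 * T) P" if "P \<in> \<P>" for P
  proof -
    have P: "P \<in> cubes" "subcube P R" using \<P> that by auto
    have "cube_set (dil 2 P) \<subseteq> cube_set (dil 2 R)"
      using P by (intro subcube_imp_subset subcube_dil) auto
    then have "avgq \<infinity> (cube_set (dil 2 P)) G \<le> ennreal T"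
      using le unfolding avgq_inf_le_iff by (auto elim!: eventually_mono)
    then have "avgLp p (cube_set (dil 2 P)) G \<le> ennreal (2 * T)"
      using T p P G by (intro avgLp_le_avgq[where q = \<infinity>]) auto
    then show ?thesis by (simp add: high_def not_less)
  qed
  then have "lvlset p G (2 ^ 1 * T) \<P> = {}" by (auto simp: lvlset_def)
  then show "(\<Sum>l\<in>{1..1}. ennreal ((2 ^ l) powr q) * wmeas w (lvlset p G (2 ^ l * T) \<P>)) \<le> ennreal (\<eta> * real 1) * wmeas w (cube_set R)"
    by (simp add: wmeas_def)
qed simp

text \<open>Let x_l be the relative measure of the l-th level set. The numbers 2^(lr) x_l have a sum
  bounded independently of \<open>J\<close>, and the l-th weighted term is at most a multiple of
  their power with exponent \<open>\<theta> < 1\<close>. By concavity the sum of J such powers is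
  o(J).\<close>

lemma level_decay_RH:
  fixes w :: "real^('n::finite) \<Rightarrow> real"
  assumes p: "p \<ge> 1" "p < q" "q < r" and RH: "RH (r / (r - q)) w"
  shows "level_decay p q (ennreal r) w"
  unfolding level_decay_def
proof (intro allI impI)
  fix \<eta> :: real assume eta: "\<eta> > 0"
  define \<theta> where "\<theta> = q / r"
  have th: "0 < \<theta>" "\<theta> < 1" using p by (auto simp: \<theta>_def)
  have s: "r / (r - q) > 1" using p by (simp add: less_divide_eq)
  \<comment> \<open>The reverse Hoelder exponent is conjugate to r/q, so the exponent for small sets
    is exactly q/r. This is what turns \<open>(2 ^ l) powr q\<close> into the power
    \<open>\<theta>\<close> of \<open>(2 ^ l) powr r\<close>.\<close>
  have "1 - 1 / (r / (r - q)) = \<theta>" using p by (simp add: \<theta>_def field_simps)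
  then obtain Cw where Cw: "Cw > 0" "\<And>Q E \<delta>. Q \<in> cubes \<Longrightarrow> E \<in> sets lebesgue \<Longrightarrow> E \<subseteq> cube_set Q \<Longrightarrow> \<delta> \<ge> 0 \<Longrightarrow>
    emeasure lebesgue E \<le> ennreal \<delta> * emeasure lebesgue (cube_set Q) \<Longrightarrow>
    wmeas w E \<le> ennreal (Cw * \<delta> powr \<theta>) * wmeas w (cube_set Q)"
    using RH_small_sets[OF RH s] by metis
  obtain C2 where C2: "C2 > 0" "\<And>R G T \<P> J. R \<in> cubes \<Longrightarrow> \<P> \<subseteq> cubes \<Longrightarrow> countable \<P> \<Longrightarrow> (\<And>P. P \<in> \<P> \<Longrightarrow> subcube P R) \<Longrightarrow>
    T > 0 \<Longrightarrow> (G :: real^'n \<Rightarrow> complex) \<in> borel_measurable lebesgue \<Longrightarrow> avgLp r (cube_set (dil 2 R)) G \<le> ennreal T \<Longrightarrow>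
    (\<Sum>l\<in>{1..J}. ennreal ((2 ^ l) powr r) * emeasure lebesgue (lvlset p G (2 ^ l * T) \<P>)) \<le> ennreal C2 * emeasure lebesgue (cube_set R)"
  proof (rule lvlset_sum)
    show "p \<ge> 1" "p < r" using p by auto
  qed blast
  \<comment> \<open>The height at which the powers are split: it makes the constant term of each
    summand \<open>\<eta> / 2\<close>. The remaining terms have a total bounded independently of
    \<open>J\<close>, which a large \<open>J\<close> outweighs.\<close>
  define \<tau> where "\<tau> = (\<eta> / (2 * Cw)) powr (1 / \<theta>)"
  have tau: "\<tau> > 0" "Cw * \<tau> powr \<theta> = \<eta> / 2" using eta Cw th by (auto simp: \<tau>_def powr_powr)
  obtain J :: nat where J: "2 * (Cw * \<tau> powr (\<theta> - 1) * C2) / \<eta> < real J" using reals_Archimedean2 by blast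
  have "0 < 2 * (Cw * \<tau> powr (\<theta> - 1) * C2) / \<eta>" using Cw C2 tau eta by simp
  then have J1: "J \<ge> 1" using J by (cases J) auto
  have J2: "Cw * \<tau> powr (\<theta> - 1) * C2 \<le> \<eta> / 2 * J" using J eta by (simp add: field_simps)
  have "(\<Sum>l\<in>{1..J}. ennreal ((2 ^ l) powr q) * wmeas w (lvlset p G (2 ^ l * T) \<P>)) \<le> ennreal (\<eta> * real J) * wmeas w (cube_set R)"
    if R: "R \<in> cubes" and G: "G \<in> borel_measurable lebesgue" and T: "T > 0" and \<P>: "\<P> \<subseteq> cubes" "countable \<P>" "\<forall>P\<in>\<P>. subcube P R"
    and le: "avgq (ennreal r) (cube_set (dil 2 R)) G \<le> ennreal T" for R T \<P> and G :: "real^'n \<Rightarrow> complex"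
  proof -
    define m where "m = snd R ^ CARD('n)"
    have m: "m > 0" "emeasure lebesgue (cube_set R) = ennreal m"
      using R by (simp add: m_def cubes_def, simp add: m_def emeasure_cube_set)
    let ?U = "\<lambda>l. lvlset p G (2 ^ l * T) \<P>"
    have sub: "?U l \<subseteq> cube_set R" for l using \<P> by (intro lvlset_subset) auto
    have "\<exists>x. x \<ge> 0 \<and> emeasure lebesgue (?U l) = ennreal x * emeasure lebesgue (cube_set R)" for l
    proof -
      have "emeasure lebesgue (?U l) \<le> ennreal m"
        using emeasure_mono[OF sub, of lebesgue] m by simp
      then obtain y where "y \<ge> 0" "emeasure lebesgue (?U l) = ennreal y"
        by (cases "emeasure lebesgue (?U l)") (auto simp: top_unique)
      then show ?thesis using m by (intro exI[of _ "y / m"]) (auto simp: ennreal_mult[symmetric])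
    qed
    then obtain x where x: "\<And>l. x l \<ge> 0" "\<And>l. emeasure lebesgue (?U l) = ennreal (x l) * emeasure lebesgue (cube_set R)" by metis
    have "(\<Sum>l\<in>{1..J}. ennreal ((2 ^ l) powr r) * emeasure lebesgue (?U l)) \<le> ennreal C2 * emeasure lebesgue (cube_set R)"
      using le p by (intro C2(2) R \<P> T G) (use \<P> in \<open>auto simp: avgq_def\<close>)
    moreover have "(\<Sum>l\<in>{1..J}. ennreal ((2 ^ l) powr r) * emeasure lebesgue (?U l)) = ennreal ((\<Sum>l\<in>{1..J}. (2 ^ l) powr r * x l) * m)"
      unfolding x(2) m(2) using x(1) m(1)
      by (simp add: ennreal_mult[symmetric] sum_distrib_right mult.assoc)
    ultimately have "(\<Sum>l\<in>{1..J}. (2 ^ l) powr r * x l) * m \<le> C2 * m"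
      using m C2 by (simp add: ennreal_mult[symmetric] ennreal_le_iff)
    then have sumx: "(\<Sum>l\<in>{1..J}. (2 ^ l) powr r * x l) \<le> C2" using m by simp
    have each: "ennreal ((2 ^ l) powr q) * wmeas w (?U l) \<le> ennreal (Cw * (\<tau> powr \<theta> + \<tau> powr (\<theta> - 1) * ((2 ^ l) powr r * x l))) * wmeas w (cube_set R)" for l
    proof -
      have "wmeas w (?U l) \<le> ennreal (Cw * x l powr \<theta>) * wmeas w (cube_set R)"
        using x sub \<P> by (intro Cw(2) R) auto
      then have "ennreal ((2 ^ l) powr q) * wmeas w (?U l) \<le> ennreal ((2 ^ l) powr q) * (ennreal (Cw * x l powr \<theta>) * wmeas w (cube_set R))"
        by (rule mult_left_mono) simp
      also have "\<dots> = ennreal ((2 ^ l) powr q * (Cw * x l powr \<theta>)) * wmeas w (cube_set R)"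
        using Cw by (simp add: ennreal_mult mult.assoc)
      also have "(2 ^ l) powr q * (Cw * x l powr \<theta>) = Cw * ((2 ^ l) powr r * x l) powr \<theta>"
      proof -
        have "r * \<theta> = q" using p by (simp add: \<theta>_def)
        then show ?thesis using x(1)[of l] by (simp add: powr_mult powr_powr)
      qed
      also have "ennreal \<dots> * wmeas w (cube_set R) \<le> ennreal (Cw * (\<tau> powr \<theta> + \<tau> powr (\<theta> - 1) * ((2 ^ l) powr r * x l))) * wmeas w (cube_set R)"
        using powr_le_split[of \<theta> 1 "(2 ^ l) powr r * x l" \<tau>] th tau x(1)[of l] Cw
        by (intro mult_right_mono ennreal_leI mult_left_mono) auto
      finally show ?thesis .
    qed
    have "(\<Sum>l\<in>{1..J}. ennreal ((2 ^ l) powr q) * wmeas w (?U l)) \<le> (\<Sum>l\<in>{1..J}. ennreal (Cw * (\<tau> powr \<theta> + \<tau> powr (\<theta> - 1) * ((2 ^ l) powr r * x l))) * wmeas w (cube_set R))"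
      by (intro sum_mono each)
    also have "\<dots> = ennreal (\<Sum>l\<in>{1..J}. Cw * (\<tau> powr \<theta> + \<tau> powr (\<theta> - 1) * ((2 ^ l) powr r * x l))) * wmeas w (cube_set R)"
      using Cw x(1) by (simp flip: sum_distrib_right)
    also have "(\<Sum>l\<in>{1..J}. Cw * (\<tau> powr \<theta> + \<tau> powr (\<theta> - 1) * ((2 ^ l) powr r * x l))) = 
       real J * (Cw * \<tau> powr \<theta>) + Cw * \<tau> powr (\<theta> - 1) * (\<Sum>l\<in>{1..J}. (2 ^ l) powr r * x l)"
      by (simp add: distrib_left sum.distrib sum_distrib_left mult.assoc)
    also have "ennreal \<dots> * wmeas w (cube_set R) \<le> ennreal (\<eta> * real J) * wmeas w (cube_set R)"
    proof (intro mult_right_mono ennreal_leI)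
      have "Cw * \<tau> powr (\<theta> - 1) * (\<Sum>l\<in>{1..J}. (2 ^ l) powr r * x l) \<le> Cw * \<tau> powr (\<theta> - 1) * C2"
        using sumx Cw by (intro mult_left_mono) auto
      then show "real J * (Cw * \<tau> powr \<theta>) + Cw * \<tau> powr (\<theta> - 1) * (\<Sum>l\<in>{1..J}. (2 ^ l) powr r * x l) \<le> \<eta> * real J"
        using J2 unfolding tau(2) mult.commute[of "real J"] by linarith
    qed simp
    finally show ?thesis .
  qed
  then have "level_decay_at p q (ennreal r) w \<eta> J" unfolding level_decay_at_def by blast
  then show "\<exists>J\<ge>1. level_decay_at p q (ennreal r) w \<eta> J" using J1 by blast
qed

section \<open>Stopping cubes and one step of the good-lambda argument\<close>

abbreviation stopping :: "real \<Rightarrow> (real^('n::finite) \<Rightarrow> complex) \<Rightarrow> real \<Rightarrow> 'n cube \<Rightarrow> 'n cube set" where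
  "stopping p F t Q \<equiv> maxdy (high p F t) Q"

abbreviation Om :: "real \<Rightarrow> (real^('n::finite) \<Rightarrow> complex) \<Rightarrow> real \<Rightarrow> 'n cube \<Rightarrow> (real^'n) set" where
  "Om p F t Q \<equiv> (\<Union>P\<in>dyads (high p F t) Q. cube_set P)"

text \<open>The two parts play different roles: \<open>S\<close> is small in the exponent
  \<open>p\<close>, while \<open>G\<close> is only bounded, but in the better exponent
  \<open>q0\<close>.\<close>

definition decomposable :: "real \<Rightarrow> ennreal \<Rightarrow> (real^('n::finite) \<Rightarrow> complex) \<Rightarrow> 'n cube \<Rightarrow> real \<Rightarrow> real \<Rightarrow> bool" where
  "decomposable p q0 F R s T \<longleftrightarrow> (\<exists>S G. S \<in> borel_measurable lebesgue \<and> G \<in> borel_measurable lebesgue \<and>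
     (\<forall>x. F x = S x + G x) \<and> avgLp p (cube_set (dil 2 R)) S \<le> ennreal s \<and> avgq q0 (cube_set (dil 2 R)) G \<le> ennreal T)"

lemma dyads_mono:
  assumes "\<And>P. \<phi> P \<Longrightarrow> \<psi> P"
  shows "dyads \<phi> Q \<subseteq> dyads \<psi> Q"
  unfolding dyads_def using assms by blast

lemma Om_antimono:
  assumes "t \<le> t'"
  shows "Om p F t' Q \<subseteq> Om p F t Q"
proof (rule UN_mono[OF dyads_mono order_refl])
  fix P assume "high p F t' P"
  then show "high p F t P"
    unfolding high_def using ennreal_leI[OF assms] by (rule le_less_trans[rotated])
qed

text \<open>A cube that is high at \<open>t'\<close> is high at \<open>t\<close>, hence lies in some
  maximal cube; by disjointness this is R as soon as they share a point. So only subcubes of R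
  matter on R.\<close>

lemma Om_inter_stopping:
  fixes F :: "real^('n::finite) \<Rightarrow> complex"
  assumes Q: "Q \<in> cubes" and p: "p \<ge> 1" and t: "t > 0" "t \<le> t'" and R: "R \<in> stopping p F t Q"
    and m: "S \<in> borel_measurable lebesgue" "G \<in> borel_measurable lebesgue" "\<And>x. F x = S x + G x"
  shows "Om p F t' Q \<inter> cube_set R \<subseteq>
     lvlset p S (t' / 8) {P\<in>dyads (\<lambda>_. True) Q. subcube P R} \<union> lvlset p G (t' / 8) {P\<in>dyads (\<lambda>_. True) Q. subcube P R}"
proof
  fix x assume x: "x \<in> Om p F t' Q \<inter> cube_set R"
  then obtain P where P: "P \<in> dyads (high p F t') Q" "x \<in> cube_set P" by auto
  have hP: "high p F t' P" "P \<in> cubes" using P dyads_cubes[OF Q] by blast+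
  then have "high p F t P" using t unfolding high_def by (meson ennreal_leI le_less_trans)
  then have "P \<in> dyads (high p F t) Q" using P unfolding dyads_def by blast
  then obtain R' where R': "R' \<in> stopping p F t Q" "subcube P R'" using dyads_subset_maxdy[OF Q] by blast
  have "x \<in> cube_set R'" using P(2) subcube_imp_subset[OF R'(2)] by blast
  then have "R' = R" using disjoint_maxdy[OF Q, of "high p F t"] R' R x unfolding disjoint_family_on_def by blast
  then have PR: "subcube P R" using R' by simp
  \<comment> \<open>The fraction 1/8 matches the factor 4 of \<open>avgLp_add\<close>: averages of
    both parts at most \<open>t' / 8\<close> would give \<open>4 * (t' / 8 + t' / 8) = t'\<close>
    for F.\<close>
  have "high p S (t' / 8) P \<or> high p G (t' / 8) P"
  proof (rule ccontr)
    assume "\<not> ?thesis"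
    then have "avgLp p (cube_set (dil 2 P)) S \<le> ennreal (t' / 8)" "avgLp p (cube_set (dil 2 P)) G \<le> ennreal (t' / 8)"
      by (auto simp: high_def not_less)
    then have "avgLp p (cube_set (dil 2 P)) (\<lambda>x. S x + G x) \<le> ennreal (4 * (t' / 8 + t' / 8))"
      using hP t by (intro avgLp_add p m) auto
    also have "(\<lambda>x. S x + G x) = F" using m(3) by auto
    finally show False using hP(1) by (simp add: high_def not_le[symmetric])
  qed
  then show "x \<in> lvlset p S (t' / 8) {P\<in>dyads (\<lambda>_. True) Q. subcube P R} \<union> lvlset p G (t' / 8) {P\<in>dyads (\<lambda>_. True) Q. subcube P R}"
    using P PR unfolding lvlset_def dyads_def by blast
qed

text \<open>The sum over the factors \<open>\<kappa> l\<close> for l = 1, ..., J is estimated on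
  each good maximal cube: the S-part contributes J/4 through \<open>small_sets_cond\<close>, the
  G-part J/4 through \<open>level_decay\<close>. After summation over the cubes one of the J factors
  does at least as well as the mean. The factor depends on Q, F and t, but its range up to
  \<open>K\<close> and \<open>\<epsilon>\<close> do not. The function \<open>b\<close> merely
  separates good cubes from bad ones.\<close>

lemma good_lambda:
  fixes w :: "real^('n::finite) \<Rightarrow> real"
  assumes small: "small_sets_cond w" and LD: "level_decay p q q0 w" and p: "p \<ge> 1" and q: "q > 0" and C1: "C1 \<ge> 1"
  obtains \<epsilon> K where "\<epsilon> > 0" "K \<ge> 2"
    "\<And>Q F t b. Q \<in> cubes \<Longrightarrow> F \<in> borel_measurable lebesgue \<Longrightarrow> t > 0 \<Longrightarrow>
      (\<And>R. R \<in> stopping p F t Q \<Longrightarrow> b R \<le> \<epsilon> * t \<Longrightarrow> decomposable p q0 F R (C1 * \<epsilon> * t) (C1 * t)) \<Longrightarrow>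
      \<exists>\<kappa>. 2 \<le> \<kappa> \<and> \<kappa> \<le> K \<and> ennreal (\<kappa> powr q) * wmeas w (Om p F (\<kappa> * t) Q) \<le>
        ennreal (K powr q) * wmeas w (\<Union>R\<in>{R\<in>stopping p F t Q. b R > \<epsilon> * t}. cube_set R) + ennreal (1/2) * wmeas w (Om p F t Q)"
proof -
  have w: "weight w" using small by (simp add: small_sets_cond_def)
  have [measurable]: "w \<in> borel_measurable lebesgue" using w by (rule weight_measurable)
  \<comment> \<open>The 8 comes from the division of heights between \<open>S\<close> and
    \<open>G\<close>; with it, \<open>\<kappa> l * t / 8\<close> is \<open>2 ^ l * (C1 * t)\<close>,
    the heights of \<open>level_decay\<close> for the bound \<open>C1 * t\<close> of
    \<open>G\<close>.\<close>
  define K0 where "K0 = 8 * C1"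
  have K0: "K0 \<ge> 8" using C1 by (simp add: K0_def)
  define \<eta> where "\<eta> = K0 powr (- q) / 4"
  have eta: "\<eta> > 0" "K0 powr q * \<eta> = 1 / 4" using K0 by (auto simp: \<eta>_def powr_minus)
  obtain J where J: "J \<ge> 1" and decay: "level_decay_at p q q0 w \<eta> J"
    using LD eta(1) unfolding level_decay_def by blast
  note decay = decay[unfolded level_decay_at_def, rule_format]
  define K where "K = K0 * 2 ^ J"
  have K: "K \<ge> 8" using K0 mult_mono[of 8 K0 1 "2 ^ J"] by (simp add: K_def)
  \<comment> \<open>Fixed only after \<open>J\<close>: the weight tolerated for the S-part must
    outweigh the largest factor \<open>K powr q\<close>.\<close>
  define e where "e = K powr (- q) / 4"
  have e: "e > 0" "K powr q * e = 1 / 4" using K by (auto simp: e_def powr_minus)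
  obtain d where d: "d > 0" "\<And>Q E. Q \<in> cubes \<Longrightarrow> E \<in> sets lebesgue \<Longrightarrow> E \<subseteq> cube_set Q \<Longrightarrow>
     emeasure lebesgue E \<le> ennreal d * emeasure lebesgue (cube_set Q) \<Longrightarrow> wmeas w E \<le> ennreal e * wmeas w (cube_set Q)"
    using small e(1) unfolding small_sets_cond_def by metis
  define v where "v = vitali_const CARD('n)"
  have v: "v > 0" by (simp add: v_def vitali_const_pos)
  \<comment> \<open>All heights used for \<open>S\<close> are at least \<open>t\<close>, so
    \<open>lvlset_weak\<close> gives its level sets relative measure at most
    \<open>v * (C1 * \<epsilon>) powr p = d\<close>.\<close>
  define \<epsilon> where "\<epsilon> = (d / v) powr (1 / p) / C1"
  have eps: "\<epsilon> > 0" using d v C1 by (simp add: \<epsilon>_def)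
  have "C1 * \<epsilon> = (d / v) powr (1 / p)" using C1 by (simp add: \<epsilon>_def)
  then have veps: "v * (C1 * \<epsilon>) powr p = d" using d v p by (simp add: powr_powr)
  define \<kappa> where "\<kappa> l = K0 * 2 ^ l" for l :: nat
  have kap8: "\<kappa> l \<ge> 8" for l using K0 mult_mono[of 8 K0 1 "2 ^ l"] by (simp add: \<kappa>_def)
  have kapK: "\<kappa> l \<le> K" if "l \<le> J" for l
    using that K0 unfolding \<kappa>_def K_def by (intro mult_left_mono power_increasing) auto
  show ?thesis
  proof (rule that[OF eps])
    show "K \<ge> 2" using K by simp
    fix Q :: "'n cube" and F :: "real^'n \<Rightarrow> complex" and t :: real and b :: "'n cube \<Rightarrow> real"
    assume Q: "Q \<in> cubes" and F [measurable]: "F \<in> borel_measurable lebesgue" and t: "t > 0"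
      and dec: "\<And>R. R \<in> stopping p F t Q \<Longrightarrow> b R \<le> \<epsilon> * t \<Longrightarrow> decomposable p q0 F R (C1 * \<epsilon> * t) (C1 * t)"
    let ?W = "\<lambda>l. Om p F (\<kappa> l * t) Q"
    let ?Bad = "\<Union>R\<in>{R\<in>stopping p F t Q. b R > \<epsilon> * t}. cube_set R"
    have [measurable]: "?W l \<in> sets lebesgue" for l by simp
    have Bad [measurable]: "?Bad \<in> sets lebesgue" by (rule sets_Union_cubes) simp
    have Wsub: "?W l \<subseteq> Om p F t Q" for l
      using kap8[of l] t by (intro Om_antimono) auto
    have trivial: "(\<Sum>l\<in>{1..J}. ennreal (\<kappa> l powr q) * wmeas w (?W l \<inter> cube_set R)) \<le> ennreal (real J * K powr q) * wmeas w (cube_set R)" for R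
    proof -
      have "(\<Sum>l\<in>{1..J}. ennreal (\<kappa> l powr q) * wmeas w (?W l \<inter> cube_set R)) \<le> (\<Sum>l\<in>{1..J}. ennreal (K powr q) * wmeas w (cube_set R))"
      proof (intro sum_mono mult_mono)
        fix l assume "l \<in> {1..J}"
        then show "ennreal (\<kappa> l powr q) \<le> ennreal (K powr q)"
          using kapK[of l] kap8[of l] q by (intro ennreal_leI powr_mono2) auto
      qed (auto intro: wmeas_mono)
      also have "\<dots> = ennreal (real J * K powr q) * wmeas w (cube_set R)"
        by (simp add: ennreal_mult mult.assoc ennreal_of_nat_eq_real_of_nat)
      finally show ?thesis .
    qed
    have good: "(\<Sum>l\<in>{1..J}. ennreal (\<kappa> l powr q) * wmeas w (?W l \<inter> cube_set R)) \<le> ennreal (real J / 2) * wmeas w (cube_set R)"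
      if R: "R \<in> stopping p F t Q" "b R \<le> \<epsilon> * t" for R
    proof -
      have Rc: "R \<in> cubes" using R maxdy_subset dyads_cubes[OF Q] by blast
      obtain S G where SG: "S \<in> borel_measurable lebesgue" "G \<in> borel_measurable lebesgue" "\<And>x. F x = S x + G x"
        "avgLp p (cube_set (dil 2 R)) S \<le> ennreal (C1 * \<epsilon> * t)" "avgq q0 (cube_set (dil 2 R)) G \<le> ennreal (C1 * t)"
        using dec[OF R] unfolding decomposable_def by blast
      define \<P> where "\<P> = {P\<in>dyads (\<lambda>_. True) Q. subcube P R}"
      have P: "\<P> \<subseteq> cubes" "countable \<P>" "\<And>P. P \<in> \<P> \<Longrightarrow> subcube P R"
        unfolding \<P>_def using dyads_cubes[OF Q] by (blast, simp_all)
      have hit: "\<kappa> l * t / 8 = 2 ^ l * (C1 * t)" for l by (simp add: \<kappa>_def K0_def)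
      let ?S = "\<lambda>l. lvlset p S (\<kappa> l * t / 8) \<P>" and ?G = "\<lambda>l. lvlset p G (2 ^ l * (C1 * t)) \<P>"
      have wS: "wmeas w (?S l) \<le> ennreal e * wmeas w (cube_set R)" for l
      proof (rule d(2)[OF Rc])
        show "?S l \<in> sets lebesgue" using P by simp
        show "?S l \<subseteq> cube_set R" using P by (intro lvlset_subset)
        have u: "\<kappa> l * t / 8 \<ge> t" using kap8[of l] t by (simp add: field_simps)
        have "emeasure lebesgue (?S l) \<le> ennreal (v * (C1 * \<epsilon> * t / (\<kappa> l * t / 8)) powr p) * emeasure lebesgue (cube_set R)"
          unfolding v_def by (rule lvlset_weak[OF Rc P p]) (use u t C1 eps SG in auto)
        also have "\<dots> \<le> ennreal d * emeasure lebesgue (cube_set R)"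
        proof (intro mult_right_mono ennreal_leI)
          have "C1 * \<epsilon> * t / (\<kappa> l * t / 8) \<le> C1 * \<epsilon> * t / t"
            using u t C1 eps by (intro divide_left_mono) auto
          then have "(C1 * \<epsilon> * t / (\<kappa> l * t / 8)) powr p \<le> (C1 * \<epsilon>) powr p"
            using t C1 eps p kap8[of l] by (intro powr_mono2) (auto intro!: divide_nonneg_nonneg mult_nonneg_nonneg)
          then show "v * (C1 * \<epsilon> * t / (\<kappa> l * t / 8)) powr p \<le> d"
            using v veps mult_left_mono[of "(C1 * \<epsilon> * t / (\<kappa> l * t / 8)) powr p" "(C1 * \<epsilon>) powr p" v] by linarith
        qed simp
        finally show "emeasure lebesgue (?S l) \<le> ennreal d * emeasure lebesgue (cube_set R)" .
      qed
      have each: "ennreal (\<kappa> l powr q) * wmeas w (?W l \<inter> cube_set R) \<le>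
          ennreal (1/4) * wmeas w (cube_set R) + ennreal (K0 powr q) * (ennreal ((2 ^ l) powr q) * wmeas w (?G l))"
        if l: "l \<in> {1..J}" for l
      proof -
        have "?W l \<inter> cube_set R \<subseteq> ?S l \<union> ?G l"
          unfolding \<P>_def hit[symmetric] using kap8[of l] t by (intro Om_inter_stopping[OF Q p t _ R(1) SG(1-3)]) auto
        then have "wmeas w (?W l \<inter> cube_set R) \<le> wmeas w (?S l \<union> ?G l)" by (rule wmeas_mono)
        also have "\<dots> \<le> wmeas w (?S l) + wmeas w (?G l)"
          using P by (simp add: wmeas_density[OF w] emeasure_subadditive)
        also have "\<dots> \<le> ennreal e * wmeas w (cube_set R) + wmeas w (?G l)"
          by (intro add_right_mono wS)
        finally have "ennreal (\<kappa> l powr q) * wmeas w (?W l \<inter> cube_set R) \<le> ennreal (\<kappa> l powr q) * (ennreal e * wmeas w (cube_set R) + wmeas w (?G l))"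
          by (rule mult_left_mono) simp
        also have "\<dots> = ennreal (\<kappa> l powr q * e) * wmeas w (cube_set R) + ennreal (\<kappa> l powr q) * wmeas w (?G l)"
          using e by (simp add: distrib_left ennreal_mult mult.assoc)
        also have "\<dots> \<le> ennreal (1/4) * wmeas w (cube_set R) + ennreal (K0 powr q * (2 ^ l) powr q) * wmeas w (?G l)"
        proof (intro add_mono mult_right_mono ennreal_leI)
          have "\<kappa> l powr q * e \<le> K powr q * e"
            using kapK[of l] kap8[of l] q l e by (intro mult_right_mono powr_mono2) auto
          then show "\<kappa> l powr q * e \<le> 1 / 4" using e by simp
          show "\<kappa> l powr q \<le> K0 powr q * (2 ^ l) powr q" using K0 by (simp add: \<kappa>_def powr_mult)
        qed auto
        finally show ?thesis by (simp add: ennreal_mult mult.assoc)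
      qed
      have "(\<Sum>l\<in>{1..J}. ennreal (\<kappa> l powr q) * wmeas w (?W l \<inter> cube_set R)) \<le>
         (\<Sum>l\<in>{1..J}. ennreal (1/4) * wmeas w (cube_set R) + ennreal (K0 powr q) * (ennreal ((2 ^ l) powr q) * wmeas w (?G l)))"
        by (intro sum_mono each)
      also have "\<dots> = of_nat J * (ennreal (1/4) * wmeas w (cube_set R)) + ennreal (K0 powr q) * (\<Sum>l\<in>{1..J}. ennreal ((2 ^ l) powr q) * wmeas w (?G l))"
        by (simp add: sum.distrib sum_distrib_left)
      also have "\<dots> \<le> of_nat J * (ennreal (1/4) * wmeas w (cube_set R)) + ennreal (K0 powr q) * (ennreal (\<eta> * real J) * wmeas w (cube_set R))"
        using P SG C1 t by (intro add_left_mono mult_left_mono decay[OF Rc]) auto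
      also have "\<dots> = ennreal (real J * (1/4) + K0 powr q * (\<eta> * real J)) * wmeas w (cube_set R)"
        unfolding ennreal_of_nat_eq_real_of_nat mult.assoc[symmetric] distrib_right[symmetric]
        using eta(1) by (subst (1 2) ennreal_mult[symmetric], simp_all add: ennreal_plus[symmetric] mult.assoc del: ennreal_plus)
      also have "real J * (1/4) + K0 powr q * (\<eta> * real J) = real J / 2"
        unfolding mult.assoc[symmetric] eta(2) by simp
      finally show ?thesis .
    qed
    \<comment> \<open>Both sides are written as integrals of densities, so that the inequality on
      single cubes can be summed over the maximal cubes.\<close>
    define f where "f x = (\<Sum>l\<in>{1..J}. ennreal (\<kappa> l powr q) * (ennreal (w x) * indicator (?W l) x))" for x
    define g where "g x = ennreal (real J * K powr q) * (ennreal (w x) * indicator ?Bad x) + ennreal (real J / 2) * ennreal (w x)" for x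
    have fm [measurable]: "f \<in> borel_measurable lebesgue" and gm [measurable]: "g \<in> borel_measurable lebesgue"
      unfolding f_def g_def by measurable
    have ind2: "indicator A x * indicator B x = (indicator (A \<inter> B) x :: ennreal)" for A B :: "(real^'n) set" and x
      by (simp add: indicator_def)
    have fint: "(\<integral>\<^sup>+x\<in>E. f x \<partial>lebesgue) = (\<Sum>l\<in>{1..J}. ennreal (\<kappa> l powr q) * wmeas w (?W l \<inter> E))" if [measurable]: "E \<in> sets lebesgue" for E
    proof -
      have "(\<integral>\<^sup>+x\<in>E. f x \<partial>lebesgue) = (\<integral>\<^sup>+x. (\<Sum>l\<in>{1..J}. ennreal (\<kappa> l powr q) * (ennreal (w x) * indicator (?W l \<inter> E) x)) \<partial>lebesgue)"
        unfolding f_def sum_distrib_right by (simp add: ind2 mult.assoc)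
      also have "\<dots> = (\<Sum>l\<in>{1..J}. \<integral>\<^sup>+x. ennreal (\<kappa> l powr q) * (ennreal (w x) * indicator (?W l \<inter> E) x) \<partial>lebesgue)"
        by (rule nn_integral_sum) measurable
      also have "\<dots> = (\<Sum>l\<in>{1..J}. ennreal (\<kappa> l powr q) * wmeas w (?W l \<inter> E))"
        unfolding wmeas_def by (intro sum.cong nn_integral_cmult refl) measurable
      finally show ?thesis .
    qed
    have gint: "(\<integral>\<^sup>+x\<in>E. g x \<partial>lebesgue) = ennreal (real J * K powr q) * wmeas w (?Bad \<inter> E) + ennreal (real J / 2) * wmeas w E" if [measurable]: "E \<in> sets lebesgue" for E
    proof -
      have "(\<integral>\<^sup>+x\<in>E. g x \<partial>lebesgue) = (\<integral>\<^sup>+x. ennreal (real J * K powr q) * (ennreal (w x) * indicator (?Bad \<inter> E) x) + ennreal (real J / 2) * (ennreal (w x) * indicator E x) \<partial>lebesgue)"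
        unfolding g_def by (simp only: distrib_right mult.assoc ind2)
      also have "\<dots> = (\<integral>\<^sup>+x. ennreal (real J * K powr q) * (ennreal (w x) * indicator (?Bad \<inter> E) x) \<partial>lebesgue) + (\<integral>\<^sup>+x. ennreal (real J / 2) * (ennreal (w x) * indicator E x) \<partial>lebesgue)"
        by (rule nn_integral_add) measurable
      also have "(\<integral>\<^sup>+x. ennreal (real J * K powr q) * (ennreal (w x) * indicator (?Bad \<inter> E) x) \<partial>lebesgue) = ennreal (real J * K powr q) * wmeas w (?Bad \<inter> E)"
        unfolding wmeas_def by (rule nn_integral_cmult) measurable
      also have "(\<integral>\<^sup>+x. ennreal (real J / 2) * (ennreal (w x) * indicator E x) \<partial>lebesgue) = ennreal (real J / 2) * wmeas w E"
        unfolding wmeas_def by (rule nn_integral_cmult) measurable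
      finally show ?thesis .
    qed
    let ?X = "ennreal (K powr q) * wmeas w ?Bad + ennreal (1/2) * wmeas w (Om p F t Q)"
    have "(\<integral>\<^sup>+x\<in>UNIV \<inter> Om p F t Q. f x \<partial>lebesgue) \<le> 1 * (\<integral>\<^sup>+x\<in>Om p F t Q. g x \<partial>lebesgue)"
    proof (rule emeasure_Union_maxdy_le[OF Q fm gm])
      fix R assume R: "R \<in> stopping p F t Q"
      have "(\<integral>\<^sup>+x\<in>cube_set R. f x \<partial>lebesgue) \<le> (\<integral>\<^sup>+x\<in>cube_set R. g x \<partial>lebesgue)"
      proof (cases "b R \<le> \<epsilon> * t")
        case True
        then show ?thesis using good[OF R True] by (simp add: fint gint add_increasing)
      next
        case False
        then have "cube_set R \<subseteq> ?Bad" using R by auto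
        then have "?Bad \<inter> cube_set R = cube_set R" by blast
        then show ?thesis using trivial[of R] by (simp add: fint gint add_increasing2)
      qed
      then show "(\<integral>\<^sup>+x\<in>UNIV \<inter> cube_set R. f x \<partial>lebesgue) \<le> 1 * (\<integral>\<^sup>+x\<in>cube_set R. g x \<partial>lebesgue)" by simp
    qed simp
    then have "(\<Sum>l\<in>{1..J}. ennreal (\<kappa> l powr q) * wmeas w (?W l \<inter> Om p F t Q)) \<le>
        ennreal (real J * K powr q) * wmeas w (?Bad \<inter> Om p F t Q) + ennreal (real J / 2) * wmeas w (Om p F t Q)"
      by (simp add: fint gint)
    also have "\<dots> \<le> ennreal (real J * K powr q) * wmeas w ?Bad + ennreal (real J / 2) * wmeas w (Om p F t Q)"
      by (intro add_mono mult_left_mono wmeas_mono) auto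
    also have "\<dots> = of_nat J * ?X"
    proof -
      have "ennreal (real J / 2) = of_nat J * ennreal (1/2)"
        unfolding ennreal_of_nat_eq_real_of_nat by (subst ennreal_mult[symmetric]) simp_all
      moreover have "ennreal (real J * K powr q) = of_nat J * ennreal (K powr q)"
        unfolding ennreal_of_nat_eq_real_of_nat by (subst ennreal_mult[symmetric]) simp_all
      ultimately show ?thesis by (simp only: distrib_left mult.assoc)
    qed
    also have "(\<Sum>l\<in>{1..J}. ennreal (\<kappa> l powr q) * wmeas w (?W l \<inter> Om p F t Q)) = (\<Sum>l\<in>{1..J}. ennreal (\<kappa> l powr q) * wmeas w (?W l))"
      using Wsub by (simp add: Int_absorb2)
    finally have tot: "(\<Sum>l\<in>{1..J}. ennreal (\<kappa> l powr q) * wmeas w (?W l)) \<le> of_nat J * ?X" .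
    \<comment> \<open>The smallest of the J terms is at most their mean; this selects the factor for
      this \<open>t\<close>.\<close>
    define a where "a l = ennreal (\<kappa> l powr q) * wmeas w (?W l)" for l
    obtain l where l: "l \<in> {1..J}" "\<And>i. i \<in> {1..J} \<Longrightarrow> a l \<le> a i"
      using arg_min_if_finite[of "{1..J}" a] J by (metis atLeastAtMost_iff empty_iff finite_atLeastAtMost linorder_not_less order_refl)
    have "of_nat J * a l \<le> (\<Sum>l\<in>{1..J}. a l)"
      using sum_bounded_below[of "{1..J}" "a l" a] l by simp
    also have "\<dots> \<le> of_nat J * ?X" using tot by (simp add: a_def)
    finally have "a l \<le> ?X" using J by (subst (asm) ennreal_mult_le_mult_iff) (auto simp: ennreal_of_nat_eq_real_of_nat)
    then show "\<exists>\<kappa>. 2 \<le> \<kappa> \<and> \<kappa> \<le> K \<and> ennreal (\<kappa> powr q) * wmeas w (Om p F (\<kappa> * t) Q) \<le> ?X"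
      using l kapK[of l] kap8[of l] unfolding a_def by (intro exI[of _ "\<kappa> l"]) auto
  qed
qed

text \<open>The steps lead from \<open>t0\<close> upward by factors between 2 and \<open>K\<close>
  that depend on the current height. The last height s not passing \<open>t\<close> satisfies
  \<open>t \<le> K * s\<close>, and monotonicity of \<open>v\<close> bridges the rest at the cost
  \<open>K powr q\<close>.\<close>

lemma level_iteration:
  fixes v :: "real \<Rightarrow> real"
  assumes anti: "\<And>s t. t0 \<le> s \<Longrightarrow> s \<le> t \<Longrightarrow> v t \<le> v s" and nonneg: "\<And>t. v t \<ge> 0"
    and t0: "t0 > 0" "v t0 \<le> W" and q: "q > 0" and K: "K \<ge> 2" and B: "B \<ge> 0"
    and step: "\<And>t. t \<ge> t0 \<Longrightarrow> \<exists>\<kappa>. 2 \<le> \<kappa> \<and> \<kappa> \<le> K \<and> \<kappa> powr q * v (\<kappa> * t) \<le> B / t powr q + v t / 2"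
    and t: "t \<ge> t0"
  shows "t powr q * v t \<le> K powr q * (2 * B + t0 powr q * W)"
proof -
  define M where "M = 2 * B + t0 powr q * W"
  have W: "W \<ge> 0" using t0 nonneg[of t0] by linarith
  \<comment> \<open>The invariant: s carries the bound \<open>M\<close> and either has come within
    the factor \<open>K\<close> of \<open>t\<close> or has grown by \<open>2 ^ n\<close>. The second
    alternative fails for large n.\<close>
  have "\<exists>s\<ge>t0. s \<le> t \<and> s powr q * v s \<le> M \<and> (t \<le> K * s \<or> 2 ^ n * t0 \<le> s)" for n :: nat
  proof (induction n)
    case 0
    have "t0 powr q * v t0 \<le> M" unfolding M_def using B t0 by (intro add_increasing mult_left_mono) auto
    then show ?case using t by (intro exI[of _ t0]) auto
  next
    case (Suc n)
    then obtain s where s: "s \<ge> t0" "s \<le> t" "s powr q * v s \<le> M" "t \<le> K * s \<or> 2 ^ n * t0 \<le> s" by blast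
    show ?case
    proof (cases "t \<le> K * s")
      case False
      then have sn: "2 ^ n * t0 \<le> s" using s by simp
      obtain \<kappa> where k: "2 \<le> \<kappa>" "\<kappa> \<le> K" "\<kappa> powr q * v (\<kappa> * s) \<le> B / s powr q + v s / 2" using step[OF s(1)] by blast
      have s0: "s > 0" using s t0 by simp
      have "\<kappa> * s \<le> K * s" using k s0 by (intro mult_right_mono) auto
      then have le: "\<kappa> * s \<le> t" using False by simp
      have ge: "2 * s \<le> \<kappa> * s" using k s0 by (intro mult_right_mono) auto
      have "(\<kappa> * s) powr q * v (\<kappa> * s) = s powr q * (\<kappa> powr q * v (\<kappa> * s))"
        using k s0 by (simp add: powr_mult)
      also have "\<dots> \<le> s powr q * (B / s powr q + v s / 2)" by (intro mult_left_mono k) auto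
      also have "\<dots> = B + (s powr q * v s) / 2" using s0 by (simp add: distrib_left)
      \<comment> \<open>The bound reproduces itself, since \<open>B \<le> M / 2\<close> and the old
        term enters with the factor 1/2.\<close>
      also have "\<dots> \<le> M"
      proof -
        have "2 * B \<le> M" using t0 W by (simp add: M_def)
        then show ?thesis using s(3) by linarith
      qed
      finally have "(\<kappa> * s) powr q * v (\<kappa> * s) \<le> M" .
      moreover have "t0 \<le> \<kappa> * s" using ge s(1) s0 by linarith
      moreover have "2 ^ Suc n * t0 \<le> \<kappa> * s" using ge sn by simp
      ultimately show ?thesis using le by blast
    qed (use s in blast)
  qed
  moreover obtain n :: nat where "t / t0 < 2 ^ n" using real_arch_pow[of 2] by auto
  ultimately obtain s where s: "s \<ge> t0" "s \<le> t" "s powr q * v s \<le> M" "t \<le> K * s"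
    using t0 by (metis linorder_not_le order_trans pos_divide_less_eq)
  have "t powr q * v t \<le> (K * s) powr q * v s"
    using s t t0 q anti[of s t] nonneg[of t] by (intro mult_mono powr_mono2) auto
  also have "\<dots> = K powr q * (s powr q * v s)" using s K t0 by (simp add: powr_mult)
  also have "\<dots> \<le> K powr q * M" using s by (intro mult_left_mono) auto
  finally show ?thesis unfolding M_def .
qed

subsection \<open>Local decomposition of the oscillations\<close>

text \<open>Four consequences of the definition of \<open>mk\<close>. The factors 2^(kn/p) occur in
  it only from k = 5 on; for smaller k they are at most 2^(4n), whence the constant. The shift by 2
  in the last claim makes the entry of index 4 supply \<open>\<beta> 2\<close> and later entries
  supply \<open>\<beta> (k - 2)\<close>.\<close>

lemma mk_nonneg_ge:
  assumes ab: "\<And>k. k \<ge> 2 \<Longrightarrow> 0 \<le> \<alpha> k" "\<And>k. k \<ge> 2 \<Longrightarrow> 0 \<le> \<beta> k" and p: "p \<ge> 1"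
  shows "k \<ge> 1 \<Longrightarrow> 0 \<le> mk n p \<alpha> \<beta> k"
    and "k \<ge> 2 \<Longrightarrow> \<alpha> k \<le> mk n p \<alpha> \<beta> k"
    and "k \<ge> 2 \<Longrightarrow> \<alpha> k * 2 powr (real k * real n / p) \<le> 2 ^ (4 * n) * mk n p \<alpha> \<beta> k"
    and "k \<ge> 2 \<Longrightarrow> \<beta> k \<le> mk n p \<alpha> \<beta> (k + 2)"
proof -
  have one: "1 \<le> 2 powr (real k * real n / p)" for k
    using p by (intro ge_one_powr_ge_zero) auto
  have al: "\<alpha> k \<le> mk n p \<alpha> \<beta> k" if k: "k \<ge> 2" for k
  proof -
    consider "k = 2" | "k = 3" | "k = 4" | "k \<ge> 5" using k by linarith
    then show ?thesis
    proof cases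
      case 4
      have "\<alpha> k \<le> 2 powr (real k * real n / p) * \<alpha> k"
        using one[of k] ab(1)[OF k] by (simp add: mult_le_cancel_right1)
      also have "\<dots> \<le> mk n p \<alpha> \<beta> k" using 4 by (simp add: mk_def le_max_iff_disj)
      finally show ?thesis .
    qed (simp_all add: mk_def le_max_iff_disj)
  qed
  show "k \<ge> 2 \<Longrightarrow> \<alpha> k \<le> mk n p \<alpha> \<beta> k" by (rule al)
  show "k \<ge> 1 \<Longrightarrow> 0 \<le> mk n p \<alpha> \<beta> k"
  proof (cases "k = 1")
    case False
    assume "k \<ge> 1"
    with False have "k \<ge> 2" by simp
    then show ?thesis using order_trans[OF ab(1) al] by blast
  qed (simp add: mk_def)
  show "k \<ge> 2 \<Longrightarrow> \<alpha> k * 2 powr (real k * real n / p) \<le> 2 ^ (4 * n) * mk n p \<alpha> \<beta> k"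
  proof -
    assume k: "k \<ge> 2"
    show ?thesis
    proof (cases "k \<ge> 5")
      case True
      have "\<alpha> k * 2 powr (real k * real n / p) \<le> mk n p \<alpha> \<beta> k"
        using True by (simp add: mk_def le_max_iff_disj mult.commute)
      also have "\<dots> \<le> 2 ^ (4 * n) * mk n p \<alpha> \<beta> k"
        using al[OF k] ab(1)[OF k] one_le_power[of "2::real" "4 * n"] by (simp add: mult_le_cancel_right1)
      finally show ?thesis .
    next
      case False
      have "real k * real n / p \<le> real (4 * n)"
      proof -
        have "real k * real n / p \<le> real k * real n / 1"
          using p by (intro divide_left_mono) auto
        also have "\<dots> \<le> 4 * real n" using False by (simp add: mult_right_mono)
        finally show ?thesis by simp
      qed
      then have "2 powr (real k * real n / p) \<le> 2 powr real (4 * n)" by (intro powr_mono) auto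
      also have "\<dots> = 2 ^ (4 * n)" by (rule powr_realpow) simp
      finally show ?thesis using al[OF k] ab(1)[OF k] by (subst mult.commute) (intro mult_mono, auto)
    qed
  qed
  show "k \<ge> 2 \<Longrightarrow> \<beta> k \<le> mk n p \<alpha> \<beta> (k + 2)"
    by (cases "k = 2") (simp_all add: mk_def le_max_iff_disj)
qed

section \<open>Off-diagonal estimates with real majorants of the averages\<close>

locale oscillation_family =
  fixes p0 Cp0 :: real and q0 :: ennreal and \<alpha> \<beta> :: "nat \<Rightarrow> real" and B :: "('n::finite) cube \<Rightarrow> 'n op"
  assumes p0: "1 \<le> p0" and q0: "ennreal p0 < q0" and O: "O_class p0 q0 Cp0 \<alpha> \<beta> B"
begin

lemma q0_ge_1: "1 \<le> q0"
proof -
  have "ennreal 1 \<le> ennreal p0" using p0 by (rule ennreal_leI)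
  then have "ennreal 1 \<le> q0" using q0 by (rule order_trans[OF _ less_imp_le])
  then show ?thesis by simp
qed

lemma alpha_nonneg: "k \<ge> 2 \<Longrightarrow> 0 \<le> \<alpha> k" and beta_nonneg: "k \<ge> 2 \<Longrightarrow> 0 \<le> \<beta> k"
  using O unfolding O_class_def by blast+

lemma alpha_summable: "summable (\<lambda>k. \<alpha> (k + 2))"
proof -
  have "summable (\<lambda>k. 2 powr (real k * real CARD('n) / p0) * \<alpha> k)"
    using O unfolding O_class_def by blast
  then have "summable (\<lambda>k. 2 powr (real (k + 2) * real CARD('n) / p0) * \<alpha> (k + 2))"
    by (rule summable_ignore_initial_segment)
  then show ?thesis
  proof (rule summable_comparison_test')
    fix k
    have "1 \<le> 2 powr (real (k + 2) * real CARD('n) / p0)"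
      using p0 by (intro ge_one_powr_ge_zero) auto
    then show "norm (\<alpha> (k + 2)) \<le> 2 powr (real (k + 2) * real CARD('n) / p0) * \<alpha> (k + 2)"
      using alpha_nonneg[of "k + 2"] by (simp add: mult_le_cancel_right1)
  qed
qed

lemma B_linear: "Q \<in> cubes \<Longrightarrow> linear_loc p0 (B Q)"
  using O unfolding O_class_def by blast

lemma B_Lploc [simp]: "Q \<in> cubes \<Longrightarrow> Lploc p0 f \<Longrightarrow> Lploc p0 (B Q f)"
  using B_linear unfolding linear_loc_def by blast

lemma B_cong: "Q \<in> cubes \<Longrightarrow> Lploc p0 f \<Longrightarrow> Lploc p0 g \<Longrightarrow> AE x in lebesgue. f x = g x \<Longrightarrow> AE x in lebesgue. B Q f x = B Q g x"
  using B_linear unfolding linear_loc_def by blast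

lemma B_add: "Q \<in> cubes \<Longrightarrow> Lploc p0 f \<Longrightarrow> Lploc p0 g \<Longrightarrow> AE x in lebesgue. B Q (\<lambda>y. f y + g y) x = B Q f x + B Q g x"
  using B_linear unfolding linear_loc_def by blast

lemma Lploc_diff:
  fixes f g :: "real^'n \<Rightarrow> complex"
  assumes "Lploc p0 f" "Lploc p0 g"
  shows "Lploc p0 (\<lambda>y. f y - g y)"
  using Lploc_add[OF assms(1) Lploc_uminus[OF assms(2)]] p0 by simp

lemma Aop_Lploc [simp]: "Q \<in> cubes \<Longrightarrow> Lploc p0 f \<Longrightarrow> Lploc p0 (Aop B Q f)"
  unfolding Aop_def by (intro Lploc_diff B_Lploc)

lemma B_diff:
  assumes Q: "Q \<in> cubes" and f: "Lploc p0 f" and g: "Lploc p0 g"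
  shows "AE x in lebesgue. B Q (\<lambda>y. f y - g y) x = B Q f x - B Q g x"
proof -
  have d: "Lploc p0 (\<lambda>y. f y - g y)" by (rule Lploc_diff[OF f g])
  have "AE x in lebesgue. B Q (\<lambda>y. (f y - g y) + g y) x = B Q (\<lambda>y. f y - g y) x + B Q g x"
    by (rule B_add[OF Q d g])
  then show ?thesis by eventually_elim simp
qed

lemma Aop_add:
  assumes Q: "Q \<in> cubes" and f: "Lploc p0 f" and g: "Lploc p0 g"
  shows "AE x in lebesgue. Aop B Q (\<lambda>y. f y + g y) x = Aop B Q f x + Aop B Q g x"
  using B_add[OF assms] by eventually_elim (simp add: Aop_def)

lemma B_commute: "Q \<in> cubes \<Longrightarrow> R \<in> cubes \<Longrightarrow> Lploc p0 f \<Longrightarrow> AE x in lebesgue. B Q (B R f) x = B R (B Q f) x"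
  using O unfolding O_class_def by blast

lemma weighted_suminf_le:
  fixes c y :: "nat \<Rightarrow> real" and z :: "nat \<Rightarrow> ennreal"
  assumes "\<And>k. 0 \<le> c k" "\<And>k. 0 \<le> y k" "\<And>k. z k \<le> ennreal (y k)" "summable (\<lambda>k. c k * y k)"
  shows "(\<Sum>k. ennreal (c k) * z k) \<le> ennreal (\<Sum>k. c k * y k)"
proof -
  have "(\<Sum>k. ennreal (c k) * z k) \<le> (\<Sum>k. ennreal (c k * y k))"
    using assms by (intro suminf_le) (auto simp: ennreal_mult intro!: mult_left_mono)
  also have "\<dots> = ennreal (\<Sum>k. c k * y k)"
    using assms by (intro suminf_ennreal2) auto
  finally show ?thesis .
qed

lemma Aop_far:
  assumes Q: "Q \<in> cubes" and g: "Lploc p0 g" and j: "j \<ge> 1"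
    and y: "\<And>k. k \<ge> 2 \<Longrightarrow> 0 \<le> y k" "\<And>k. k \<ge> 2 \<Longrightarrow> avgLp p0 (cube_set (dil (2 ^ k) Q)) g \<le> ennreal (y k)"
    and sm: "summable (\<lambda>k. \<alpha> (k + 2) * y (k + 2))"
  shows "avgq q0 (cube_set (dil (2 ^ j) Q)) (Aop B Q (\<lambda>x. if x \<in> cube_set (dil (2 ^ (j + 1)) Q) then 0 else g x))
    \<le> ennreal (\<Sum>k. \<alpha> (k + 2 + j) * y (k + 2 + j))"
proof -
  have "avgq q0 (cube_set (dil (2 ^ j) Q)) (Aop B Q (\<lambda>x. if x \<in> cube_set (dil (2 ^ (j + 1)) Q) then 0 else g x))
    \<le> (\<Sum>k. ennreal (\<alpha> (k + 2 + j)) * avgLp p0 (cube_set (dil (2 ^ (k + 2 + j)) Q)) g)"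
    using O Q g j unfolding O_class_def by blast
  also have "\<dots> \<le> ennreal (\<Sum>k. \<alpha> (k + 2 + j) * y (k + 2 + j))"
  proof (rule weighted_suminf_le)
    have "summable (\<lambda>k. \<alpha> (k + j + 2) * y (k + j + 2))"
      using summable_ignore_initial_segment[OF sm, of j] by simp
    then show "summable (\<lambda>k. \<alpha> (k + 2 + j) * y (k + 2 + j))" by (simp add: ac_simps)
    show "avgLp p0 (cube_set (dil (2 ^ (k + 2 + j)) Q)) g \<le> ennreal (y (k + 2 + j))" for k
      by (rule y(2)) simp
  qed (use alpha_nonneg y(1) in auto)
  finally show ?thesis .
qed

lemma tail_suminf_le:
  assumes y: "\<And>k. k \<ge> 2 \<Longrightarrow> 0 \<le> y k" and sm: "summable (\<lambda>k. \<alpha> (k + 2) * y (k + 2))"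
  shows "(\<Sum>k. \<alpha> (k + 2 + j) * y (k + 2 + j)) \<le> (\<Sum>k. \<alpha> (k + 2) * y (k + 2))"
proof -
  have "(\<Sum>k. \<alpha> (k + j + 2) * y (k + j + 2)) \<le> (\<Sum>k. \<alpha> (k + 2) * y (k + 2))"
    using suminf_split_initial_segment[OF sm, of j] alpha_nonneg y
    by (simp add: sum_nonneg)
  then show ?thesis by (simp add: ac_simps)
qed

lemma restrict_split:
  fixes g :: "real^'n \<Rightarrow> complex"
  assumes Q: "Q \<in> cubes" and g: "Lploc p0 g" and E: "E \<in> sets lebesgue"
  shows "AE x in lebesgue. Aop B Q g x = Aop B Q (\<lambda>x. if x \<in> E then g x else 0) x + Aop B Q (\<lambda>x. if x \<in> E then 0 else g x) x"
proof -
  have "(\<lambda>x. (if x \<in> E then g x else 0) + (if x \<in> E then 0 else g x)) = g" by auto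
  then show ?thesis using Aop_add[OF Q Lploc_restrict[OF g _ E]] p0 by simp
qed

text \<open>The part of \<open>g\<close> inside 4Q takes the coefficient \<open>\<alpha> 2\<close>,
  the part outside (with j = 1) takes \<open>\<alpha> 3\<close> and all later ones; together they
  form the full series.\<close>

lemma Aop_local:
  assumes Q: "Q \<in> cubes" and g: "Lploc p0 g"
    and y: "\<And>k. k \<ge> 2 \<Longrightarrow> 0 \<le> y k" "\<And>k. k \<ge> 2 \<Longrightarrow> avgLp p0 (cube_set (dil (2 ^ k) Q)) g \<le> ennreal (y k)"
    and sm: "summable (\<lambda>k. \<alpha> (k + 2) * y (k + 2))"
  shows "avgq q0 (cube_set (dil 2 Q)) (Aop B Q g) \<le> ennreal (4 * (\<Sum>k. \<alpha> (k + 2) * y (k + 2)))"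
proof -
  let ?E = "cube_set (dil 4 Q)"
  let ?g1 = "\<lambda>x. if x \<in> ?E then g x else 0" and ?g2 = "\<lambda>x. if x \<in> ?E then 0 else g x"
  have L: "Lploc p0 ?g1" "Lploc p0 ?g2" using Lploc_restrict[OF g, of ?E] p0 by auto
  have "avgq q0 (cube_set (dil 2 Q)) (Aop B Q ?g1) \<le> ennreal (\<alpha> 2) * avgLp p0 ?E g"
    using O Q g unfolding O_class_def by blast
  also have "\<dots> \<le> ennreal (\<alpha> 2) * ennreal (y 2)"
    using y(2)[of 2] by (intro mult_left_mono) auto
  also have "\<dots> = ennreal (\<alpha> 2 * y 2)" using alpha_nonneg y by (simp add: ennreal_mult)
  finally have 1: "avgq q0 (cube_set (dil 2 Q)) (Aop B Q ?g1) \<le> ennreal (\<alpha> 2 * y 2)" .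
  have 2: "avgq q0 (cube_set (dil 2 Q)) (Aop B Q ?g2) \<le> ennreal (\<Sum>k. \<alpha> (k + 2 + 1) * y (k + 2 + 1))"
    using Aop_far[OF Q g _ y sm, of 1] by simp
  have n: "0 \<le> \<alpha> 2 * y 2" "0 \<le> (\<Sum>k. \<alpha> (k + 2 + 1) * y (k + 2 + 1))"
    using alpha_nonneg y summable_ignore_initial_segment[OF sm, of 1] by (auto intro!: suminf_nonneg mult_nonneg_nonneg simp: ac_simps)
  have "avgq q0 (cube_set (dil 2 Q)) (\<lambda>x. Aop B Q ?g1 x + Aop B Q ?g2 x) \<le> ennreal (4 * (\<alpha> 2 * y 2 + (\<Sum>k. \<alpha> (k + 2 + 1) * y (k + 2 + 1))))"
    by (rule avgq_add[OF _ q0_ge_1 n _ _ 1 2]) (use Q L in \<open>auto intro!: Lploc_measurable[of p0]\<close>)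
  moreover have "avgq q0 (cube_set (dil 2 Q)) (Aop B Q g) = avgq q0 (cube_set (dil 2 Q)) (\<lambda>x. Aop B Q ?g1 x + Aop B Q ?g2 x)"
    by (rule avgq_cong_AE) (use restrict_split[OF Q g, of ?E] in \<open>auto elim!: eventually_mono\<close>)
  moreover have "\<alpha> 2 * y 2 + (\<Sum>k. \<alpha> (k + 2 + 1) * y (k + 2 + 1)) = (\<Sum>k. \<alpha> (k + 2) * y (k + 2))"
    using suminf_split_head[OF sm] by (simp add: ac_simps numeral_eq_Suc)
  ultimately show ?thesis by (simp only:)
qed

text \<open>The global bound (b) applied to a function supported in 2R; the passage from 2R to R
  costs a volume factor. The maximum with 0 matches \<open>ennreal\<close>, which sends negative
  reals to 0.\<close>

lemma B_near:
  assumes Q: "Q \<in> cubes" and R: "R \<in> cubes" and g: "Lploc p0 g" and y: "0 \<le> y"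
    and le: "avgLp p0 (cube_set (dil 2 R)) g \<le> ennreal y"
  shows "avgLp p0 (cube_set R) (B Q (\<lambda>x. if x \<in> cube_set (dil 2 R) then g x else 0)) \<le> ennreal (max Cp0 0 * 2 ^ CARD('n) * y)"
proof -
  let ?g = "\<lambda>x. if x \<in> cube_set (dil 2 R) then g x else 0"
  define M where "M = snd R ^ CARD('n)"
  have M: "M > 0" "emeasure lebesgue (cube_set R) = ennreal M"
    using R by (simp add: M_def cubes_def, simp add: M_def emeasure_cube_set)
  define T where "T = y * (2 ^ CARD('n) * M) powr (1 / p0)"
  have T: "T \<ge> 0" "T powr p0 = y powr p0 * (2 ^ CARD('n) * M)"
    using y M p0 by (auto simp: T_def powr_mult powr_powr)
  define C where "C = max Cp0 0"
  have C: "C \<ge> 0" "ennreal C = ennreal Cp0" by (auto simp: C_def max_def ennreal_neg)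
  have "(\<integral>\<^sup>+x. ennreal (norm (?g x) powr p0) \<partial>lebesgue) = (\<integral>\<^sup>+x\<in>cube_set (dil 2 R). ennreal (norm (g x) powr p0) \<partial>lebesgue)"
    using p0 by (intro nn_integral_cong) (auto simp: indicator_def)
  also have "\<dots> \<le> ennreal (y powr p0) * emeasure lebesgue (cube_set (dil 2 R))"
    using le y p0 R by (subst (asm) avgLp_le_iff) auto
  also have "\<dots> = ennreal (T powr p0)"
    using R M unfolding T(2) by (simp add: emeasure_cube_set power_mult_distrib M_def ennreal_mult[symmetric])
  finally have "Lpnorm p0 ?g \<le> ennreal T"
    unfolding Lpnorm_def using T(1) p0 by (subst enn_powr_le_iff) auto
  then have "ennreal Cp0 * Lpnorm p0 ?g \<le> ennreal (C * T)"
    using C T by (simp add: ennreal_mult mult_left_mono flip: C(2))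
  moreover have "Lpnorm p0 (B Q ?g) \<le> ennreal Cp0 * Lpnorm p0 ?g"
    using O Q Lploc_restrict[OF g, of "cube_set (dil 2 R)"] p0 unfolding O_class_def by auto
  ultimately have "Lpnorm p0 (B Q ?g) \<le> ennreal (C * T)" by simp
  then have I: "(\<integral>\<^sup>+x. ennreal (norm (B Q ?g x) powr p0) \<partial>lebesgue) \<le> ennreal ((C * T) powr p0)"
    unfolding Lpnorm_def using C T p0 by (subst (asm) enn_powr_le_iff) auto
  have "(\<integral>\<^sup>+x\<in>cube_set R. ennreal (norm (B Q ?g x) powr p0) \<partial>lebesgue) \<le> (\<integral>\<^sup>+x. ennreal (norm (B Q ?g x) powr p0) \<partial>lebesgue)"
    by (intro nn_integral_mono) (auto simp: indicator_def)
  also note I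
  also have "ennreal ((C * T) powr p0) \<le> ennreal ((C * 2 ^ CARD('n) * y) powr p0) * emeasure lebesgue (cube_set R)"
  proof -
    have "(2::real) ^ CARD('n) \<le> (2 ^ CARD('n)) powr p0"
      using p0 powr_mono[of 1 p0 "2 ^ CARD('n) :: real"] by simp
    then have "C powr p0 * (y powr p0 * (2 ^ CARD('n) * M)) \<le> C powr p0 * (y powr p0 * ((2 ^ CARD('n)) powr p0 * M))"
      using M by (intro mult_left_mono mult_right_mono) auto
    then have "(C * T) powr p0 \<le> (C * 2 ^ CARD('n) * y) powr p0 * M"
      using C T y by (simp add: powr_mult ac_simps)
    then show ?thesis using M by (simp add: ennreal_mult[symmetric] ennreal_leI)
  qed
  finally show ?thesis unfolding C_def[symmetric] using p0 C y by (subst avgLp_le_iff[OF R]) auto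
qed

text \<open>The constant of \<open>Aop_average\<close>, with 16 = 4 * 4 from two additions for the
  near part and 8 = 4 * 2 from one addition and the passage from \<open>q0\<close> to
  \<open>p0\<close> for the far part.\<close>

definition KA :: real where
  "KA = 16 * (1 + max Cp0 0) * 2 ^ CARD('n) + 8 * 2 ^ CARD('n)"

lemma KA_pos: "KA > 0"
  by (simp add: KA_def add_pos_nonneg)

text \<open>\<open>Aop_local\<close> reaches only 2Q, whereas averages of B_R F over all dilates of
  R are required later. In the exponent \<open>p0\<close> this is possible: inside the next dilate
  B_Q is bounded on L^p0, outside the off-diagonal tail applies.\<close>

lemma Aop_average:
  assumes Q: "Q \<in> cubes" and g: "Lploc p0 g" and j: "j \<ge> 1"
    and u: "\<And>k. k \<ge> 1 \<Longrightarrow> 0 \<le> u k" "\<And>k. k \<ge> 1 \<Longrightarrow> avgLp p0 (cube_set (dil (2 ^ (k + 1)) Q)) g \<le> ennreal (u k)"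
    and y: "\<And>k. k \<ge> 1 \<Longrightarrow> avgLp p0 (cube_set (dil (2 ^ k) Q)) g \<le> ennreal (2 ^ CARD('n) * u k)"
    and sm: "summable (\<lambda>k. \<alpha> (k + 2) * u (k + 2))"
  shows "avgLp p0 (cube_set (dil (2 ^ j) Q)) (Aop B Q g) \<le> ennreal (KA * (u j + (\<Sum>k. \<alpha> (k + 2) * u (k + 2))))"
proof -
  define N where "N = (2::real) ^ CARD('n)"
  have N: "N \<ge> 1" by (simp add: N_def)
  define C where "C = max Cp0 0"
  have C: "C \<ge> 0" by (simp add: C_def)
  define \<Lambda> where "\<Lambda> = (\<Sum>k. \<alpha> (k + 2) * u (k + 2))"
  have Lam: "\<Lambda> \<ge> 0" unfolding \<Lambda>_def using sm alpha_nonneg u by (intro suminf_nonneg) auto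
  have uj: "u j \<ge> 0" using u j by simp
  let ?R = "dil (2 ^ j) Q"
  have R: "?R \<in> cubes" using Q by simp
  have R2: "dil 2 ?R = dil (2 ^ (j + 1)) Q" by (simp add: dil_dil)
  let ?E = "cube_set (dil (2 ^ (j + 1)) Q)"
  let ?g1 = "\<lambda>x. if x \<in> ?E then g x else 0" and ?g2 = "\<lambda>x. if x \<in> ?E then 0 else g x"
  have L: "Lploc p0 ?g1" "Lploc p0 ?g2" using Lploc_restrict[OF g, of ?E] p0 by auto
  have b1: "avgLp p0 (cube_set ?R) (B Q ?g1) \<le> ennreal (C * N * u j)"
    using B_near[OF Q R g uj] u(2)[OF j] unfolding R2 C_def N_def by simp
  have g1: "avgLp p0 (cube_set ?R) ?g1 \<le> ennreal (N * u j)"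
  proof -
    have "subcube ?R (dil (2 ^ (j + 1)) Q)" using Q by (intro subcube_dil_dil) auto
    then have sub: "cube_set ?R \<subseteq> ?E" by (rule subcube_imp_subset)
    have "avgLp p0 (cube_set ?R) ?g1 = avgLp p0 (cube_set ?R) g"
      by (rule avgLp_cong_AE) (use sub in auto)
    then show ?thesis using y[OF j] unfolding N_def by simp
  qed
  have m1: "avgLp p0 (cube_set ?R) (\<lambda>x. - B Q ?g1 x) \<le> ennreal (C * N * u j)"
    using b1 avgLp_cong_AE[of "cube_set ?R" "\<lambda>x. - B Q ?g1 x" "B Q ?g1" p0] by simp
  have "avgLp p0 (cube_set ?R) (\<lambda>x. ?g1 x + (- B Q ?g1 x)) \<le> ennreal (4 * (N * u j + C * N * u j))"
    by (rule avgLp_add[OF R p0 _ _ _ _ g1 m1]) 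
      (use N C uj Lploc_measurable[OF L(1)] Lploc_measurable[OF B_Lploc[OF Q L(1)]] in auto)
  then have 1: "avgLp p0 (cube_set ?R) (Aop B Q ?g1) \<le> ennreal (4 * (N * u j + C * N * u j))"
    unfolding Aop_def by simp
  have sm': "summable (\<lambda>k. \<alpha> (k + 2) * (N * u (k + 2)))"
    using summable_mult[OF sm, of N] by (simp add: ac_simps)
  have "avgq q0 (cube_set ?R) (Aop B Q ?g2) \<le> ennreal (\<Sum>k. \<alpha> (k + 2 + j) * (N * u (k + 2 + j)))"
    by (rule Aop_far[OF Q g j _ _ sm']) (use N u y in \<open>auto simp: N_def\<close>)
  also have "\<dots> \<le> ennreal (\<Sum>k. \<alpha> (k + 2) * (N * u (k + 2)))"
    by (intro ennreal_leI tail_suminf_le[of "\<lambda>k. N * u k"] sm') (use N u in auto)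
  also have "(\<Sum>k. \<alpha> (k + 2) * (N * u (k + 2))) = N * \<Lambda>"
    unfolding \<Lambda>_def using suminf_mult[OF sm, of N] by (simp add: ac_simps)
  finally have "avgq q0 (cube_set ?R) (Aop B Q ?g2) \<le> ennreal (N * \<Lambda>)" .
  then have 2: "avgLp p0 (cube_set ?R) (Aop B Q ?g2) \<le> ennreal (2 * (N * \<Lambda>))"
    using R p0 q0 N Lam Q L by (intro avgLp_le_avgq[where q = q0] Lploc_measurable[of p0] Aop_Lploc) auto
  have "avgLp p0 (cube_set ?R) (\<lambda>x. Aop B Q ?g1 x + Aop B Q ?g2 x) \<le> ennreal (4 * (4 * (N * u j + C * N * u j) + 2 * (N * \<Lambda>)))"
    by (rule avgLp_add[OF R p0 _ _ _ _ 1 2])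
      (use N C uj Lam Lploc_measurable[OF Aop_Lploc[OF Q L(1)]] Lploc_measurable[OF Aop_Lploc[OF Q L(2)]] in auto)
  moreover have "avgLp p0 (cube_set ?R) (Aop B Q g) = avgLp p0 (cube_set ?R) (\<lambda>x. Aop B Q ?g1 x + Aop B Q ?g2 x)"
    by (rule avgLp_cong_AE) (use restrict_split[OF Q g, of ?E] in \<open>auto elim!: eventually_mono\<close>)
  moreover have "4 * (4 * (N * u j + C * N * u j) + 2 * (N * \<Lambda>)) \<le> KA * (u j + \<Lambda>)"
  proof -
    have "KA * (u j + \<Lambda>) = 16 * (1 + C) * N * u j + 8 * N * \<Lambda> + (8 * N * u j + 16 * (1 + C) * N * \<Lambda>)"
      unfolding KA_def N_def[symmetric] C_def[symmetric] by (simp add: algebra_simps)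
    moreover have "0 \<le> 8 * N * u j + 16 * (1 + C) * N * \<Lambda>" using N C uj Lam by simp
    ultimately show ?thesis by (simp add: algebra_simps)
  qed
  ultimately show ?thesis unfolding \<Lambda>_def[symmetric] by (auto intro: order_trans ennreal_leI)
qed

end

text \<open>The shift \<open>i\<close> aligns indices: \<open>c k\<close> multiplies
  \<open>a\<close> at the dilate of order k + i + 1 and is compared with \<open>\<gamma>\<close> at
  the same index.\<close>

lemma atilde_dominates:
  assumes a: "functional a" and Q: "Q \<in> cubes" and \<gamma>: "\<And>k. k \<ge> 1 \<Longrightarrow> 0 \<le> \<gamma> k"
    and sm: "summable (\<lambda>k. \<gamma> (k + 1) * a (dil (2 ^ (k + 1)) Q))"
    and c: "\<And>k. 0 \<le> c k" "\<And>k. c k \<le> M * \<gamma> (k + i + 1)" and M: "0 \<le> M"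
  shows "summable (\<lambda>k. c k * a (dil (2 ^ (k + i + 1)) Q))"
    and "(\<Sum>k. c k * a (dil (2 ^ (k + i + 1)) Q)) \<le> M * atilde \<gamma> a Q"
proof -
  have a0: "0 \<le> a (dil (2 ^ k) Q)" for k using a Q by (simp add: functional_def)
  let ?b = "\<lambda>k. \<gamma> (k + 1) * a (dil (2 ^ (k + 1)) Q)"
  have b0: "0 \<le> ?b k" for k by (rule mult_nonneg_nonneg[OF \<gamma> a0]) simp
  have smi: "summable (\<lambda>k. M * ?b (k + i))" using summable_ignore_initial_segment[OF sm, of i] by (rule summable_mult)
  have le: "c k * a (dil (2 ^ (k + i + 1)) Q) \<le> M * ?b (k + i)" for k
    using mult_right_mono[OF c(2)[of k] a0[of "k + i + 1"]] by (simp only: mult.assoc)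
  show sm1: "summable (\<lambda>k. c k * a (dil (2 ^ (k + i + 1)) Q))"
  proof (rule summable_comparison_test'[OF smi])
    fix k
    have "0 \<le> c k * a (dil (2 ^ (k + i + 1)) Q)" by (rule mult_nonneg_nonneg[OF c(1) a0])
    then show "norm (c k * a (dil (2 ^ (k + i + 1)) Q)) \<le> M * ?b (k + i)"
      using le[of k] by (simp only: real_norm_def abs_of_nonneg)
  qed
  have "(\<Sum>k. c k * a (dil (2 ^ (k + i + 1)) Q)) \<le> (\<Sum>k. M * ?b (k + i))"
    by (rule suminf_le[OF le sm1 smi])
  also have "\<dots> = M * (\<Sum>k. ?b (k + i))"
    by (rule suminf_mult[OF summable_ignore_initial_segment[OF sm]])
  also have "\<dots> \<le> M * (\<Sum>k. ?b k)"
  proof (intro mult_left_mono M)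
    have "(\<Sum>k<i. ?b k) \<ge> 0" by (intro sum_nonneg b0)
    then show "(\<Sum>k. ?b (k + i)) \<le> (\<Sum>k. ?b k)" using suminf_split_initial_segment[OF sm, of i] by linarith
  qed
  finally show "(\<Sum>k. c k * a (dil (2 ^ (k + i + 1)) Q)) \<le> M * atilde \<gamma> a Q" by (simp add: atilde_def)
qed

lemma atilde_first:
  assumes a: "functional a" and Q: "Q \<in> cubes" and \<gamma>: "\<And>k. k \<ge> 1 \<Longrightarrow> 0 \<le> \<gamma> k" "1 \<le> \<gamma> 1"
    and sm: "summable (\<lambda>k. \<gamma> (k + 1) * a (dil (2 ^ (k + 1)) Q))"
  shows "a (dil 2 Q) \<le> atilde \<gamma> a Q" "0 \<le> atilde \<gamma> a Q"
proof -
  have a0: "0 \<le> a (dil (2 ^ k) Q)" for k using a Q by (simp add: functional_def)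
  have b0: "0 \<le> \<gamma> (k + 1) * a (dil (2 ^ (k + 1)) Q)" for k by (rule mult_nonneg_nonneg[OF \<gamma>(1) a0]) simp
  have "a (dil 2 Q) \<le> \<gamma> (0 + 1) * a (dil (2 ^ (0 + 1)) Q)" using \<gamma>(2) a0[of 1] by (simp add: mult_le_cancel_right1)
  also have "\<dots> = (\<Sum>k<1. \<gamma> (k + 1) * a (dil (2 ^ (k + 1)) Q))" by simp
  also have "\<dots> \<le> atilde \<gamma> a Q" unfolding atilde_def by (rule sum_le_suminf[OF sm]) (use b0 in auto)
  finally show "a (dil 2 Q) \<le> atilde \<gamma> a Q" .
  then show "0 \<le> atilde \<gamma> a Q" using a0[of 1] by simp
qed

lemma avgLp_uminus: "avgLp p E (\<lambda>x. - f x) = avgLp p E f"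
  by (rule avgLp_cong_AE) simp

lemma avgLp_diff:
  fixes f g :: "(real^('n::finite)) \<Rightarrow> complex"
  assumes Q: "Q \<in> cubes" and p: "p \<ge> 1" and S: "S \<ge> 0" and T: "T \<ge> 0"
    and m: "f \<in> borel_measurable lebesgue" "g \<in> borel_measurable lebesgue"
    and le: "avgLp p (cube_set Q) f \<le> ennreal S" "avgLp p (cube_set Q) g \<le> ennreal T"
  shows "avgLp p (cube_set Q) (\<lambda>x. f x - g x) \<le> ennreal (4 * (S + T))"
proof -
  have "avgLp p (cube_set Q) (\<lambda>x. f x + - g x) \<le> ennreal (4 * (S + T))"
    by (rule avgLp_add[OF Q p S T]) (use m le in \<open>simp_all add: avgLp_uminus\<close>)
  then show ?thesis by simp
qed

section \<open>Decomposition of F on a single maximal cube\<close>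

context oscillation_family
begin

lemma gamma_bounds:
  assumes \<gamma>: "\<And>k. k \<ge> 1 \<Longrightarrow> mk CARD('n) p0 \<alpha> \<beta> k \<le> \<gamma> k"
  shows "1 \<le> \<gamma> 1"
    and "k \<ge> 1 \<Longrightarrow> 0 \<le> \<gamma> k"
    and "k \<ge> 2 \<Longrightarrow> \<alpha> k \<le> \<gamma> k"
    and "k \<ge> 2 \<Longrightarrow> \<alpha> k * 2 powr (real k * real CARD('n) / p0) \<le> 2 ^ (4 * CARD('n)) * \<gamma> k"
    and "k \<ge> 2 \<Longrightarrow> \<beta> k \<le> \<gamma> (k + 2)"
proof -
  have mk: "k \<ge> 1 \<Longrightarrow> 0 \<le> mk CARD('n) p0 \<alpha> \<beta> k" "k \<ge> 2 \<Longrightarrow> \<alpha> k \<le> mk CARD('n) p0 \<alpha> \<beta> k"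
    "k \<ge> 2 \<Longrightarrow> \<alpha> k * 2 powr (real k * real CARD('n) / p0) \<le> 2 ^ (4 * CARD('n)) * mk CARD('n) p0 \<alpha> \<beta> k"
    "k \<ge> 2 \<Longrightarrow> \<beta> k \<le> mk CARD('n) p0 \<alpha> \<beta> (k + 2)"
    using mk_nonneg_ge[where \<alpha> = \<alpha> and \<beta> = \<beta> and p = p0 and n = "CARD('n)" and k = k] alpha_nonneg beta_nonneg p0
    by blast+
  show "1 \<le> \<gamma> 1" using \<gamma>[of 1] by (simp add: mk_def)
  show "k \<ge> 1 \<Longrightarrow> 0 \<le> \<gamma> k" using mk(1) \<gamma>[of k] by (simp add: order_trans)
  show "k \<ge> 2 \<Longrightarrow> \<alpha> k \<le> \<gamma> k" using mk(2) \<gamma>[of k] by (simp add: order_trans)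
  show "\<alpha> k * 2 powr (real k * real CARD('n) / p0) \<le> 2 ^ (4 * CARD('n)) * \<gamma> k" if "k \<ge> 2"
  proof (rule order_trans[OF mk(3)[OF that]])
    show "2 ^ (4 * CARD('n)) * mk CARD('n) p0 \<alpha> \<beta> k \<le> 2 ^ (4 * CARD('n)) * \<gamma> k"
      using \<gamma>[of k] that by (intro mult_left_mono) auto
  qed
  show "\<beta> k \<le> \<gamma> (k + 2)" if "k \<ge> 2"
    by (rule order_trans[OF mk(4)[OF that] \<gamma>]) simp
qed

text \<open>Write B_R g = g - A_R g with g = B_R f, whose averages over the dilates of R are bounded
  by \<open>a\<close>. The number 36 is 4 * (1 + 2 * 4): a 4 from \<open>Aop_local\<close>, a 2 from
  the passage to \<open>p0\<close>, a 4 from the subtraction.\<close>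

lemma square_average:
  assumes R: "R \<in> cubes" and f: "Lploc p0 f" and a: "functional a"
    and osc: "\<And>k::nat. avgLp p0 (cube_set (dil (2 ^ k) R)) (B R f) \<le> ennreal (a (dil (2 ^ k) R))"
    and \<gamma>: "\<And>k. k \<ge> 1 \<Longrightarrow> mk CARD('n) p0 \<alpha> \<beta> k \<le> \<gamma> k"
    and sm: "summable (\<lambda>k. \<gamma> (k + 1) * a (dil (2 ^ (k + 1)) R))"
  shows "avgLp p0 (cube_set (dil 2 R)) (B R (B R f)) \<le> ennreal (36 * atilde \<gamma> a R)"
proof -
  note g1 = gamma_bounds(1)[of \<gamma>, OF \<gamma>] and g0 = gamma_bounds(2)[of \<gamma>, OF \<gamma>]
    and ga = gamma_bounds(3)[of \<gamma>, OF \<gamma>] and gb = gamma_bounds(5)[of \<gamma>, OF \<gamma>]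
  have a0: "0 \<le> a (dil (2 ^ k) R)" for k using a R by (simp add: functional_def)
  have dom: "summable (\<lambda>k. \<alpha> (k + 2) * a (dil (2 ^ (k + 2)) R))"
    "(\<Sum>k. \<alpha> (k + 2) * a (dil (2 ^ (k + 2)) R)) \<le> 1 * atilde \<gamma> a R"
    using atilde_dominates[OF a R g0 sm, of "\<lambda>k. \<alpha> (k + 2)" 1 1] alpha_nonneg ga by (simp_all add: numeral_eq_Suc)
  define A where "A = atilde \<gamma> a R"
  have A: "a (dil 2 R) \<le> A" "0 \<le> A" unfolding A_def using atilde_first[OF a R g0 g1 sm] by auto
  let ?g = "B R f"
  have g: "Lploc p0 ?g" using R f by simp
  have "avgq q0 (cube_set (dil 2 R)) (Aop B R ?g) \<le> ennreal (4 * (\<Sum>k. \<alpha> (k + 2) * a (dil (2 ^ (k + 2)) R)))"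
    by (rule Aop_local[OF R g _ osc dom(1)]) (use a0 in auto)
  also have "\<dots> \<le> ennreal (4 * A)" using dom(2) by (intro ennreal_leI) (simp add: A_def)
  finally have "avgLp p0 (cube_set (dil 2 R)) (Aop B R ?g) \<le> ennreal (2 * (4 * A))"
    using R p0 q0 A by (intro avgLp_le_avgq[where q = q0] Lploc_measurable[of p0] Aop_Lploc g) auto
  moreover have "avgLp p0 (cube_set (dil 2 R)) ?g \<le> ennreal A"
    using osc[of 1] ennreal_leI[OF A(1)] by simp
  ultimately have "avgLp p0 (cube_set (dil 2 R)) (\<lambda>x. ?g x - Aop B R ?g x) \<le> ennreal (4 * (A + 2 * (4 * A)))"
    using R p0 A g by (intro avgLp_diff Lploc_measurable[of p0] Aop_Lploc) auto
  then show ?thesis by (simp add: Aop_def A_def)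
qed

definition SA :: real where "SA = (\<Sum>k. \<alpha> (k + 2))"

lemma SA_nonneg: "0 \<le> SA"
  unfolding SA_def using alpha_summable alpha_nonneg by (intro suminf_nonneg) auto

text \<open>The sum of the coefficients of the two quantities, the series in \<open>u\<close> and
  the value of \<open>atilde\<close>, in the final bound for G.\<close>

definition KG :: real where
  "KG = 16 * (4 * 2 ^ CARD('n) + 16 * (2 ^ CARD('n) + KA) + 16 * KA * SA) + 4 * 4 ^ CARD('n)"

lemma KG_pos: "KG > 0"
  using KA_pos SA_nonneg by (simp add: KG_def add_nonneg_pos add_pos_nonneg)

text \<open>The three terms of G draw on different data: A_R F on the majorants \<open>u\<close> of
  F, A_R B_R F on majorants of B_R F derived from \<open>u\<close>, and the last term on the
  averages of B_R f alone. The number \<open>j\<close> counts the generations from Q to R, so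
  \<open>dil (2 ^ j) R\<close> has the size of Q.\<close>

lemma local_decomposition:
  assumes Q: "Q \<in> cubes" and R: "R \<in> cubes" and RQ: "subcube R Q" and j: "snd Q = 2 ^ j * snd R"
    and f: "Lploc p0 f" and a: "functional a"
    and osc: "\<And>k::nat. avgLp p0 (cube_set (dil (2 ^ k) R)) (B R f) \<le> ennreal (a (dil (2 ^ k) R))"
    and \<gamma>: "\<And>k. k \<ge> 1 \<Longrightarrow> mk CARD('n) p0 \<alpha> \<beta> k \<le> \<gamma> k"
    and sm: "\<And>Q. Q \<in> cubes \<Longrightarrow> summable (\<lambda>k. \<gamma> (k + 1) * a (dil (2 ^ (k + 1)) Q))"
    and u: "\<And>k. k \<ge> 1 \<Longrightarrow> 0 \<le> u k" "\<And>k. k \<ge> 1 \<Longrightarrow> avgLp p0 (cube_set (dil (2 ^ (k + 1)) R)) (B Q f) \<le> ennreal (u k)"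
    and smu: "summable (\<lambda>k. \<alpha> (k + 2) * u (k + 2))"
  shows "decomposable p0 q0 (B Q f) R (36 * atilde \<gamma> a R)
     (KG * ((\<Sum>k. \<alpha> (k + 2) * u (k + 2)) + atilde \<gamma> a (dil (2 ^ j) R)))"
proof -
  note g1 = gamma_bounds(1)[of \<gamma>, OF \<gamma>] and g0 = gamma_bounds(2)[of \<gamma>, OF \<gamma>]
    and ga = gamma_bounds(3)[of \<gamma>, OF \<gamma>] and gb = gamma_bounds(5)[of \<gamma>, OF \<gamma>]
  define N where "N = (2::real) ^ CARD('n)"
  have N: "N \<ge> 1" by (simp add: N_def)
  define \<Lambda> where "\<Lambda> = (\<Sum>k. \<alpha> (k + 2) * u (k + 2))"
  have Lam: "\<Lambda> \<ge> 0" unfolding \<Lambda>_def using smu alpha_nonneg u by (intro suminf_nonneg) auto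
  define F where "F = B Q f"
  define g where "g = B R f"
  have F: "Lploc p0 F" and g: "Lploc p0 g" using Q R f by (simp_all add: F_def g_def)
  have BF: "Lploc p0 (B R F)" and AF: "Lploc p0 (Aop B R F)" using R F by simp_all
  have y: "avgLp p0 (cube_set (dil (2 ^ k) R)) F \<le> ennreal (N * u k)" if k: "k \<ge> 1" for k
  proof -
    have "avgLp p0 (cube_set (dil (2 ^ k) R)) F \<le> ennreal (2 ^ CARD('n) * u k)"
    proof (rule avgLp_mono_set_2)
      show "cube_set (dil (2 ^ k) R) \<subseteq> cube_set (dil (2 ^ (k + 1)) R)"
        using R by (intro subcube_imp_subset subcube_dil_dil power_increasing) auto
      show "avgLp p0 (cube_set (dil (2 ^ (k + 1)) R)) F \<le> ennreal (u k)" unfolding F_def by (rule u(2)[OF k])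
    qed (use R p0 u k in auto)
    then show ?thesis by (simp add: N_def)
  qed
  have u': "avgLp p0 (cube_set (dil (2 ^ (k + 1)) R)) F \<le> ennreal (u k)" if "k \<ge> 1" for k
    unfolding F_def using u(2) that by blast
  have smN: "summable (\<lambda>k. \<alpha> (k + 2) * (N * u (k + 2)))" and sumN: "(\<Sum>k. \<alpha> (k + 2) * (N * u (k + 2))) = N * \<Lambda>"
    using summable_mult[OF smu, of N] suminf_mult[OF smu, of N] by (simp_all add: ac_simps \<Lambda>_def)
  have G1: "avgq q0 (cube_set (dil 2 R)) (Aop B R F) \<le> ennreal (4 * (N * \<Lambda>))"
    using Aop_local[OF R F _ _ smN] N u y unfolding sumN by simp
  \<comment> \<open>Majorants for B_R F = F - A_R F over the dilates of R, with
    \<open>Aop_average\<close> for the second term.\<close>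
  define z where "z k = 4 * (N * u k + KA * (u k + \<Lambda>))" for k
  have z0: "0 \<le> z k" if "k \<ge> 1" for k
    using N u that KA_pos Lam by (simp add: z_def)
  have zle: "avgLp p0 (cube_set (dil (2 ^ k) R)) (B R F) \<le> ennreal (z k)" if k: "k \<ge> 1" for k
  proof -
    have "avgLp p0 (cube_set (dil (2 ^ k) R)) (Aop B R F) \<le> ennreal (KA * (u k + (\<Sum>k. \<alpha> (k + 2) * u (k + 2))))"
      by (rule Aop_average[OF R F k u(1) u' _ smu]) (use y in \<open>simp_all add: N_def\<close>)
    then have "avgLp p0 (cube_set (dil (2 ^ k) R)) (\<lambda>x. F x - Aop B R F x) \<le> ennreal (z k)"
      unfolding z_def \<Lambda>_def[symmetric] using R p0 N u k KA_pos Lam F y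
      by (intro avgLp_diff Lploc_measurable[of p0] Aop_Lploc) auto
    then show ?thesis by (simp add: Aop_def)
  qed
  have zeq: "\<alpha> (k + 2) * z (k + 2) = 4 * (N + KA) * (\<alpha> (k + 2) * u (k + 2)) + 4 * KA * \<Lambda> * \<alpha> (k + 2)" for k
    by (simp add: z_def algebra_simps)
  have smz: "summable (\<lambda>k. \<alpha> (k + 2) * z (k + 2))"
    unfolding zeq by (intro summable_add summable_mult smu alpha_summable)
  have sumz: "(\<Sum>k. \<alpha> (k + 2) * z (k + 2)) = 4 * (N + KA) * \<Lambda> + 4 * KA * \<Lambda> * SA"
  proof -
    have "(\<Sum>k. \<alpha> (k + 2) * z (k + 2)) = (\<Sum>k. 4 * (N + KA) * (\<alpha> (k + 2) * u (k + 2))) + (\<Sum>k. 4 * KA * \<Lambda> * \<alpha> (k + 2))"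
      unfolding zeq by (intro suminf_add[symmetric] summable_mult smu alpha_summable)
    also have "(\<Sum>k. 4 * (N + KA) * (\<alpha> (k + 2) * u (k + 2))) = 4 * (N + KA) * \<Lambda>"
      unfolding \<Lambda>_def by (rule suminf_mult[OF smu])
    also have "(\<Sum>k. 4 * KA * \<Lambda> * \<alpha> (k + 2)) = 4 * KA * \<Lambda> * SA"
      unfolding SA_def by (rule suminf_mult[OF alpha_summable])
    finally show ?thesis .
  qed
  define g2 where "g2 = 16 * (N + KA) * \<Lambda> + 16 * KA * \<Lambda> * SA"
  have g20: "g2 \<ge> 0" using N KA_pos Lam SA_nonneg by (simp add: g2_def)
  have "avgq q0 (cube_set (dil 2 R)) (Aop B R (B R F)) \<le> ennreal (4 * (\<Sum>k. \<alpha> (k + 2) * z (k + 2)))"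
    by (rule Aop_local[OF R BF z0 zle smz]) auto
  also have "4 * (\<Sum>k. \<alpha> (k + 2) * z (k + 2)) = g2" unfolding sumz g2_def by (simp add: algebra_simps)
  finally have G2: "avgq q0 (cube_set (dil 2 R)) (Aop B R (B R F)) \<le> ennreal g2" .
  let ?S' = "dil (2 ^ j) R"
  have S': "?S' \<in> cubes" using R by simp
  define A' where "A' = atilde \<gamma> a ?S'"
  have A': "A' \<ge> 0" unfolding A'_def using atilde_first[OF a S' g0 g1 sm[OF S']] by auto
  have a0: "0 \<le> a (dil (2 ^ k) ?S')" for k using a S' by (simp add: functional_def)
  \<comment> \<open>Condition (d) produces dilates of Q, the hypothesis on \<open>a\<close> concerns
    dilates of R. Enlarging by the factor 4 absorbs the different centres and raises the index from
    k + 2 to k + 4, so that \<open>\<beta> (k + 2)\<close> meets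
    \<open>\<gamma> (k + 4)\<close>.\<close>
  have big: "avgLp p0 (cube_set (dil (2 ^ (k + 2)) Q)) g \<le> ennreal (4 ^ CARD('n) * a (dil (2 ^ (k + 4)) ?S'))" for k
  proof (rule avgLp_mono_set_2)
    have r: "snd R > 0" using R by (simp add: cubes_def)
    define L where "L = snd Q"
    have L: "L > 0" using Q by (simp add: L_def cubes_def)
    define s where "s = (2::real) ^ (k + 2)"
    have s: "s \<ge> 1" unfolding s_def by (rule one_le_power) simp
    have sL: "s * L \<ge> L" using s L by simp
    have dd: "dil (2 ^ (k + 4)) ?S' = dil (4 * s * 2 ^ j) R" by (simp add: dil_dil s_def power_add ac_simps)
    show "cube_set (dil (2 ^ (k + 2)) Q) \<subseteq> cube_set (dil (2 ^ (k + 4)) ?S')"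
      unfolding dd s_def[symmetric]
    proof (rule dil_subset)
      fix i
      have i: "fst Q $ i \<le> fst R $ i" "fst R $ i + snd R \<le> fst Q $ i + L"
        using RQ by (auto simp: subcube_def L_def)
      have e: "(1 - 4 * s * 2 ^ j) * snd R / 2 = snd R / 2 - 2 * (s * L)" "(1 + 4 * s * 2 ^ j) * snd R / 2 = snd R / 2 + 2 * (s * L)"
        "(1 - s) * snd Q / 2 = L / 2 - s * L / 2" "(1 + s) * snd Q / 2 = L / 2 + s * L / 2"
        unfolding L_def j by (simp_all add: algebra_simps diff_divide_distrib add_divide_distrib)
      show "fst R $ i + (1 - 4 * s * 2 ^ j) * snd R / 2 \<le> fst Q $ i + (1 - s) * snd Q / 2"
        unfolding e using i sL L r by linarith
      show "fst Q $ i + (1 + s) * snd Q / 2 \<le> fst R $ i + (1 + 4 * s * 2 ^ j) * snd R / 2"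
        unfolding e using i sL L r by linarith
    qed
    show "snd (dil (2 ^ (k + 4)) ?S') \<le> 4 * snd (dil (2 ^ (k + 2)) Q)"
      by (simp add: j power_add)
    have "dil (2 ^ (k + 4)) ?S' = dil (2 ^ (k + 4 + j)) R" by (simp add: dil_dil power_add)
    then show "avgLp p0 (cube_set (dil (2 ^ (k + 4)) ?S')) g \<le> ennreal (a (dil (2 ^ (k + 4)) ?S'))"
      unfolding g_def using osc[of "k + 4 + j"] by simp
  qed (use Q R p0 a0 in auto)
  have domb: "summable (\<lambda>k. \<beta> (k + 2) * a (dil (2 ^ (k + 4)) ?S'))"
    "(\<Sum>k. \<beta> (k + 2) * a (dil (2 ^ (k + 4)) ?S')) \<le> 1 * A'"
  proof -
    have c0: "0 \<le> \<beta> (k + 2)" for k by (rule beta_nonneg) simp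
    have c: "\<beta> (k + 2) \<le> 1 * \<gamma> (k + 3 + 1)" for k
      using gb[of "k + 2"] by (simp add: numeral_eq_Suc)
    have "k + 3 + 1 = k + 4" for k :: nat by simp
    then show "summable (\<lambda>k. \<beta> (k + 2) * a (dil (2 ^ (k + 4)) ?S'))"
      "(\<Sum>k. \<beta> (k + 2) * a (dil (2 ^ (k + 4)) ?S')) \<le> 1 * A'"
      unfolding A'_def
      using atilde_dominates[where c = "\<lambda>k. \<beta> (k + 2)" and M = 1 and i = 3, OF a S' g0 sm[OF S'] c0 c] by (simp_all add: add.commute)
  qed
  have "avgq q0 (cube_set (dil 2 R)) (B R (Aop B Q g)) \<le> (\<Sum>k. ennreal (\<beta> (k + 2)) * avgLp p0 (cube_set (dil (2 ^ (k + 2)) Q)) g)"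
    using O Q R g subcube_imp_subset[OF RQ] unfolding O_class_def by blast
  also have "\<dots> \<le> ennreal (\<Sum>k. \<beta> (k + 2) * (4 ^ CARD('n) * a (dil (2 ^ (k + 4)) ?S')))"
  proof (rule weighted_suminf_le)
    show "summable (\<lambda>k. \<beta> (k + 2) * (4 ^ CARD('n) * a (dil (2 ^ (k + 4)) ?S')))"
      using summable_mult[OF domb(1), of "4 ^ CARD('n)"] by (simp add: ac_simps)
  qed (use big beta_nonneg a0 in auto)
  also have "(\<Sum>k. \<beta> (k + 2) * (4 ^ CARD('n) * a (dil (2 ^ (k + 4)) ?S'))) = 4 ^ CARD('n) * (\<Sum>k. \<beta> (k + 2) * a (dil (2 ^ (k + 4)) ?S'))"
    using suminf_mult[OF domb(1), of "4 ^ CARD('n)"] by (simp add: ac_simps)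
  also have "ennreal \<dots> \<le> ennreal (4 ^ CARD('n) * A')"
    using domb(2) by (intro ennreal_leI mult_left_mono) auto
  finally have G3: "avgq q0 (cube_set (dil 2 R)) (B R (Aop B Q g)) \<le> ennreal (4 ^ CARD('n) * A')" .
  have G3': "avgq q0 (cube_set (dil 2 R)) (\<lambda>x. - B R (Aop B Q g) x) \<le> ennreal (4 ^ CARD('n) * A')"
    using G3 avgq_cong_AE[of "cube_set (dil 2 R)" "\<lambda>x. - B R (Aop B Q g) x" "B R (Aop B Q g)" q0] by simp
  let ?H = "\<lambda>x. (Aop B R F x + Aop B R (B R F) x) + - B R (Aop B Q g) x"
  have meas: "Aop B R F \<in> borel_measurable lebesgue" "Aop B R (B R F) \<in> borel_measurable lebesgue" "B R (Aop B Q g) \<in> borel_measurable lebesgue"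
    using Q R F g by (auto intro!: Lploc_measurable[of p0])
  have R2: "dil 2 R \<in> cubes" using R by simp
  have H1: "avgq q0 (cube_set (dil 2 R)) (\<lambda>x. Aop B R F x + Aop B R (B R F) x) \<le> ennreal (4 * (4 * (N * \<Lambda>) + g2))"
    by (rule avgq_add[OF R2 q0_ge_1 _ g20 meas(1,2) G1 G2]) (use N Lam in simp)
  have "avgq q0 (cube_set (dil 2 R)) ?H \<le> ennreal (4 * (4 * (4 * (N * \<Lambda>) + g2) + 4 ^ CARD('n) * A'))"
    by (rule avgq_add[OF R2 q0_ge_1 _ _ _ _ H1 G3']) (use N Lam g20 A' meas in auto)
  also have "\<dots> \<le> ennreal (KG * (\<Lambda> + A'))"
  proof (rule ennreal_leI)
    have "KG * (\<Lambda> + A') = 4 * (4 * (4 * (N * \<Lambda>) + g2) + 4 ^ CARD('n) * A')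
       + (4 * 4 ^ CARD('n) * \<Lambda> + 16 * (4 * N + 16 * (N + KA) + 16 * KA * SA) * A')"
      unfolding KG_def N_def[symmetric] g2_def by (simp add: algebra_simps)
    moreover have "0 \<le> 4 * 4 ^ CARD('n) * \<Lambda> + 16 * (4 * N + 16 * (N + KA) + 16 * KA * SA) * A'"
      using N Lam A' KA_pos SA_nonneg by simp
    ultimately show "4 * (4 * (4 * (N * \<Lambda>) + g2) + 4 ^ CARD('n) * A') \<le> KG * (\<Lambda> + A')" by linarith
  qed
  finally have H: "avgq q0 (cube_set (dil 2 R)) ?H \<le> ennreal (KG * (\<Lambda> + A'))" .
  define S where "S = B R g"
  have S: "Lploc p0 S" using R g by (simp add: S_def)
  have comm: "AE x in lebesgue. B R F x = B Q g x" unfolding F_def g_def by (rule B_commute[OF R Q f])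
  have "AE x in lebesgue. B R (B R F) x = B R (B Q g) x"
    by (rule B_cong[OF R BF _ comm]) (use Q g in simp)
  moreover have "AE x in lebesgue. B R (\<lambda>y. g y - Aop B Q g y) x = B R g x - B R (Aop B Q g) x"
    by (rule B_diff[OF R g]) (use Q g in simp)
  moreover have "(\<lambda>y. g y - Aop B Q g y) = B Q g" by (simp add: Aop_def)
  ultimately have "AE x in lebesgue. B R (B R F) x = S x - B R (Aop B Q g) x"
    by (auto simp: S_def elim!: eventually_elim2)
  then have "AE x in lebesgue. F x - S x = ?H x"
    by eventually_elim (simp add: Aop_def)
  then have "avgq q0 (cube_set (dil 2 R)) (\<lambda>x. F x - S x) = avgq q0 (cube_set (dil 2 R)) ?H"
    by (intro avgq_cong_AE) (auto elim!: eventually_mono)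
  then have "avgq q0 (cube_set (dil 2 R)) (\<lambda>x. F x - S x) \<le> ennreal (KG * (\<Lambda> + A'))" using H by simp
  moreover have "avgLp p0 (cube_set (dil 2 R)) S \<le> ennreal (36 * atilde \<gamma> a R)"
    unfolding S_def g_def by (rule square_average[OF R f a osc \<gamma> sm[OF R]])
  \<comment> \<open>\<open>G\<close> is taken to be \<open>F - S\<close>, so that
    \<open>F = S + G\<close> holds at every point although the operator identities hold only almost
    everywhere.\<close>
  ultimately show ?thesis
    unfolding decomposable_def F_def[symmetric] \<Lambda>_def[symmetric] A'_def[symmetric]
    using Lploc_measurable[OF S] Lploc_measurable[OF Lploc_diff[OF F S]]
    by (intro exI[of _ S] exI[of _ "\<lambda>x. F x - S x"]) simp
qed

end

text \<open>If the dilate is no larger than Q, it lies in the double of an ancestor that was not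
  selected, and only a factor 2^n is lost against \<open>t\<close>. Otherwise
  \<open>j \<le> k\<close>, the dilate lies in the same dilate of Q, and the volume ratio 2^(jn)
  costs at most 2^(kn/p) in the average.\<close>

lemma stopping_averages:
  fixes F :: "real^('n::finite) \<Rightarrow> complex"
  assumes Q: "Q \<in> cubes" and x: "x \<in> cube_set Q" and p: "p \<ge> 1" and t: "t > 0" and k: "k \<ge> 1"
    and nh: "\<And>i. i < j \<Longrightarrow> \<not> high p F t (dy Q i x)"
    and b: "0 \<le> b" "avgLp p (cube_set (dil (2 ^ (k + 1)) Q)) F \<le> ennreal b"
  shows "avgLp p (cube_set (dil (2 ^ (k + 1)) (dy Q j x))) F \<le> ennreal (2 ^ CARD('n) * t + 2 powr (real k * real CARD('n) / p) * b)"
proof -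
  define R where "R = dy Q j x"
  have R: "R \<in> cubes" "subcube R Q" unfolding R_def using Q by simp (rule subcube_dy_Q[OF Q x])
  have r: "snd R > 0" "snd Q = 2 ^ j * snd R" using R by (simp_all add: cubes_def) (simp add: R_def)
  have "avgLp p (cube_set (dil (2 ^ (k + 1)) R)) F \<le> ennreal (2 ^ CARD('n) * t + 2 powr (real k * real CARD('n) / p) * b)"
  proof (cases "k + 1 \<le> j")
    case True
    \<comment> \<open>The ancestor whose side is that of the dilate of R; it is a proper ancestor of
      R, hence not high.\<close>
    define P where "P = dy Q (j - (k + 1)) x"
    have P: "P \<in> cubes" "subcube R P" using Q subcube_dy[OF Q, of "j - (k + 1)" j x] by (auto simp: P_def R_def)
    define s where "s = (2::real) ^ (k + 1)"
    have sP: "snd P = s * snd R"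
      using True by (simp add: P_def R_def s_def power_diff)
    have "avgLp p (cube_set (dil s R)) F \<le> ennreal (2 ^ CARD('n) * t)"
    proof (rule avgLp_mono_set_2)
      show "cube_set (dil s R) \<subseteq> cube_set (dil 2 P)"
      proof (rule dil_subset)
        fix i
        have i: "fst P $ i \<le> fst R $ i" "fst R $ i + snd R \<le> fst P $ i + s * snd R"
          using P(2) by (auto simp: subcube_def sP)
        have e: "(1 - s) * snd R / 2 = snd R / 2 - s * snd R / 2" "(1 + s) * snd R / 2 = snd R / 2 + s * snd R / 2"
          "(1 - 2) * snd P / 2 = - (s * snd R) / 2" "(1 + 2) * snd P / 2 = 3 * (s * snd R) / 2"
          unfolding sP by (simp_all add: algebra_simps diff_divide_distrib add_divide_distrib)
        show "fst P $ i + (1 - 2) * snd P / 2 \<le> fst R $ i + (1 - s) * snd R / 2"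
          unfolding e using i r(1) by linarith
        show "fst R $ i + (1 + s) * snd R / 2 \<le> fst P $ i + (1 + 2) * snd P / 2"
          unfolding e using i r(1) by linarith
      qed
      show "avgLp p (cube_set (dil 2 P)) F \<le> ennreal t"
        using nh[of "j - (k + 1)"] True by (simp add: high_def not_less P_def)
      show "snd (dil 2 P) \<le> 2 * snd (dil s R)" by (simp add: sP)
    qed (use R P p t in \<open>auto simp: s_def\<close>)
    also have "\<dots> \<le> ennreal (2 ^ CARD('n) * t + 2 powr (real k * real CARD('n) / p) * b)"
      using b by (intro ennreal_leI) simp
    finally show ?thesis by (simp add: s_def)
  next
    case False
    then have jk: "j \<le> k" by simp
    have "avgLp p (cube_set (dil (2 ^ (k + 1)) R)) F \<le> ennreal ((2 ^ j) powr (real CARD('n) / p) * b)"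
    proof (rule avgLp_mono_set)
      show "cube_set (dil (2 ^ (k + 1)) R) \<subseteq> cube_set (dil (2 ^ (k + 1)) Q)"
        by (intro subcube_imp_subset subcube_dil R(2) one_le_power) simp
      show "snd (dil (2 ^ (k + 1)) Q) \<le> 2 ^ j * snd (dil (2 ^ (k + 1)) R)" by (simp add: r(2))
    qed (use Q R p b in auto)
    also have "\<dots> \<le> ennreal (2 ^ CARD('n) * t + 2 powr (real k * real CARD('n) / p) * b)"
    proof (rule ennreal_leI)
      have "(2 ^ j) powr (real CARD('n) / p) = 2 powr (real j * (real CARD('n) / p))"
        by (simp add: powr_powr powr_realpow[symmetric])
      also have "\<dots> \<le> 2 powr (real k * real CARD('n) / p)"
        using jk p by (intro powr_mono) (auto simp: divide_right_mono mult_right_mono)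
      finally have "(2 ^ j) powr (real CARD('n) / p) * b \<le> 2 powr (real k * real CARD('n) / p) * b"
        using b(1) by (rule mult_right_mono)
      moreover have "0 \<le> 2 ^ CARD('n) * t" using t by simp
      ultimately show "(2 ^ j) powr (real CARD('n) / p) * b \<le> 2 ^ CARD('n) * t + 2 powr (real k * real CARD('n) / p) * b" by linarith
    qed
    finally show ?thesis .
  qed
  then show ?thesis by (simp add: R_def)
qed

subsection \<open>The self-improvement\<close>

text \<open>Almost every point with \<open>norm (F x) > 2 ^ n * t\<close> (n the dimension) lies in
  a dyadic cube P with average above that height. Enlarging P to 2P loses at most the factor 2^n, so
  P is high at \<open>t\<close>.\<close>

lemma weak_level_subset:
  fixes F :: "real^('n::finite) \<Rightarrow> complex"
  assumes Q: "Q \<in> cubes" and p: "p \<ge> 1" and t: "t > 0" and [measurable]: "F \<in> borel_measurable lebesgue"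
  shows "wmeas w {x\<in>cube_set Q. norm (F x) > 2 ^ CARD('n) * t} \<le> wmeas w (Om p F t Q)"
proof -
  define s where "s = 2 ^ CARD('n) * t"
  have s: "s > 0" using t by (simp add: s_def)
  let ?g = "\<lambda>x. ennreal (norm (F x) powr p)"
  let ?D = "dyads (\<lambda>P. (\<integral>\<^sup>+y\<in>cube_set P. ?g y \<partial>lebesgue) > ennreal (s powr p) * emeasure lebesgue (cube_set P)) Q"
  have sub: "cube_set P \<subseteq> Om p F t Q" if P: "P \<in> ?D" for P
  proof -
    have Pc: "P \<in> cubes" using dyads_cubes[OF Q P] by blast
    have "high p F t P"
    proof (rule ccontr)
      assume "\<not> high p F t P"
      then have "avgLp p (cube_set (dil 2 P)) F \<le> ennreal t" by (simp add: high_def not_less)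
      then have "avgLp p (cube_set P) F \<le> ennreal (2 ^ CARD('n) * t)"
        using Pc p t subcube_imp_subset[OF subcube_dil_self[of 2 P]]
        by (intro avgLp_mono_set_2[of P "dil 2 P"]) auto
      then have "(\<integral>\<^sup>+y\<in>cube_set P. ?g y \<partial>lebesgue) \<le> ennreal (s powr p) * emeasure lebesgue (cube_set P)"
        unfolding s_def[symmetric] using p s by (subst (asm) avgLp_le_iff[OF Pc]) auto
      moreover have "(\<integral>\<^sup>+y\<in>cube_set P. ?g y \<partial>lebesgue) > ennreal (s powr p) * emeasure lebesgue (cube_set P)"
        using P unfolding dyads_def by blast
      ultimately show False by simp
    qed
    then have "P \<in> dyads (high p F t) Q" using P unfolding dyads_def by blast
    then show ?thesis by blast
  qed
  have "AE x in lebesgue. x \<in> cube_set Q \<longrightarrow> ?g x > ennreal (s powr p) \<longrightarrow> (\<exists>P\<in>?D. x \<in> cube_set P)"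
    by (rule AE_dyadic_average[OF Q]) auto
  then have "AE x in lebesgue. x \<in> {x\<in>cube_set Q. norm (F x) > s} \<longrightarrow> x \<in> Om p F t Q"
  proof eventually_elim
    case (elim x)
    show ?case
    proof
      assume x: "x \<in> {x\<in>cube_set Q. norm (F x) > s}"
      then have "s powr p < norm (F x) powr p" using s p by (intro powr_less_mono2) auto
      then have "ennreal (s powr p) < ?g x" by (intro ennreal_lessI) auto
      then obtain P where "P \<in> ?D" "x \<in> cube_set P" using elim x by blast
      then show "x \<in> Om p F t Q" using sub by blast
    qed
  qed
  then show ?thesis
    unfolding wmeas_def s_def[symmetric]
    by (intro nn_integral_mono_AE) (auto elim!: eventually_mono simp: indicator_def)
qed

lemma Dq_finite_sum:
  fixes w :: "real^('n::finite) \<Rightarrow> real"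
  assumes "Dq q w a"
  obtains C where "C \<ge> 1" "\<And>Q S. Q \<in> cubes \<Longrightarrow> finite S \<Longrightarrow> S \<subseteq> cubes \<Longrightarrow> (\<And>R. R \<in> S \<Longrightarrow> cube_set R \<subseteq> cube_set Q) \<Longrightarrow>
    disjoint_family_on cube_set S \<Longrightarrow>
    (\<Sum>R\<in>S. ennreal (a R powr q) * wmeas w (cube_set R)) \<le> ennreal (C powr q * a Q powr q) * wmeas w (cube_set Q)"
proof -
  obtain C where C: "C \<ge> 1" "\<forall>Q\<in>cubes. \<forall>S. S \<subseteq> cubes \<and> (\<forall>R\<in>S. cube_set R \<subseteq> cube_set Q)
        \<and> disjoint_family_on cube_set S \<longrightarrow>
        infsum (\<lambda>R. ennreal (a R powr q) * wmeas w (cube_set R)) S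
          \<le> ennreal (C powr q * a Q powr q) * wmeas w (cube_set Q)"
    using assms unfolding Dq_def by blast
  show ?thesis
  proof (rule that[OF C(1)])
    fix Q :: "'n cube" and S :: "'n cube set"
    assume *: "Q \<in> cubes" "finite S" "S \<subseteq> cubes" "\<And>R. R \<in> S \<Longrightarrow> cube_set R \<subseteq> cube_set Q" "disjoint_family_on cube_set S"
    have "infsum (\<lambda>R. ennreal (a R powr q) * wmeas w (cube_set R)) S \<le> ennreal (C powr q * a Q powr q) * wmeas w (cube_set Q)"
      using C(2) * by blast
    then show "(\<Sum>R\<in>S. ennreal (a R powr q) * wmeas w (cube_set R)) \<le> ennreal (C powr q * a Q powr q) * wmeas w (cube_set Q)"
      using *(2) by simp
  qed
qed

text \<open>Chebyshev's inequality: each cube satisfies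
  \<open>1 \<le> b R powr q / s powr q\<close>, which may be inserted in the sum of the
  weights.\<close>

lemma bad_cubes:
  fixes w :: "real^('n::finite) \<Rightarrow> real"
  assumes w: "weight w" and q: "q > 0" and s: "s > 0" and M: "M \<ge> 0"
    and S: "countable S" "S \<subseteq> cubes" "disjoint_family_on cube_set S" "\<And>R. R \<in> S \<Longrightarrow> s \<le> b R"
    and fin: "\<And>F. finite F \<Longrightarrow> F \<subseteq> S \<Longrightarrow> (\<Sum>R\<in>F. ennreal (b R powr q) * wmeas w (cube_set R)) \<le> ennreal M"
  shows "wmeas w (\<Union>R\<in>S. cube_set R) \<le> ennreal (M / s powr q)"
proof -
  have "emeasure (density lebesgue (\<lambda>x. ennreal (w x))) (\<Union>R\<in>S. cube_set R) \<le> ennreal (M / s powr q)"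
  proof (rule emeasure_UN_le_of_finite[OF S(1)])
    fix F assume F: "finite F" "F \<subseteq> S"
    have "cube_set ` F \<subseteq> sets (density lebesgue (\<lambda>x. ennreal (w x)))" by (simp add: image_subset_iff)
    then have "emeasure (density lebesgue (\<lambda>x. ennreal (w x))) (\<Union>R\<in>F. cube_set R) \<le> (\<Sum>R\<in>F. wmeas w (cube_set R))"
      using emeasure_subadditive_finite[OF F(1), of cube_set "density lebesgue (\<lambda>x. ennreal (w x))"]
      by (simp add: wmeas_density[OF w])
    also have "\<dots> \<le> (\<Sum>R\<in>F. ennreal (1 / s powr q) * (ennreal (b R powr q) * wmeas w (cube_set R)))"
    proof (rule sum_mono)
      fix R assume "R \<in> F"
      then have "s \<le> b R" using F S(4) by blast
      then have "s powr q \<le> b R powr q" using s q by (intro powr_mono2) auto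
      then have "1 \<le> 1 / s powr q * b R powr q" using s by simp
      then have "ennreal 1 \<le> ennreal (1 / s powr q) * ennreal (b R powr q)"
        by (subst ennreal_mult[symmetric]) (auto intro: ennreal_leI)
      then have "1 * wmeas w (cube_set R) \<le> ennreal (1 / s powr q) * ennreal (b R powr q) * wmeas w (cube_set R)"
        by (intro mult_right_mono) auto
      then show "wmeas w (cube_set R) \<le> ennreal (1 / s powr q) * (ennreal (b R powr q) * wmeas w (cube_set R))"
        by (simp add: mult.assoc)
    qed
    also have "\<dots> \<le> ennreal (1 / s powr q) * ennreal M"
      unfolding sum_distrib_left[symmetric] by (intro mult_left_mono fin F) auto
    also have "\<dots> = ennreal (M / s powr q)"
      using M by (subst ennreal_mult[symmetric]) auto
    finally show "emeasure (density lebesgue (\<lambda>x. ennreal (w x))) (\<Union>R\<in>F. cube_set R) \<le> ennreal (M / s powr q)" .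
  qed simp
  then show ?thesis using S(1) by (simp add: wmeas_density[OF w])
qed

lemma weakLq_le:
  assumes W: "wmeas w (cube_set Q) = ennreal W" "W > 0" and q: "q > 0" and M: "M \<ge> 0"
    and le: "\<And>t. t > 0 \<Longrightarrow> ennreal (t powr q) * wmeas w {x\<in>cube_set Q. norm (g x) > t} \<le> ennreal (M powr q * W)"
  shows "weakLq w q Q g \<le> ennreal M"
  unfolding weakLq_def
proof (rule SUP_least)
  fix t :: real assume "t \<in> {0<..}"
  then have t: "t > 0" by simp
  obtain v where v: "v \<ge> 0" "wmeas w {x\<in>cube_set Q. norm (g x) > t} = ennreal v"
    using le[OF t] t by (cases "wmeas w {x\<in>cube_set Q. norm (g x) > t}") (auto simp: ennreal_mult_top top_unique)
  have "t powr q * v \<le> M powr q * W"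
    using le[OF t] v M W by (simp add: ennreal_mult[symmetric] ennreal_le_iff)
  then have "(v / W) \<le> (M / t) powr q" using t W M by (simp add: powr_divide field_simps)
  then have "(v / W) powr (1 / q) \<le> ((M / t) powr q) powr (1 / q)"
    using v W q by (intro powr_mono2) auto
  also have "\<dots> = M / t" using q M t by (simp add: powr_powr)
  finally have "t * (v / W) powr (1 / q) \<le> M" using t by (simp add: field_simps)
  moreover have "enn_powr (wmeas w {x\<in>cube_set Q. norm (g x) > t} / wmeas w (cube_set Q)) (1 / q) = ennreal ((v / W) powr (1 / q))"
    using v W by (simp add: divide_ennreal enn_powr_def)
  ultimately show "ennreal t * enn_powr (wmeas w {x\<in>cube_set Q. norm (g x) > t} / wmeas w (cube_set Q)) (1 / q) \<le> ennreal M"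
    using t by (simp add: ennreal_mult[symmetric] ennreal_leI)
qed

text \<open>In \<open>ennreal\<close> the quotient 0 / 0 is 0. Cubes of zero weight are treated
  apart because the main argument divides by their weight.\<close>

lemma weakLq_null:
  assumes "wmeas w (cube_set Q) = 0"
  shows "weakLq w q Q g = 0"
proof -
  have "wmeas w {x\<in>cube_set Q. norm (g x) > t} = 0" for t
    using wmeas_mono[of "{x\<in>cube_set Q. norm (g x) > t}" "cube_set Q" w] assms by (auto simp: subset_iff)
  then show ?thesis using assms by (simp add: weakLq_def enn_powr_def)
qed

context oscillation_family
begin

text \<open>The majorants of \<open>stopping_averages\<close>, to be used with the doubled cube in
  the place of \<open>Q\<close>: there the dilate of order k is the dilate of order k + 1 of the
  original cube. The constant 2^(4n) comes from the small indices of \<open>mk\<close>.\<close>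

lemma u_summable:
  fixes t :: real
  assumes a: "functional a" and Q: "Q \<in> cubes"
    and \<gamma>: "\<And>k. k \<ge> 1 \<Longrightarrow> mk CARD('n) p0 \<alpha> \<beta> k \<le> \<gamma> k"
    and sm: "summable (\<lambda>k. \<gamma> (k + 1) * a (dil (2 ^ (k + 1)) Q))"
  defines "u \<equiv> \<lambda>k::nat. 2 ^ CARD('n) * t + 2 powr (real k * real CARD('n) / p0) * a (dil (2 ^ k) Q)"
  shows "summable (\<lambda>k. \<alpha> (k + 2) * u (k + 2))"
    and "(\<Sum>k. \<alpha> (k + 2) * u (k + 2)) \<le> 2 ^ CARD('n) * SA * t + 2 ^ (4 * CARD('n)) * atilde \<gamma> a Q"
proof -
  note g0 = gamma_bounds(2)[of \<gamma>, OF \<gamma>] and gd = gamma_bounds(4)[of \<gamma>, OF \<gamma>]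
  let ?c = "\<lambda>k. \<alpha> (k + 2) * 2 powr (real (k + 2) * real CARD('n) / p0)"
  have dom: "summable (\<lambda>k. ?c k * a (dil (2 ^ (k + 2)) Q))"
    "(\<Sum>k. ?c k * a (dil (2 ^ (k + 2)) Q)) \<le> 2 ^ (4 * CARD('n)) * atilde \<gamma> a Q"
  proof -
    have c: "0 \<le> ?c k" "?c k \<le> 2 ^ (4 * CARD('n)) * \<gamma> (k + 1 + 1)" for k
      using alpha_nonneg[of "k + 2"] gd[of "k + 2"] by (simp_all add: numeral_eq_Suc)
    have e: "k + 2 = k + 1 + 1" for k :: nat by simp
    show "summable (\<lambda>k. ?c k * a (dil (2 ^ (k + 2)) Q))"
      "(\<Sum>k. ?c k * a (dil (2 ^ (k + 2)) Q)) \<le> 2 ^ (4 * CARD('n)) * atilde \<gamma> a Q"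
      using atilde_dominates[where c = ?c and M = "2 ^ (4 * CARD('n))" and i = 1, OF a Q g0 sm c] unfolding e by simp_all
  qed
  have eq: "\<alpha> (k + 2) * u (k + 2) = 2 ^ CARD('n) * t * \<alpha> (k + 2) + ?c k * a (dil (2 ^ (k + 2)) Q)" for k
    unfolding u_def by (simp add: algebra_simps)
  have sma: "summable (\<lambda>k. 2 ^ CARD('n) * t * \<alpha> (k + 2))" by (intro summable_mult alpha_summable)
  show "summable (\<lambda>k. \<alpha> (k + 2) * u (k + 2))" unfolding eq by (intro summable_add sma dom)
  have "(\<Sum>k. \<alpha> (k + 2) * u (k + 2)) = (\<Sum>k. 2 ^ CARD('n) * t * \<alpha> (k + 2)) + (\<Sum>k. ?c k * a (dil (2 ^ (k + 2)) Q))"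
    unfolding eq by (intro suminf_add[symmetric] sma dom)
  also have "(\<Sum>k. 2 ^ CARD('n) * t * \<alpha> (k + 2)) = 2 ^ CARD('n) * t * SA"
    unfolding SA_def by (rule suminf_mult[OF alpha_summable])
  finally show "(\<Sum>k. \<alpha> (k + 2) * u (k + 2)) \<le> 2 ^ CARD('n) * SA * t + 2 ^ (4 * CARD('n)) * atilde \<gamma> a Q"
    using dom(2) by (simp add: ac_simps)
qed

text \<open>The centre of the companion lies in Q, so the cube extends at most half a side of Q
  beyond Q, and 2Q in turn stays within one and a half sides of that centre. The first inclusion
  serves D_q, the second doubling.\<close>

lemma companion_cube:
  assumes Q: "Q \<in> cubes" and R: "R \<in> cubes" and RQ: "subcube R Q" and j: "snd Q = 2 ^ j * snd R"
  shows "cube_set (dil (2 ^ j) R) \<subseteq> cube_set (dil 2 Q)" "cube_set (dil 2 Q) \<subseteq> cube_set (dil 4 (dil (2 ^ j) R))"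
proof -
  have r: "snd R > 0" using R by (simp add: cubes_def)
  define L where "L = snd Q"
  have L: "L > 0" using Q by (simp add: L_def cubes_def)
  have i: "fst Q $ i \<le> fst R $ i" "fst R $ i + snd R \<le> fst Q $ i + L" for i
    using RQ by (auto simp: subcube_def L_def)
  have rL: "snd R \<le> L" using subcube_snd_le[OF RQ] by (simp add: L_def)
  have e: "(1 - 2 ^ j) * snd R / 2 = snd R / 2 - L / 2" "(1 + 2 ^ j) * snd R / 2 = snd R / 2 + L / 2"
    "(1 - 4 * 2 ^ j) * snd R / 2 = snd R / 2 - 2 * L" "(1 + 4 * 2 ^ j) * snd R / 2 = snd R / 2 + 2 * L"
    "(1 - 2) * snd Q / 2 = - L / 2" "(1 + 2) * snd Q / 2 = 3 * L / 2"
    unfolding L_def j by (simp_all add: algebra_simps diff_divide_distrib add_divide_distrib)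
  show "cube_set (dil (2 ^ j) R) \<subseteq> cube_set (dil 2 Q)"
  proof (rule dil_subset)
    fix k
    show "fst Q $ k + (1 - 2) * snd Q / 2 \<le> fst R $ k + (1 - 2 ^ j) * snd R / 2" unfolding e using i[of k] r by linarith
    show "fst R $ k + (1 + 2 ^ j) * snd R / 2 \<le> fst Q $ k + (1 + 2) * snd Q / 2" unfolding e using i[of k] r by linarith
  qed
  show "cube_set (dil 2 Q) \<subseteq> cube_set (dil 4 (dil (2 ^ j) R))"
    unfolding dil_dil
  proof (rule dil_subset)
    fix k
    show "fst R $ k + (1 - 4 * 2 ^ j) * snd R / 2 \<le> fst Q $ k + (1 - 2) * snd Q / 2" unfolding e using i[of k] r rL L by linarith
    show "fst Q $ k + (1 + 2) * snd Q / 2 \<le> fst R $ k + (1 + 4 * 2 ^ j) * snd R / 2" unfolding e using i[of k] r L by linarith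
  qed
qed

end

section \<open>The weak-type bound\<close>

context oscillation_family
begin

lemma weak_bound:
  fixes w :: "real^'n \<Rightarrow> real" and \<gamma> :: "nat \<Rightarrow> real"
  assumes q: "q > 0" and small: "small_sets_cond w" and LD: "level_decay p0 q q0 w" and a: "functional a"
    and \<gamma>: "\<And>k. k \<ge> 1 \<Longrightarrow> mk CARD('n) p0 \<alpha> \<beta> k \<le> \<gamma> k"
    and sm: "\<And>Q. Q \<in> cubes \<Longrightarrow> summable (\<lambda>k. \<gamma> (k + 1) * a (dil (2 ^ (k + 1)) Q))"
    and Dq: "Dq q w (atilde \<gamma> a)"
  shows "\<exists>C. \<forall>f. Lploc p0 f \<and>
            (\<forall>k::nat. \<forall>Q\<in>cubes. avgLp p0 (cube_set (dil (2 ^ k) Q)) (B Q f) \<le> ennreal (a (dil (2 ^ k) Q)))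
          \<longrightarrow> (\<forall>Q\<in>cubes. weakLq w q Q (B Q f) \<le> ennreal (C * atilde \<gamma> a (dil 2 Q)))"
proof -
  have w: "weight w" using small by (simp add: small_sets_cond_def)
  note g1 = gamma_bounds(1)[of \<gamma>, OF \<gamma>] and g0 = gamma_bounds(2)[of \<gamma>, OF \<gamma>]
  define N where "N = (2::real) ^ CARD('n)"
  have N: "N \<ge> 1" by (simp add: N_def)
  define A where "A Q = atilde \<gamma> a Q" for Q
  have A: "a (dil 2 Q) \<le> A Q" "0 \<le> A Q" if "Q \<in> cubes" for Q
    unfolding A_def using atilde_first[OF a that g0 g1 sm[OF that]] by auto
  obtain D where D: "D \<ge> 1" "\<And>Q. Q \<in> cubes \<Longrightarrow> wmeas w (cube_set (dil 4 Q)) \<le> ennreal D * wmeas w (cube_set Q)"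
    using doubling_weight[OF small] by blast
  obtain Cd where Cd: "Cd \<ge> 1" "\<And>Q S. Q \<in> cubes \<Longrightarrow> finite S \<Longrightarrow> S \<subseteq> cubes \<Longrightarrow> (\<And>R. R \<in> S \<Longrightarrow> cube_set R \<subseteq> cube_set Q) \<Longrightarrow>
    disjoint_family_on cube_set S \<Longrightarrow>
    (\<Sum>R\<in>S. ennreal (A R powr q) * wmeas w (cube_set R)) \<le> ennreal (Cd powr q * A Q powr q) * wmeas w (cube_set Q)"
    using Dq_finite_sum[OF Dq] unfolding A_def by blast
  define Cs where "Cs = Cd * D powr (1 / q)"
  have Cs: "Cs \<ge> 0" using Cd by (simp add: Cs_def)
  \<comment> \<open>One constant for both parts: 36 is the factor of \<open>square_average\<close>
    for S, the other summand bounds G once the height dominates \<open>atilde\<close> at the doubled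
    cube.\<close>
  define C1 where "C1 = 36 + KG * (N * SA + 2 ^ (4 * CARD('n)) + Cs)"
  have C1: "C1 \<ge> 36" using KG_pos N SA_nonneg Cs by (simp add: C1_def)
  have C1': "C1 \<ge> 1" using C1 by simp
  obtain \<epsilon> K where eps: "\<epsilon> > 0" and K: "K \<ge> 2" and good:
    "\<And>Q F t b. Q \<in> cubes \<Longrightarrow> F \<in> borel_measurable lebesgue \<Longrightarrow> t > 0 \<Longrightarrow>
      (\<And>R. R \<in> stopping p0 F t Q \<Longrightarrow> b R \<le> \<epsilon> * t \<Longrightarrow> decomposable p0 q0 F R (C1 * \<epsilon> * t) (C1 * t)) \<Longrightarrow>
      \<exists>\<kappa>. 2 \<le> \<kappa> \<and> \<kappa> \<le> K \<and> ennreal (\<kappa> powr q) * wmeas w (Om p0 F (\<kappa> * t) Q) \<le>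
        ennreal (K powr q) * wmeas w (\<Union>R\<in>{R\<in>stopping p0 F t Q. b R > \<epsilon> * t}. cube_set R) + ennreal (1/2) * wmeas w (Om p0 F t Q)"
    using good_lambda[OF small LD p0 q C1'] by blast
  \<comment> \<open>The bound of \<open>level_iteration\<close> divided by
    \<open>t0 powr q * W\<close>, after \<open>atilde\<close> at the doubled cube has been replaced
    by the larger \<open>t0\<close>.\<close>
  define M0 where "M0 = K powr q * (2 * (K powr q * (Cd powr q * D) / \<epsilon> powr q) + 1)"
  have M0: "M0 \<ge> 0" using K Cd D eps by (simp add: M0_def)
  define Cf where "Cf = N * (M0 + 1) powr (1 / q)"
  have Cf: "Cf \<ge> 0" using N by (simp add: Cf_def)
  \<comment> \<open>The starting height \<open>t0\<close> must be positive, while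
    \<open>N * A (dil 2 Q)\<close> may vanish. The claim is therefore made for all larger
    \<open>t0\<close>, and the limit is taken afterwards.\<close>
  have main: "weakLq w q Q (B Q f) \<le> ennreal (Cf * t0)"
    if f: "Lploc p0 f" and osc: "\<And>(k::nat) Q. Q \<in> cubes \<Longrightarrow> avgLp p0 (cube_set (dil (2 ^ k) Q)) (B Q f) \<le> ennreal (a (dil (2 ^ k) Q))"
      and Q: "Q \<in> cubes" and t0: "t0 > 0" "t0 \<ge> N * A (dil 2 Q)" and W0: "wmeas w (cube_set Q) \<noteq> 0" for f Q t0
  proof -
    define F where "F = B Q f"
    have F [measurable]: "F \<in> borel_measurable lebesgue" unfolding F_def using Q f by (intro Lploc_measurable[of p0]) simp
    have Q2: "dil 2 Q \<in> cubes" using Q by simp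
    define T where "T = A (dil 2 Q)"
    have T: "T \<ge> 0" unfolding T_def by (rule A(2)[OF Q2])
    have "1 * T \<le> N * T" using N T by (intro mult_right_mono) auto
    then have Tt0: "T \<le> t0" using t0 by (simp add: T_def)
    obtain W where W: "W > 0" "wmeas w (cube_set Q) = ennreal W"
      using wmeas_cube_finite[OF w Q] W0 by (cases "wmeas w (cube_set Q)") (auto simp: less_le)
    have w2: "wmeas w (cube_set (dil 2 Q)) \<le> ennreal (D * W)"
    proof -
      have "cube_set (dil 2 Q) \<subseteq> cube_set (dil 4 Q)" using Q by (intro subcube_imp_subset subcube_dil_dil) auto
      then have "wmeas w (cube_set (dil 2 Q)) \<le> wmeas w (cube_set (dil 4 Q))" by (rule wmeas_mono)
      also have "\<dots> \<le> ennreal D * ennreal W" using D(2)[OF Q] by (simp add: W(2))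
      finally show ?thesis using D W by (simp add: ennreal_mult)
    qed
    have subQ: "cube_set Q \<subseteq> cube_set (dil 2 Q)" using Q by (intro subcube_imp_subset subcube_dil_self) auto
    have notQ: "\<not> high p0 F t Q" if "t \<ge> t0" for t
    proof -
      have a4: "a (dil 4 Q) \<le> T" using A(1)[OF Q2] by (simp add: T_def dil_dil)
      have "avgLp p0 (cube_set (dil 4 Q)) F \<le> ennreal T"
        unfolding F_def using osc[OF Q, of 2] ennreal_leI[OF a4] by simp
      then have "avgLp p0 (cube_set (dil 2 Q)) F \<le> ennreal (2 ^ CARD('n) * T)"
        using Q p0 T by (intro avgLp_mono_set_2[of _ "dil 4 Q"] subcube_imp_subset subcube_dil_dil) auto
      also have "\<dots> \<le> ennreal t" using t0 that by (intro ennreal_leI) (simp add: N_def T_def)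
      finally show ?thesis by (simp add: high_def not_less)
    qed
    have shifted: "A (dil (2 ^ j) R) \<le> Cs * T" if R: "R \<in> cubes" and RQ: "subcube R Q" and j: "snd Q = 2 ^ j * snd R" for R j
    proof -
      let ?S = "dil (2 ^ j) R"
      have S: "?S \<in> cubes" using R by simp
      note sub = companion_cube[OF Q R RQ j]
      obtain V where V: "V \<ge> 0" "wmeas w (cube_set ?S) = ennreal V"
        using wmeas_cube_finite[OF w S] by (cases "wmeas w (cube_set ?S)") auto
      have wV: "wmeas w (cube_set (dil 2 Q)) \<le> ennreal (D * V)"
        using order_trans[OF wmeas_mono[OF sub(2), of w] D(2)[OF S]] V D by (simp add: ennreal_mult)
      have "ennreal W \<le> ennreal (D * V)" using order_trans[OF wmeas_mono[OF subQ, of w] wV] by (simp add: W(2))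
      then have "W \<le> D * V" using D V by (subst (asm) ennreal_le_iff) auto
      then have "D * V > 0" using W(1) by linarith
      then have V0: "V > 0" using V(1) by (cases "V = 0") auto
      \<comment> \<open>D_q for a family consisting of a single cube.\<close>
      have "(\<Sum>R\<in>{?S}. ennreal (A R powr q) * wmeas w (cube_set R)) \<le> ennreal (Cd powr q * A (dil 2 Q) powr q) * wmeas w (cube_set (dil 2 Q))"
        by (rule Cd(2)[OF Q2]) (use S sub in \<open>auto simp: disjoint_family_on_def\<close>)
      then have "ennreal (A ?S powr q) * ennreal V \<le> ennreal (Cd powr q * T powr q) * wmeas w (cube_set (dil 2 Q))"
        by (simp add: V(2) T_def)
      also have "\<dots> \<le> ennreal (Cd powr q * T powr q) * ennreal (D * V)"
        by (intro mult_left_mono wV) simp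
      finally have "ennreal (A ?S powr q * V) \<le> ennreal (Cd powr q * T powr q * (D * V))"
        using V D by (simp add: ennreal_mult)
      then have "A ?S powr q * V \<le> Cd powr q * T powr q * (D * V)"
        using V D by (subst (asm) ennreal_le_iff) auto
      then have "A ?S powr q * V \<le> (Cd powr q * T powr q * D) * V" by (simp only: mult.assoc)
      then have "A ?S powr q \<le> Cd powr q * T powr q * D" using V0 by (rule mult_right_le_imp_le)
      also have "\<dots> = (Cs * T) powr q"
        using Cd D T q by (simp add: Cs_def powr_mult powr_powr)
      finally have le: "A ?S powr q \<le> (Cs * T) powr q" .
      show ?thesis
      proof (rule ccontr)
        assume "\<not> ?thesis"
        then have "(Cs * T) powr q < A ?S powr q" using q Cs T by (intro powr_less_mono2) auto
        then show False using le by simp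
      qed
    qed
    have dec: "decomposable p0 q0 F R (C1 * \<epsilon> * t) (C1 * t)"
      if t: "t \<ge> t0" and R: "R \<in> stopping p0 F t Q" and le: "A R \<le> \<epsilon> * t" for R t
    proof -
      obtain x j where x: "x \<in> cube_set Q" "R = dy Q j x" "\<And>i. i < j \<Longrightarrow> \<not> high p0 F t (dy Q i x)"
        using R unfolding maxdy_def by blast
      have tp: "t > 0" using t t0 by linarith
      have Rc: "R \<in> cubes" unfolding x(2) using Q by simp
      have RQ: "subcube R Q" unfolding x(2) by (rule subcube_dy_Q[OF Q x(1)])
      have j: "snd Q = 2 ^ j * snd R" by (simp add: x(2))
      \<comment> \<open>The majorants of \<open>stopping_averages\<close>, with \<open>a\<close> at
        the dilates of 2Q so that the series is comparable with \<open>atilde\<close> at 2Q.\<close>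
      define u where "u k = 2 ^ CARD('n) * t + 2 powr (real k * real CARD('n) / p0) * a (dil (2 ^ k) (dil 2 Q))" for k :: nat
      have a0: "0 \<le> a (dil (2 ^ k) (dil 2 Q))" for k using a Q by (simp add: functional_def)
      have u0: "0 \<le> u k" for k unfolding u_def using tp a0 by (intro add_nonneg_nonneg mult_nonneg_nonneg) auto
      have ule: "avgLp p0 (cube_set (dil (2 ^ (k + 1)) R)) F \<le> ennreal (u k)" if k: "k \<ge> 1" for k
        unfolding u_def x(2)
      proof (rule stopping_averages[OF Q x(1) p0 tp k x(3) a0])
        have "dil (2 ^ k) (dil 2 Q) = dil (2 ^ (k + 1)) Q" by (simp add: dil_dil mult.commute)
        then show "avgLp p0 (cube_set (dil (2 ^ (k + 1)) Q)) F \<le> ennreal (a (dil (2 ^ k) (dil 2 Q)))"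
          unfolding F_def using osc[OF Q, of "k + 1"] by simp
      qed
      have usm: "summable (\<lambda>k. \<alpha> (k + 2) * u (k + 2))"
        "(\<Sum>k. \<alpha> (k + 2) * u (k + 2)) \<le> N * SA * t + 2 ^ (4 * CARD('n)) * T"
        using u_summable[OF a Q2 \<gamma> sm[OF Q2], of t] unfolding u_def N_def T_def A_def by simp_all
      have "decomposable p0 q0 F R (36 * atilde \<gamma> a R)
         (KG * ((\<Sum>k. \<alpha> (k + 2) * u (k + 2)) + atilde \<gamma> a (dil (2 ^ j) R)))"
        unfolding F_def by (rule local_decomposition[OF Q Rc RQ j f a osc[OF Rc] \<gamma> sm u0 ule[unfolded F_def] usm(1)]) auto
      moreover have "36 * atilde \<gamma> a R \<le> C1 * \<epsilon> * t"
      proof -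
        have "36 * A R \<le> C1 * (\<epsilon> * t)" using le C1 A(2)[OF Rc] by (intro mult_mono) auto
        then show ?thesis by (simp add: A_def mult.assoc)
      qed
      moreover have "KG * ((\<Sum>k. \<alpha> (k + 2) * u (k + 2)) + atilde \<gamma> a (dil (2 ^ j) R)) \<le> C1 * t"
      proof -
        have Tt: "T \<le> t" using Tt0 t by simp
        have "(\<Sum>k. \<alpha> (k + 2) * u (k + 2)) + atilde \<gamma> a (dil (2 ^ j) R) \<le> N * SA * t + 2 ^ (4 * CARD('n)) * T + Cs * T"
          using usm(2) shifted[OF Rc RQ j] by (simp add: A_def)
        also have "\<dots> \<le> N * SA * t + 2 ^ (4 * CARD('n)) * t + Cs * t"
          using Tt Cs by (intro add_mono mult_left_mono order_refl) auto
        finally have "KG * ((\<Sum>k. \<alpha> (k + 2) * u (k + 2)) + atilde \<gamma> a (dil (2 ^ j) R)) \<le> KG * (N * SA * t + 2 ^ (4 * CARD('n)) * t + Cs * t)"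
          using KG_pos by (intro mult_left_mono) auto
        also have "\<dots> = C1 * t - 36 * t" by (simp add: C1_def algebra_simps)
        finally show ?thesis using tp by linarith
      qed
      ultimately show ?thesis
        unfolding decomposable_def by (meson ennreal_leI order_trans)
    qed
    have bad: "wmeas w (\<Union>R\<in>{R\<in>stopping p0 F t Q. A R > \<epsilon> * t}. cube_set R) \<le> ennreal (Cd powr q * T powr q * (D * W) / (\<epsilon> * t) powr q)"
      if t: "t \<ge> t0" for t
    proof (rule bad_cubes[OF w q, where b = A])
      have tp: "t > 0" using t t0 by linarith
      show "\<epsilon> * t > 0" using eps tp by simp
      show "0 \<le> Cd powr q * T powr q * (D * W)" using D W by simp
      let ?S = "{R\<in>stopping p0 F t Q. A R > \<epsilon> * t}"
      have S: "R \<in> cubes \<and> subcube R Q" if "R \<in> stopping p0 F t Q" for R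
        using that maxdy_subset dyads_cubes[OF Q] by blast
      show "?S \<subseteq> cubes" using S by blast
      show "countable ?S" by (rule countable_subset[OF _ countable_maxdy]) auto
      show disj: "disjoint_family_on cube_set ?S"
        by (rule disjoint_family_on_mono[OF _ disjoint_maxdy[OF Q]]) auto
      show "\<epsilon> * t \<le> A R" if "R \<in> ?S" for R using that by simp
      fix E assume E: "finite E" "E \<subseteq> ?S"
      have "(\<Sum>R\<in>E. ennreal (A R powr q) * wmeas w (cube_set R)) \<le> ennreal (Cd powr q * A (dil 2 Q) powr q) * wmeas w (cube_set (dil 2 Q))"
      proof (rule Cd(2)[OF Q2 E(1)])
        show "E \<subseteq> cubes" using E S by blast
        show "cube_set R \<subseteq> cube_set (dil 2 Q)" if "R \<in> E" for R
          using that E S subcube_imp_subset subQ by blast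
        show "disjoint_family_on cube_set E" by (rule disjoint_family_on_mono[OF E(2) disj])
      qed
      also have "\<dots> \<le> ennreal (Cd powr q * T powr q) * ennreal (D * W)"
        unfolding T_def by (intro mult_left_mono w2) simp
      also have "\<dots> = ennreal (Cd powr q * T powr q * (D * W))"
        using D W by (subst ennreal_mult) auto
      finally show "(\<Sum>R\<in>E. ennreal (A R powr q) * wmeas w (cube_set R)) \<le> ennreal (Cd powr q * T powr q * (D * W))" .
    qed
    define v where "v t = enn2real (wmeas w (Om p0 F t Q))" for t
    have OmQ: "Om p0 F t Q \<subseteq> cube_set Q" for t
      using dyads_cubes[OF Q] subcube_imp_subset by blast
    have v: "wmeas w (Om p0 F t Q) = ennreal (v t)" for t
    proof -
      have "wmeas w (Om p0 F t Q) \<le> ennreal W" using wmeas_mono[OF OmQ, of w t] by (simp add: W(2))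
      then have "wmeas w (Om p0 F t Q) < top" by (rule le_less_trans) simp
      then show ?thesis by (simp add: v_def)
    qed
    have v0: "v t \<ge> 0" for t by (simp add: v_def)
    define Bd where "Bd = K powr q * (Cd powr q * T powr q * (D * W)) / \<epsilon> powr q"
    have Bd: "Bd \<ge> 0" using D W by (simp add: Bd_def)
    have level: "t powr q * v t \<le> K powr q * (2 * Bd + t0 powr q * W)" if t: "t \<ge> t0" for t
    proof (rule level_iteration[OF _ v0 t0(1) _ q K Bd _ t])
      show "v t \<le> v s" if "t0 \<le> s" "s \<le> t" for s t
      proof -
        have "ennreal (v t) \<le> ennreal (v s)" unfolding v[symmetric] using that by (intro wmeas_mono Om_antimono)
        then show ?thesis using v0 by (subst (asm) ennreal_le_iff) auto
      qed
      have "ennreal (v t0) \<le> ennreal W" unfolding v[symmetric] W(2)[symmetric] by (intro wmeas_mono OmQ)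
      then show "v t0 \<le> W" using W by (subst (asm) ennreal_le_iff) auto
      show "\<exists>\<kappa>\<ge>2. \<kappa> \<le> K \<and> \<kappa> powr q * v (\<kappa> * s) \<le> Bd / s powr q + v s / 2" if s: "t0 \<le> s" for s
      proof -
        have sp: "s > 0" using s t0 by linarith
        obtain \<kappa> where k: "2 \<le> \<kappa>" "\<kappa> \<le> K" "ennreal (\<kappa> powr q) * wmeas w (Om p0 F (\<kappa> * s) Q) \<le>
          ennreal (K powr q) * wmeas w (\<Union>R\<in>{R\<in>stopping p0 F s Q. A R > \<epsilon> * s}. cube_set R) + ennreal (1/2) * wmeas w (Om p0 F s Q)"
          using good[OF Q F sp, of A] dec[OF s] by blast
        note k(3)
        also have "ennreal (K powr q) * wmeas w (\<Union>R\<in>{R\<in>stopping p0 F s Q. A R > \<epsilon> * s}. cube_set R) + ennreal (1/2) * wmeas w (Om p0 F s Q)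
          \<le> ennreal (K powr q) * ennreal (Cd powr q * T powr q * (D * W) / (\<epsilon> * s) powr q) + ennreal (1/2) * ennreal (v s)"
          unfolding v by (intro add_right_mono mult_left_mono bad[OF s]) simp
        also have "\<dots> = ennreal (K powr q * (Cd powr q * T powr q * (D * W) / (\<epsilon> * s) powr q) + v s / 2)"
        proof -
          define Z where "Z = Cd powr q * T powr q * (D * W) / (\<epsilon> * s) powr q"
          have Z: "0 \<le> Z" using D W by (simp add: Z_def)
          have "ennreal (K powr q * Z + v s / 2) = ennreal (K powr q * Z) + ennreal (v s / 2)"
            using Z v0[of s] by (intro ennreal_plus mult_nonneg_nonneg) auto
          moreover have "ennreal (K powr q * Z) = ennreal (K powr q) * ennreal Z"
            using Z by (intro ennreal_mult) auto
          ultimately show ?thesis unfolding Z_def[symmetric] by (simp only: ennreal_half_mult[OF v0])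
        qed
        also have "K powr q * (Cd powr q * T powr q * (D * W) / (\<epsilon> * s) powr q) = Bd / s powr q"
          using eps sp by (simp add: Bd_def powr_mult)
        finally have "ennreal (\<kappa> powr q * v (\<kappa> * s)) \<le> ennreal (Bd / s powr q + v s / 2)"
          unfolding v using v0 by (subst ennreal_mult) auto
        then have "\<kappa> powr q * v (\<kappa> * s) \<le> Bd / s powr q + v s / 2"
          using Bd v0[of s] by (subst (asm) ennreal_le_iff) auto
        then show ?thesis using k by blast
      qed
    qed
    have "K powr q * (2 * Bd + t0 powr q * W) \<le> M0 * t0 powr q * W"
    proof -
      have "T powr q \<le> t0 powr q" using T Tt0 q by (intro powr_mono2) auto
      then have "Bd \<le> K powr q * (Cd powr q * t0 powr q * (D * W)) / \<epsilon> powr q"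
        unfolding Bd_def using D W by (intro divide_right_mono mult_left_mono mult_right_mono) auto
      then have "K powr q * (2 * Bd + t0 powr q * W) \<le> K powr q * (2 * (K powr q * (Cd powr q * t0 powr q * (D * W)) / \<epsilon> powr q) + t0 powr q * W)"
        by (intro mult_left_mono) auto
      also have "\<dots> = M0 * t0 powr q * W" by (simp add: M0_def algebra_simps add_divide_distrib)
      finally show ?thesis .
    qed
    then have level': "t powr q * v t \<le> M0 * t0 powr q * W" if "t \<ge> t0" for t using level[OF that] by linarith
    have cfq: "(Cf * t0) powr q * W = N powr q * (M0 + 1) * t0 powr q * W"
      using N M0 t0 q by (simp add: Cf_def powr_mult powr_powr)
    show ?thesis unfolding F_def[symmetric]
    proof (rule weakLq_le[OF W(2,1) q])
      show "0 \<le> Cf * t0" using Cf t0 by simp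
      fix \<tau> :: real assume tau: "\<tau> > 0"
      \<comment> \<open>\<open>weak_level_subset\<close> relates the height \<open>N * t\<close> of
        F to the level set at \<open>t\<close>.\<close>
      define t where "t = \<tau> / N"
      have t: "t > 0" "\<tau> = N * t" using tau N by (simp_all add: t_def)
      \<comment> \<open>Below \<open>t0\<close> no decay has been shown, but there
        \<open>\<tau> < N * t0\<close> and the weight of the whole cube is bound enough.\<close>
      have real_le: "\<tau> powr q * x \<le> (Cf * t0) powr q * W" if "x \<le> (if t \<ge> t0 then v t else W)" for x
      proof (cases "t \<ge> t0")
        case True
        have "\<tau> powr q * x \<le> \<tau> powr q * v t" using that True by (intro mult_left_mono) auto
        also have "\<dots> = N powr q * (t powr q * v t)" using t N by (simp add: powr_mult)
        also have "\<dots> \<le> N powr q * (M0 * t0 powr q * W)" by (intro mult_left_mono level'[OF True]) simp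
        also have "\<dots> \<le> N powr q * ((M0 + 1) * t0 powr q * W)" using W by (intro mult_left_mono mult_right_mono) auto
        finally show ?thesis unfolding cfq by (simp only: mult.assoc)
      next
        case False
        have "\<tau> powr q * x \<le> \<tau> powr q * W" using that False by (intro mult_left_mono) auto
        also have "\<dots> \<le> (N * t0) powr q * W"
          using t N False q W by (intro mult_right_mono powr_mono2) auto
        also have "\<dots> = N powr q * (1 * t0 powr q * W)" using N t0 by (simp add: powr_mult)
        also have "\<dots> \<le> N powr q * ((M0 + 1) * t0 powr q * W)"
          using W M0 by (intro mult_left_mono mult_right_mono) auto
        finally show ?thesis unfolding cfq by (simp only: mult.assoc)
      qed
      let ?E = "{x\<in>cube_set Q. norm (F x) > \<tau>}"
      have "wmeas w ?E \<le> ennreal (if t \<ge> t0 then v t else W)"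
      proof (cases "t \<ge> t0")
        case True
        then show ?thesis using weak_level_subset[OF Q p0 t(1) F, of w] by (simp add: t(2) N_def v)
      next
        case False
        then show ?thesis using wmeas_mono[of ?E "cube_set Q" w] W by auto
      qed
      then have "ennreal (\<tau> powr q) * wmeas w ?E \<le> ennreal (\<tau> powr q) * ennreal (if t \<ge> t0 then v t else W)"
        by (rule mult_left_mono) simp
      also have "\<dots> = ennreal (\<tau> powr q * (if t \<ge> t0 then v t else W))"
        using v0 W by (subst ennreal_mult) auto
      also have "\<dots> \<le> ennreal ((Cf * t0) powr q * W)" by (intro ennreal_leI real_le order_refl)
      finally show "ennreal (\<tau> powr q) * wmeas w ?E \<le> ennreal ((Cf * t0) powr q * W)" .
    qed
  qed
  show ?thesis
  proof (intro exI[of _ "Cf * N"] allI impI ballI)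
    fix f and Q :: "'n cube"
    assume "Lploc p0 f \<and> (\<forall>k::nat. \<forall>Q\<in>cubes. avgLp p0 (cube_set (dil (2 ^ k) Q)) (B Q f) \<le> ennreal (a (dil (2 ^ k) Q)))"
    then have f: "Lploc p0 f" and osc: "\<And>(k::nat) Q. Q \<in> cubes \<Longrightarrow> avgLp p0 (cube_set (dil (2 ^ k) Q)) (B Q f) \<le> ennreal (a (dil (2 ^ k) Q))"
      by auto
    assume Q: "Q \<in> cubes"
    have T: "0 \<le> A (dil 2 Q)" by (rule A(2)) (use Q in simp)
    show "weakLq w q Q (B Q f) \<le> ennreal (Cf * N * atilde \<gamma> a (dil 2 Q))"
    proof (cases "wmeas w (cube_set Q) = 0")
      case False
      show ?thesis unfolding A_def[symmetric]
      proof (rule ennreal_le_epsilon)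
        fix e :: real assume e: "e > 0"
        \<comment> \<open>Chosen so that \<open>Cf * d \<le> e\<close>; the summand 1 covers
          \<open>Cf = 0\<close>.\<close>
        define d where "d = e / (Cf + 1)"
        have d: "d > 0" using e Cf by (simp add: d_def)
        have "weakLq w q Q (B Q f) \<le> ennreal (Cf * (N * A (dil 2 Q) + d))"
          by (rule main[OF f osc Q _ _ False]) (use d N T in \<open>auto intro: add_nonneg_pos\<close>)
        also have "\<dots> \<le> ennreal (Cf * N * A (dil 2 Q) + e)"
        proof (rule ennreal_leI)
          have "Cf * d \<le> (Cf + 1) * d" using d by (intro mult_right_mono) auto
          also have "\<dots> = e" using Cf by (simp add: d_def)
          finally show "Cf * (N * A (dil 2 Q) + d) \<le> Cf * N * A (dil 2 Q) + e" by (simp add: distrib_left mult.assoc)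
        qed
        also have "\<dots> = ennreal (Cf * N * A (dil 2 Q)) + ennreal e"
          using Cf N T e by (intro ennreal_plus) auto
        finally show "weakLq w q Q (B Q f) \<le> ennreal (Cf * N * A (dil 2 Q)) + ennreal e" .
      qed
    qed (simp add: weakLq_null)
  qed
qed

end

text \<open>\<open>atilde\<close> is a series of reals, so the requirement that it be finite on
  every cube appears as a summability hypothesis. \<open>C0\<close> is chosen after the dimension,
  \<open>p0\<close>, \<open>Cp0\<close>, \<open>\<alpha>\<close> and \<open>\<beta>\<close> only,
  and \<open>C\<close> before \<open>f\<close> and \<open>Q\<close>; this order of quantifiers
  expresses the stated dependence of the constants.\<close>

theorem mainTheorem7:
  fixes p0 Cp0 :: real and \<alpha> \<beta> :: "nat \<Rightarrow> real"
  assumes "1 \<le> p0"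
  shows "\<exists>C0>0. \<forall>(q::real) (q0::ennreal) (B :: 'n cube \<Rightarrow> 'n op) (a :: 'n cube \<Rightarrow> real)
           (w :: (real^'n) \<Rightarrow> real) (\<gamma> :: nat \<Rightarrow> real).
     p0 < q \<and> ennreal q < q0 \<and> O_class p0 q0 Cp0 \<alpha> \<beta> B \<and> functional a \<and>
     (if q0 = \<infinity> then Ainf w else RH (enn2real q0 / (enn2real q0 - q)) w) \<and>
     (\<forall>k\<ge>1. \<gamma> k \<ge> C0 * mk CARD('n) p0 \<alpha> \<beta> k) \<and>
     (\<forall>Q\<in>cubes. summable (\<lambda>k. \<gamma> (k + 1) * a (dil (2 ^ (k + 1)) Q))) \<and>
     Dq q w (atilde \<gamma> a)
     \<longrightarrow> (\<exists>C. \<forall>f. Lploc p0 f \<and>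
            (\<forall>k::nat. \<forall>Q\<in>cubes. avgLp p0 (cube_set (dil (2 ^ k) Q)) (B Q f) \<le> ennreal (a (dil (2 ^ k) Q)))
          \<longrightarrow> (\<forall>Q\<in>cubes. weakLq w q Q (B Q f) \<le> ennreal (C * atilde \<gamma> a (dil 2 Q))))"
proof (rule exI[of _ "1::real"], intro conjI[OF zero_less_one] allI impI, elim conjE)
  fix q q0 and B :: "'n cube \<Rightarrow> 'n op" and a :: "'n cube \<Rightarrow> real" and w :: "real^'n \<Rightarrow> real" and \<gamma> :: "nat \<Rightarrow> real"
  assume q: "p0 < q" "ennreal q < q0" and O: "O_class p0 q0 Cp0 \<alpha> \<beta> B" and a: "functional a"
    and w: "if q0 = \<infinity> then Ainf w else RH (enn2real q0 / (enn2real q0 - q)) w"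
    and \<gamma>: "\<forall>k\<ge>1. \<gamma> k \<ge> 1 * mk CARD('n) p0 \<alpha> \<beta> k"
    and sm: "\<forall>Q\<in>cubes. summable (\<lambda>k. \<gamma> (k + 1) * a (dil (2 ^ (k + 1)) Q))"
    and Dq: "Dq q w (atilde \<gamma> a)"
  have "ennreal p0 < q0"
    using le_less_trans[OF ennreal_leI q(2), of p0] q(1) by simp
  then interpret oscillation_family p0 Cp0 q0 \<alpha> \<beta> B
    using assms O by unfold_locales
  have "small_sets_cond w \<and> level_decay p0 q q0 w"
  proof (cases "q0 = \<infinity>")
    case True
    then show ?thesis using w Ainf_imp_small_sets_cond[of w] level_decay_infinity[OF assms, where w = w and q = q] by simp
  next
    case False
    define r where "r = enn2real q0"
    have r: "q0 = ennreal r" "q < r"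
      using False q assms by (cases q0; auto simp: r_def ennreal_less_iff)+
    have RH: "RH (r / (r - q)) w" using w False by (simp add: r_def)
    \<comment> \<open>r / (r - q) is the exponent conjugate to r / q, that is (q0/q)'.\<close>
    have "r / (r - q) > 1" using r q assms by (simp add: less_divide_eq)
    then show ?thesis
      using RH_imp_small_sets_cond[OF RH] level_decay_RH[OF assms q(1) r(2) RH] r(1) by simp
  qed
  then show "\<exists>C. \<forall>f. Lploc p0 f \<and>
            (\<forall>k::nat. \<forall>Q\<in>cubes. avgLp p0 (cube_set (dil (2 ^ k) Q)) (B Q f) \<le> ennreal (a (dil (2 ^ k) Q)))
          \<longrightarrow> (\<forall>Q\<in>cubes. weakLq w q Q (B Q f) \<le> ennreal (C * atilde \<gamma> a (dil 2 Q)))"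
    using q assms a \<gamma> sm Dq by (intro weak_bound) auto
qed

end
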